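(* Let $M$ be a closed (compact, without boundary) $n$-manifold and let $F$ and $\tilde F$ be Finsler metrics on $M$ which are Einstein metrics with $$\mathbf{Ric}(y)=(n-1)\lambda F^2(y),\qquad \widetilde{\mathbf{Ric}}(y)=(n-1)\tilde\lambda \tilde F^2(y)\quad (y\in TM),$$ where $\lambda,\tilde\lambda\in\{-1,0,1\}$. Suppose that $\tilde F$ is pointwise projectively related to $F$. Then $\lambda$ and $\tilde\lambda$ have the same sign. Moreover: (i) If $\lambda=1=\tilde\lambda$, then along any unit speed geodesic $c(t)$ of $F$, $$\tilde F(\dot c(t))=\frac{2}{\big(a^2-1/a^2-b^2\big)\cos(2t)+2ab\sin(2t)+\big(a^2+1/a^2+b^2\big)},$$ where $a>0$ and $-\infty<b<\infty$ are constants (depending on $c$). Consequently, every unit speed geodesic segment $c$ of $F$ of $F$-length $\pi$ is also (as a point set) a geodesic segment of $\tilde F$, and its $\tilde F$-length is $\pi$. (ii) If $\lambda=0=\tilde\lambda$, then along any geodesic $c(t)$ of $F$ or of $\tilde F$, the ratio $F(\dot c(t))/\tilde F(\dot c(t))$ is constant. (iii) If $\lambda=-1=\tilde\lambda$, then $\tilde F=F$.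
   Context: A Finsler metric on a manifold $M$ is a function $F:TM\to[0,\infty)$, smooth on $TM\setminus\{0\}$, such that on each tangent space $F$ is positively homogeneous of degree one ($F(\lambda y)=\lambda F(y)$ for $\lambda>0$; reversibility $F(-y)=F(y)$ is not assumed) and, for $y\neq 0$, the matrix $g_{ij}(y)=\frac12\frac{\partial^2[F^2]}{\partial y^i\partial y^j}(y)$ is positive definite. In local coordinates $(x^i,y^i)$ on $TM$ set $G^i(y)=\frac14 g^{il}\big\{\frac{\partial^2[F^2]}{\partial x^k\partial y^l}y^k-\frac{\partial[F^2]}{\partial x^l}\big\}$. A curve $c(t)$ with coordinates $x^i(t)$ is a geodesic of $F$ if $\ddot x^i+2G^i(\dot x)=0$; it is unit speed if $F(\dot c)=1$. The Riemann curvature is $\mathbf R_y(u)=R^i_k(y)u^k\partial/\partial x^i$ with $R^i_k=2\frac{\partial G^i}{\partial x^k}-\frac{\partial^2G^i}{\partial x^j\partial y^k}y^j+2G^j\frac{\partial^2G^i}{\partial y^j\partial y^k}-\frac{\partial G^i}{\partial y^j}\frac{\partial G^j}{\partial y^k}$, and the Ricci curvature $\mathbf{Ric}(y)$ is the trace of $\mathbf R_y$. $F$ is an Einstein metric with constant $\lambda$ if $\mathbf{Ric}(y)=(n-1)\lambda F^2(y)$ for all $y$. Two Finsler metrics $F,\tilde F$ on $M$ are pointwise projectively related if they have the same geodesics as point sets (every geodesic of one is, after an orientation-preserving reparametrization, a geodesic of the other). The $F$-length of a curve $c$ on an interval $I$ is $\int_I F(\dot c(t))\,dt$. Quantities with a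 tilde refer to $\tilde F$.
   Formalization: The dimension n is assumed to be at least 2; for n = 1 the Einstein condition reads 0 = 0 for every λ, so on the circle with F̃ = F one may take λ = 1 and λ̃ = 0, and the claim that the signs agree fails. *)

theory Defs
  imports "HOL-Analysis.Analysis"
begin

fun Ck :: "nat \<Rightarrow> 'a::real_normed_vector set \<Rightarrow> ('a \<Rightarrow> 'b::real_normed_vector) \<Rightarrow> bool" where
  "Ck 0 S f = continuous_on S f"
| "Ck (Suc k) S f = ((\<forall>x\<in>S. f differentiable (at x)) \<and>
      (\<forall>v. Ck k S (\<lambda>x. frechet_derivative f (at x) v)))"

definition smooth_on :: "'a::real_normed_vector set \<Rightarrow> ('a \<Rightarrow> 'b::real_normed_vector) \<Rightarrow> bool" where
  "smooth_on S f \<longleftrightarrow> open S \<and> (\<forall>k. Ck k S f)"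

type_synonym ('m, 'n) chart = "'m set \<times> ('m \<Rightarrow> real^'n)"

definition is_chart :: "('m::topological_space, 'n::finite) chart \<Rightarrow> bool" where
  "is_chart ch \<longleftrightarrow> (case ch of (U, \<phi>) \<Rightarrow>
      open U \<and> open (\<phi> ` U) \<and> homeomorphism U (\<phi> ` U) \<phi> (inv_into U \<phi>))"

definition smooth_atlas :: "('m::topological_space, 'n::finite) chart set \<Rightarrow> bool" where
  "smooth_atlas A \<longleftrightarrow> (\<forall>ch\<in>A. is_chart ch) \<and> (\<Union>(fst ` A) = UNIV) \<and>
     (\<forall>(U, \<phi>)\<in>A. \<forall>(V, \<psi>)\<in>A. smooth_on (\<phi> ` (U \<inter> V)) (\<psi> \<circ> inv_into U \<phi>))"

definition closed_manifold :: "('m::{t2_space, second_countable_topology}, 'n::finite) chart set \<Rightarrow> bool" where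
  "closed_manifold A \<longleftrightarrow> compact (UNIV :: 'm set) \<and> smooth_atlas A"

text \<open>A function on TM is represented by its local expressions: F ch x y is the value of F
  at the tangent vector with coordinates y at the point with coordinates x in chart ch.
  Coordinate change of a tangent vector is by the differential of the transition map.\<close>

definition coord_change :: "('m, 'n::finite) chart \<Rightarrow> ('m, 'n) chart \<Rightarrow> 'm \<Rightarrow> real^'n \<Rightarrow> real^'n" where
  "coord_change ch ch' p y = (case ch of (U, \<phi>) \<Rightarrow> case ch' of (V, \<psi>) \<Rightarrow>
      frechet_derivative (\<psi> \<circ> inv_into U \<phi>) (at (\<phi> p)) y)"

definition Lsq :: "(('m, 'n::finite) chart \<Rightarrow> real^'n \<Rightarrow> real^'n \<Rightarrow> real) \<Rightarrow> ('m, 'n) chart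
                   \<Rightarrow> (real^'n) \<times> (real^'n) \<Rightarrow> real" where
  "Lsq F ch p = (F ch (fst p) (snd p))\<^sup>2"

definition pdx :: "'n::finite \<Rightarrow> ((real^'n) \<times> (real^'n) \<Rightarrow> real) \<Rightarrow> (real^'n) \<times> (real^'n) \<Rightarrow> real" where
  "pdx k f p = frechet_derivative f (at p) (axis k 1, 0)"

definition pdy :: "'n::finite \<Rightarrow> ((real^'n) \<times> (real^'n) \<Rightarrow> real) \<Rightarrow> (real^'n) \<times> (real^'n) \<Rightarrow> real" where
  "pdy k f p = frechet_derivative f (at p) (0, axis k 1)"

definition gmat :: "(('m, 'n::finite) chart \<Rightarrow> real^'n \<Rightarrow> real^'n \<Rightarrow> real) \<Rightarrow> ('m, 'n) chart
                    \<Rightarrow> (real^'n) \<times> (real^'n) \<Rightarrow> real^'n^'n" where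
  "gmat F ch p = (\<chi> i j. (1/2) * pdy i (pdy j (Lsq F ch)) p)"

definition finsler_metric :: "('m::topological_space, 'n::finite) chart set
      \<Rightarrow> (('m, 'n) chart \<Rightarrow> real^'n \<Rightarrow> real^'n \<Rightarrow> real) \<Rightarrow> bool" where
  "finsler_metric A F \<longleftrightarrow>
     (\<forall>ch\<in>A. \<forall>x\<in>snd ch ` fst ch. \<forall>y. F ch x y \<ge> 0) \<and>
     (\<forall>ch\<in>A. \<forall>x\<in>snd ch ` fst ch. \<forall>y. \<forall>l>0. F ch x (l *\<^sub>R y) = l * F ch x y) \<and>
     (\<forall>ch\<in>A. smooth_on ((snd ch ` fst ch) \<times> (UNIV - {0})) (\<lambda>p. F ch (fst p) (snd p))) \<and>
     (\<forall>ch\<in>A. \<forall>x\<in>snd ch ` fst ch. \<forall>y. y \<noteq> 0 \<longrightarrow>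
        (\<forall>\<xi>::real^'n. \<xi> \<noteq> 0 \<longrightarrow> (\<Sum>i\<in>UNIV. \<Sum>j\<in>UNIV. gmat F ch (x, y) $ i $ j * \<xi> $ i * \<xi> $ j) > 0)) \<and>
     (\<forall>ch\<in>A. \<forall>ch'\<in>A. \<forall>p\<in>fst ch \<inter> fst ch'. \<forall>y.
        F ch' (snd ch' p) (coord_change ch ch' p y) = F ch (snd ch p) y)"

definition Gc :: "(('m, 'n::finite) chart \<Rightarrow> real^'n \<Rightarrow> real^'n \<Rightarrow> real) \<Rightarrow> ('m, 'n) chart
                  \<Rightarrow> 'n \<Rightarrow> (real^'n) \<times> (real^'n) \<Rightarrow> real" where
  "Gc F ch i p = (1/4) * (\<Sum>l\<in>UNIV. matrix_inv (gmat F ch p) $ i $ l *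
       ((\<Sum>k\<in>UNIV. pdx k (pdy l (Lsq F ch)) p * snd p $ k) - pdx l (Lsq F ch) p))"

definition Gvec :: "(('m, 'n::finite) chart \<Rightarrow> real^'n \<Rightarrow> real^'n \<Rightarrow> real) \<Rightarrow> ('m, 'n) chart
                  \<Rightarrow> (real^'n) \<times> (real^'n) \<Rightarrow> real^'n" where
  "Gvec F ch p = (\<chi> i. Gc F ch i p)"

definition Rc :: "(('m, 'n::finite) chart \<Rightarrow> real^'n \<Rightarrow> real^'n \<Rightarrow> real) \<Rightarrow> ('m, 'n) chart
                  \<Rightarrow> 'n \<Rightarrow> 'n \<Rightarrow> (real^'n) \<times> (real^'n) \<Rightarrow> real" where
  "Rc F ch i k p =
      2 * pdx k (Gc F ch i) p
    - (\<Sum>j\<in>UNIV. pdx j (pdy k (Gc F ch i)) p * snd p $ j)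
    + 2 * (\<Sum>j\<in>UNIV. Gc F ch j p * pdy j (pdy k (Gc F ch i)) p)
    - (\<Sum>j\<in>UNIV. pdy j (Gc F ch i) p * pdy k (Gc F ch j) p)"

definition Ric :: "(('m, 'n::finite) chart \<Rightarrow> real^'n \<Rightarrow> real^'n \<Rightarrow> real) \<Rightarrow> ('m, 'n) chart
                  \<Rightarrow> real^'n \<Rightarrow> real^'n \<Rightarrow> real" where
  "Ric F ch x y = (\<Sum>i\<in>UNIV. Rc F ch i i (x, y))"

definition einstein :: "('m::topological_space, 'n::finite) chart set
      \<Rightarrow> (('m, 'n) chart \<Rightarrow> real^'n \<Rightarrow> real^'n \<Rightarrow> real) \<Rightarrow> real \<Rightarrow> bool" where
  "einstein A F c \<longleftrightarrow> (\<forall>ch\<in>A. \<forall>x\<in>snd ch ` fst ch. \<forall>y. y \<noteq> 0 \<longrightarrow>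
      Ric F ch x y = (real CARD('n) - 1) * c * (F ch x y)\<^sup>2)"

definition cvel :: "('m, 'n::finite) chart \<Rightarrow> real set \<Rightarrow> (real \<Rightarrow> 'm) \<Rightarrow> real \<Rightarrow> real^'n" where
  "cvel ch I c t = vector_derivative (snd ch \<circ> c) (at t within I)"

definition geodesic :: "('m::topological_space, 'n::finite) chart set
      \<Rightarrow> (('m, 'n) chart \<Rightarrow> real^'n \<Rightarrow> real^'n \<Rightarrow> real) \<Rightarrow> real set \<Rightarrow> (real \<Rightarrow> 'm) \<Rightarrow> bool" where
  "geodesic A F I c \<longleftrightarrow> is_interval I \<and> (\<exists>a b. a < b \<and> a \<in> I \<and> b \<in> I) \<and> continuous_on I c \<and>
     (\<forall>ch\<in>A. \<forall>t\<in>I. c t \<in> fst ch \<longrightarrow>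
        (snd ch \<circ> c) differentiable (at t within I) \<and> cvel ch I c t \<noteq> 0 \<and>
        (\<exists>acc. (cvel ch I c has_vector_derivative acc) (at t within I) \<and>
               acc + 2 *\<^sub>R Gvec F ch (snd ch (c t), cvel ch I c t) = 0))"

text \<open>F(c'(t)), computed in some chart around c(t) (independent of the chart).\<close>
definition speed :: "('m, 'n::finite) chart set
      \<Rightarrow> (('m, 'n) chart \<Rightarrow> real^'n \<Rightarrow> real^'n \<Rightarrow> real) \<Rightarrow> real set \<Rightarrow> (real \<Rightarrow> 'm) \<Rightarrow> real \<Rightarrow> real" where
  "speed A F I c t = (let ch = (SOME ch. ch \<in> A \<and> c t \<in> fst ch) in
      F ch (snd ch (c t)) (cvel ch I c t))"

definition flength :: "('m, 'n::finite) chart set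
      \<Rightarrow> (('m, 'n) chart \<Rightarrow> real^'n \<Rightarrow> real^'n \<Rightarrow> real) \<Rightarrow> real set \<Rightarrow> (real \<Rightarrow> 'm) \<Rightarrow> real" where
  "flength A F I c = integral I (speed A F I c)"

definition reparam :: "real set \<Rightarrow> real set \<Rightarrow> (real \<Rightarrow> real) \<Rightarrow> bool" where
  "reparam J I \<sigma> \<longleftrightarrow> is_interval J \<and> bij_betw \<sigma> J I \<and> strict_mono_on J \<sigma> \<and>
     (\<forall>s\<in>J. \<exists>d>0. (\<sigma> has_real_derivative d) (at s within J))"

definition proj_related :: "('m::topological_space, 'n::finite) chart set
      \<Rightarrow> (('m, 'n) chart \<Rightarrow> real^'n \<Rightarrow> real^'n \<Rightarrow> real)
      \<Rightarrow> (('m, 'n) chart \<Rightarrow> real^'n \<Rightarrow> real^'n \<Rightarrow> real) \<Rightarrow> bool" where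
  "proj_related A F F' \<longleftrightarrow>
     (\<forall>I c. geodesic A F I c \<longrightarrow> (\<exists>J \<sigma>. reparam J I \<sigma> \<and> geodesic A F' J (c \<circ> \<sigma>))) \<and>
     (\<forall>I c. geodesic A F' I c \<longrightarrow> (\<exists>J \<sigma>. reparam J I \<sigma> \<and> geodesic A F J (c \<circ> \<sigma>)))"

end

theory Submission
  imports Defs
begin

text \<open>
  Projective relatedness forces \<open>Gt = G + P y\<close> for the spray coefficients, and applying the
  spray \<open>S\<close> of \<open>F\<close> to \<open>Ft\<close> identifies the factor as \<open>P = S(Ft) / (2 Ft)\<close>. Tracing the
  curvature formula gives \<open>Rict = Ric + (n - 1) (P\<^sup>2 - S P)\<close>, so for Einstein metrics, along every
  geodesic of \<open>F\<close>,
  \<open>F' = 0\<close>, \<open>Ft' = 2 P Ft\<close> and \<open>P' = P\<^sup>2 - lamt Ft\<^sup>2 + lam F\<^sup>2\<close>.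

  Instead of following geodesics for all time, one looks at extrema on the compact sphere bundle.
  At a maximum of \<open>Ft / F\<close>, \<open>P = 0\<close> and \<open>P' \<le> 0\<close>, that is \<open>lam \<le> lamt (max Ft / F)\<^sup>2\<close>; together
  with the same inequality for the exchanged metrics this yields the equality of signs and the
  case \<open>-1\<close>. In the flat case \<open>p = P / F\<close> satisfies \<open>p' = F p\<^sup>2\<close>, so \<open>p\<close> vanishes at its extrema and
  hence everywhere. In the spherical case, on a unit speed geodesic \<open>w = 1 / Ft\<close> solves
  \<open>w'' + 4 w = const\<close>, and \<open>1 / w\<close> is the angular velocity of a curve whose polar angle grows by
  \<open>pi\<close> over each interval of length \<open>pi\<close>.
\<close>

section \<open>Smooth functions\<close>

text \<open>\<open>geodesic\<close> imposes its equation in every chart, while a differential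
  equation can be solved only inside one. The bridge is that the Euler-Lagrange expression of F^2
  changes as a covector between charts; the transformation law of the coefficients G themselves is
  never computed.

  The factor \<open>P\<close> is a formula in one chart, but a maximum over the sphere bundle makes
  sense only for a function on TM. Chart independence is read off from the fact that 2 P Ft is the
  derivative of Ft along a geodesic with prescribed initial velocity, a number that no chart can
  change.

  Looking at extrema means that arbitrarily short geodesics suffice: neither completeness nor a
  global geodesic flow is constructed, and local solvability of the spray equation is the only
  existence theorem needed.

  Having the same geodesics is a statement about curves up to a reparametrization whose derivative
  is merely positive at each point. The relation between the spray coefficients has to be extracted
  from it without assuming that this derivative is continuous.\<close>

lemma Ck_cong:
  assumes "open S" "\<And>x. x \<in> S \<Longrightarrow> f x = g x" "Ck k S f"
  shows "Ck k S g"
  using assms(2,3)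
proof (induction k arbitrary: f g)
  case 0
  then show ?case by (simp cong: continuous_on_cong)
next
  case (Suc k)
  have eq: "frechet_derivative f (at x) = frechet_derivative g (at x)" if "x \<in> S" for x
    using Suc.prems that assms(1) by (intro frechet_derivative_transform_within_open) auto
  have "g differentiable (at x)" if "x \<in> S" for x
  proof -
    have "(f has_derivative frechet_derivative f (at x)) (at x)"
      using Suc.prems(2) that by (auto simp flip: frechet_derivative_works)
    then show ?thesis
      unfolding differentiable_def
      by (intro exI) (rule has_derivative_transform_within_open[OF _ assms(1) that Suc.prems(1)])
  qed
  moreover have "Ck k S (\<lambda>x. frechet_derivative g (at x) v)" for v
    using Suc.IH[of "\<lambda>x. frechet_derivative f (at x) v" "\<lambda>x. frechet_derivative g (at x) v"]
      Suc.prems eq by auto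
  ultimately show ?case by auto
qed

lemma Ck_Suc_imp: "Ck (Suc k) S f \<Longrightarrow> Ck k S f"
proof (induction k arbitrary: f)
  case 0
  then show ?case
    by (auto intro!: continuous_at_imp_continuous_on differentiable_imp_continuous_within)
next
  case (Suc k)
  have "Ck k S (\<lambda>x. frechet_derivative f (at x) v)" for v
    using Suc.prems by (intro Suc.IH) simp
  then show ?case using Suc.prems by simp
qed

lemma Ck_has_derivative:
  "Ck (Suc k) S f \<Longrightarrow> x \<in> S \<Longrightarrow> (f has_derivative frechet_derivative f (at x)) (at x)"
  by (simp flip: frechet_derivative_works)

text \<open>\<open>Ck\<close> refers to \<open>frechet_derivative\<close>, which is defined by
  choice. With this rule any explicit formula for the derivative may be used, so the closure proofs
  below are inductions on the order that only differentiate by the usual rules.\<close>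

lemma Ck_SucI:
  assumes "open S" "\<And>x. x \<in> S \<Longrightarrow> (f has_derivative f' x) (at x)" "\<And>v. Ck k S (\<lambda>x. f' x v)"
  shows "Ck (Suc k) S f"
proof -
  have "frechet_derivative f (at x) = f' x" if "x \<in> S" for x
    using assms(2)[OF that] frechet_derivative_at by metis
  then have "Ck k S (\<lambda>x. frechet_derivative f (at x) v)" for v
    by (intro Ck_cong[OF assms(1) _ assms(3)[of v]]) simp
  then show ?thesis using assms(2) unfolding Ck.simps differentiable_def by blast
qed

lemma Ck_const: "Ck k S (\<lambda>x. c)"
  by (induction k arbitrary: c) auto

lemma Ck_add:
  assumes "open S"
  shows "Ck k S f \<Longrightarrow> Ck k S g \<Longrightarrow> Ck k S (\<lambda>x. f x + g x)"
proof (induction k arbitrary: f g)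
  case 0
  then show ?case by (simp add: continuous_on_add)
next
  case (Suc k)
  show ?case
  proof (rule Ck_SucI[OF assms])
    fix x assume "x \<in> S"
    then show "((\<lambda>x. f x + g x) has_derivative
        (\<lambda>v. frechet_derivative f (at x) v + frechet_derivative g (at x) v)) (at x)"
      using Suc.prems Ck_has_derivative by (intro has_derivative_add) blast+
  next
    show "Ck k S (\<lambda>x. frechet_derivative f (at x) v + frechet_derivative g (at x) v)" for v
      using Suc.prems by (intro Suc.IH) simp_all
  qed
qed

lemma Ck_bounded_linear_compose:
  assumes "open S" "bounded_linear h"
  shows "Ck k S f \<Longrightarrow> Ck k S (\<lambda>x. h (f x))"
proof (induction k arbitrary: f)
  case 0
  then show ?case
    using bounded_linear.continuous_on[OF assms(2)] by simp
next
  case (Suc k)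
  show ?case
  proof (rule Ck_SucI[OF assms(1)])
    fix x assume "x \<in> S"
    then show "((\<lambda>x. h (f x)) has_derivative
        (\<lambda>v. h (frechet_derivative f (at x) v))) (at x)"
      using bounded_linear.has_derivative[OF assms(2) Ck_has_derivative[OF Suc.prems]] by blast
  next
    show "Ck k S (\<lambda>x. h (frechet_derivative f (at x) v))" for v
      using Suc.prems by (intro Suc.IH) simp
  qed
qed

lemma Ck_bounded_linear:
  assumes "open S" "bounded_linear h"
  shows "Ck k S h"
proof (cases k)
  case 0
  then show ?thesis using linear_continuous_on[OF assms(2)] by simp
next
  case (Suc m)
  have "Ck (Suc m) S h"
    by (rule Ck_SucI[OF assms(1) bounded_linear_imp_has_derivative[OF assms(2)] Ck_const])
  then show ?thesis using Suc by simp
qed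

lemma Ck_mult:
  fixes f g :: "'a::real_normed_vector \<Rightarrow> real"
  assumes "open S"
  shows "Ck k S f \<Longrightarrow> Ck k S g \<Longrightarrow> Ck k S (\<lambda>x. f x * g x)"
proof (induction k arbitrary: f g)
  case 0
  then show ?case using continuous_on_mult by simp
next
  case (Suc k)
  show ?case
  proof (rule Ck_SucI[OF assms])
    fix x assume "x \<in> S"
    then show "((\<lambda>x. f x * g x) has_derivative
        (\<lambda>v. f x * frechet_derivative g (at x) v + frechet_derivative f (at x) v * g x)) (at x)"
      using Suc.prems Ck_has_derivative by (intro has_derivative_mult) blast+
  next
    show "Ck k S (\<lambda>x. f x * frechet_derivative g (at x) v + frechet_derivative f (at x) v * g x)" for v
      using Suc.prems Ck_Suc_imp[OF Suc.prems(1)] Ck_Suc_imp[OF Suc.prems(2)]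
      by (intro Ck_add[OF assms] Suc.IH) simp_all
  qed
qed

lemma Ck_inverse:
  fixes f :: "'a::real_normed_vector \<Rightarrow> real"
  assumes "open S" "\<And>x. x \<in> S \<Longrightarrow> f x \<noteq> 0"
  shows "Ck k S f \<Longrightarrow> Ck k S (\<lambda>x. inverse (f x))"
proof (induction k)
  case 0
  then show ?case using assms(2) by (auto intro!: continuous_on_inverse)
next
  case (Suc k)
  \<comment> \<open>The derivative of 1 / f contains 1 / f again; the induction hypothesis for the
    same \<open>f\<close>, one order lower, covers that factor.\<close>
  have k: "Ck k S (\<lambda>x. inverse (f x))" using Suc Ck_Suc_imp by blast
  show ?case
  proof (rule Ck_SucI[OF assms(1)])
    fix x assume "x \<in> S"
    then show "((\<lambda>x. inverse (f x)) has_derivative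
        (\<lambda>v. (- 1) * (inverse (f x) * frechet_derivative f (at x) v * inverse (f x)))) (at x)"
      using Deriv.has_derivative_inverse[OF assms(2) Ck_has_derivative[OF Suc.prems], of x] by simp
  next
    show "Ck k S (\<lambda>x. (- 1) * (inverse (f x) * frechet_derivative f (at x) v * inverse (f x)))" for v
      using Suc.prems k by (intro Ck_mult[OF assms(1)] Ck_const) simp_all
  qed
qed

lemma smooth_on_open: "smooth_on S f \<Longrightarrow> open S"
  by (simp add: smooth_on_def)

lemma smooth_on_cong:
  "(\<And>x. x \<in> S \<Longrightarrow> f x = g x) \<Longrightarrow> smooth_on S f \<Longrightarrow> smooth_on S g"
  unfolding smooth_on_def using Ck_cong by blast

lemma smooth_on_const: "open S \<Longrightarrow> smooth_on S (\<lambda>x. c)"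
  by (simp add: smooth_on_def Ck_const)

lemma smooth_on_add:
  "smooth_on S f \<Longrightarrow> smooth_on S g \<Longrightarrow> smooth_on S (\<lambda>x. f x + g x)"
  unfolding smooth_on_def using Ck_add by blast

lemma smooth_on_bounded_linear_compose:
  "bounded_linear h \<Longrightarrow> smooth_on S f \<Longrightarrow> smooth_on S (\<lambda>x. h (f x))"
  unfolding smooth_on_def using Ck_bounded_linear_compose by blast

lemma smooth_on_bounded_linear:
  "bounded_linear h \<Longrightarrow> open S \<Longrightarrow> smooth_on S h"
  unfolding smooth_on_def using Ck_bounded_linear by blast

lemma smooth_on_mult:
  fixes f g :: "'a::real_normed_vector \<Rightarrow> real"
  shows "smooth_on S f \<Longrightarrow> smooth_on S g \<Longrightarrow> smooth_on S (\<lambda>x. f x * g x)"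
  unfolding smooth_on_def using Ck_mult by blast

lemma smooth_on_cmult:
  fixes f :: "'a::real_normed_vector \<Rightarrow> real"
  shows "smooth_on S f \<Longrightarrow> smooth_on S (\<lambda>x. c * f x)"
  by (intro smooth_on_mult smooth_on_const) (rule smooth_on_open)

lemma smooth_on_diff:
  fixes f g :: "'a::real_normed_vector \<Rightarrow> real"
  assumes "smooth_on S f" "smooth_on S g"
  shows "smooth_on S (\<lambda>x. f x - g x)"
  using smooth_on_add[OF assms(1) smooth_on_cmult[OF assms(2), of "-1"]] by simp

lemma smooth_on_divide:
  fixes f g :: "'a::real_normed_vector \<Rightarrow> real"
  assumes "smooth_on S f" "smooth_on S g" "\<And>x. x \<in> S \<Longrightarrow> g x \<noteq> 0"
  shows "smooth_on S (\<lambda>x. f x / g x)"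
  using assms unfolding divide_inverse smooth_on_def by (auto intro!: Ck_mult Ck_inverse)

lemma smooth_on_sum:
  assumes "finite I" "open S" "\<And>i. i \<in> I \<Longrightarrow> smooth_on S (f i)"
  shows "smooth_on S (\<lambda>x. \<Sum>i\<in>I. f i x)"
  using assms(1,3) by (induction I) (auto intro: smooth_on_const[OF assms(2)] smooth_on_add)

lemma smooth_on_prod:
  fixes f :: "'i \<Rightarrow> 'a::real_normed_vector \<Rightarrow> real"
  assumes "finite I" "open S" "\<And>i. i \<in> I \<Longrightarrow> smooth_on S (f i)"
  shows "smooth_on S (\<lambda>x. \<Prod>i\<in>I. f i x)"
  using assms(1,3) by (induction I) (auto intro: smooth_on_const[OF assms(2)] smooth_on_mult)

lemma smooth_on_has_derivative:
  "smooth_on S f \<Longrightarrow> x \<in> S \<Longrightarrow> (f has_derivative frechet_derivative f (at x)) (at x)"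
  unfolding smooth_on_def using Ck_has_derivative by blast

lemma smooth_on_linear_derivative:
  "smooth_on S f \<Longrightarrow> x \<in> S \<Longrightarrow> linear (frechet_derivative f (at x))"
  using smooth_on_has_derivative has_derivative_linear by blast

lemma smooth_on_frechet_derivative:
  "smooth_on S f \<Longrightarrow> smooth_on S (\<lambda>x. frechet_derivative f (at x) v)"
  unfolding smooth_on_def using Ck.simps(2) by blast

lemma smooth_on_continuous_on: "smooth_on S f \<Longrightarrow> continuous_on S f"
  unfolding smooth_on_def using Ck.simps(1) by blast

section \<open>Restriction to lines and symmetry of second derivatives\<close>

lemma line_has_real_derivative:
  fixes f :: "'a::real_normed_vector \<Rightarrow> real"
  assumes "smooth_on S f" "z + s *\<^sub>R u \<in> S"
  shows "((\<lambda>s. f (z + s *\<^sub>R u)) has_real_derivative frechet_derivative f (at (z + s *\<^sub>R u)) u) (at s)"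
proof -
  have d: "((\<lambda>s. z + s *\<^sub>R u) has_derivative (\<lambda>h. h *\<^sub>R u)) (at s)"
    by (auto intro!: derivative_eq_intros)
  have "(\<lambda>h. frechet_derivative f (at (z + s *\<^sub>R u)) (h *\<^sub>R u)) =
      (*) (frechet_derivative f (at (z + s *\<^sub>R u)) u)"
    using linear_cmul[OF smooth_on_linear_derivative[OF assms]] by auto
  then show ?thesis
    unfolding has_field_derivative_def
    using has_derivative_compose[OF d smooth_on_has_derivative[OF assms]] by simp
qed

text \<open>Two mean value theorems, one in direction \<open>u\<close> for the difference of
  \<open>f\<close> across \<open>h v\<close>, one in direction \<open>v\<close> for the resulting
  derivative. The second difference is symmetric in \<open>u\<close> and \<open>v\<close>, the
  right-hand side is not; this is the source of the symmetry theorem.\<close>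

lemma second_difference_mvt:
  fixes f :: "'a::real_normed_vector \<Rightarrow> real"
  assumes sm: "smooth_on S f" and h: "h > 0"
    and S: "\<And>s t. \<bar>s\<bar> \<le> h \<Longrightarrow> \<bar>t\<bar> \<le> h \<Longrightarrow> x + s *\<^sub>R u + t *\<^sub>R v \<in> S"
  shows "\<exists>s t. 0 < s \<and> s < h \<and> 0 < t \<and> t < h \<and>
     f (x + h *\<^sub>R u + h *\<^sub>R v) - f (x + h *\<^sub>R u) - f (x + h *\<^sub>R v) + f x =
     h * h * frechet_derivative (\<lambda>z. frechet_derivative f (at z) u) (at (x + s *\<^sub>R u + t *\<^sub>R v)) v"
proof -
  define \<phi> where "\<phi> = (\<lambda>s. f ((x + h *\<^sub>R v) + s *\<^sub>R u) - f (x + s *\<^sub>R u))"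
  have 1: "(\<phi> has_real_derivative frechet_derivative f (at ((x + h *\<^sub>R v) + s *\<^sub>R u)) u
       - frechet_derivative f (at (x + s *\<^sub>R u)) u) (at s)" if "0 \<le> s" "s \<le> h" for s
    unfolding \<phi>_def
    using S[of s h] S[of s 0] that h
    by (intro DERIV_diff line_has_real_derivative[OF sm]) (auto simp: algebra_simps)
  obtain s where s: "0 < s" "s < h" "\<phi> h - \<phi> 0 = (h - 0) * (frechet_derivative f (at ((x + h *\<^sub>R v) + s *\<^sub>R u)) u
       - frechet_derivative f (at (x + s *\<^sub>R u)) u)"
    using MVT2[OF h 1] by blast
  define \<psi> where "\<psi> = (\<lambda>t. frechet_derivative f (at ((x + s *\<^sub>R u) + t *\<^sub>R v)) u)"
  have 2: "(\<psi> has_real_derivative frechet_derivative (\<lambda>z. frechet_derivative f (at z) u)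
       (at ((x + s *\<^sub>R u) + t *\<^sub>R v)) v) (at t)" if "0 \<le> t" "t \<le> h" for t
    unfolding \<psi>_def
    using S[of s t] that s
    by (intro line_has_real_derivative[OF smooth_on_frechet_derivative[OF sm]]) (auto simp: algebra_simps)
  obtain t where t: "0 < t" "t < h" "\<psi> h - \<psi> 0 = (h - 0) * frechet_derivative (\<lambda>z. frechet_derivative f (at z) u)
       (at ((x + s *\<^sub>R u) + t *\<^sub>R v)) v"
    using MVT2[OF h 2] by blast
  have "f (x + h *\<^sub>R u + h *\<^sub>R v) - f (x + h *\<^sub>R u) - f (x + h *\<^sub>R v) + f x = \<phi> h - \<phi> 0"
    by (simp add: \<phi>_def algebra_simps)
  also have "\<dots> = h * (\<psi> h - \<psi> 0)" using s(3) by (simp add: \<psi>_def algebra_simps)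
  finally show ?thesis using s t by (intro exI[of _ s] exI[of _ t]) simp
qed

text \<open>Schwarz's theorem. The second difference, evaluated in both orders, makes the two mixed
  derivatives agree at two points near \<open>x\<close>; by continuity each is within
  \<open>e\<close> of its value at \<open>x\<close>, which contradicts a gap of 2 e.\<close>

lemma frechet_derivative_symmetric_real:
  fixes f :: "'a::real_normed_vector \<Rightarrow> real"
  assumes sm: "smooth_on S f" and x: "x \<in> S"
  shows "frechet_derivative (\<lambda>z. frechet_derivative f (at z) u) (at x) v =
         frechet_derivative (\<lambda>z. frechet_derivative f (at z) v) (at x) u" (is "?A x = ?B x")
proof (rule ccontr)
  assume ne: "?A x \<noteq> ?B x"
  define e where "e = \<bar>?A x - ?B x\<bar> / 2"
  have e: "e > 0" using ne by (simp add: e_def)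
  have op: "open S" using sm smooth_on_open by blast
  have cA: "continuous_on S ?A" and cB: "continuous_on S ?B"
    by (intro smooth_on_continuous_on smooth_on_frechet_derivative sm)+
  obtain d1 where d1: "d1 > 0" "\<And>z. dist z x < d1 \<Longrightarrow> dist (?A z) (?A x) < e"
    using cA op x e unfolding continuous_on_eq_continuous_at[OF op] continuous_at_eps_delta dist_norm by blast
  obtain d2 where d2: "d2 > 0" "\<And>z. dist z x < d2 \<Longrightarrow> dist (?B z) (?B x) < e"
    using cB op x e unfolding continuous_on_eq_continuous_at[OF op] continuous_at_eps_delta dist_norm by blast
  obtain d3 where d3: "d3 > 0" "ball x d3 \<subseteq> S" using op x openE by blast
  define d where "d = min d1 (min d2 d3)"
  have d: "d > 0" using d1 d2 d3 by (simp add: d_def)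
  \<comment> \<open>Scaled so that the whole parallelogram stays within d / 2 of \<open>x\<close>;
    the summand 1 keeps the denominator positive when \<open>u\<close> and \<open>v\<close>
    vanish.\<close>
  define h where "h = d / (norm u + norm v + 1) / 2"
  have np: "norm u + norm v + 1 > 0" by (simp add: add_nonneg_pos)
  have h: "h > 0" using d np by (simp add: h_def)
  have near: "dist (x + s *\<^sub>R u + t *\<^sub>R v) x < d" if "\<bar>s\<bar> \<le> h" "\<bar>t\<bar> \<le> h" for s t
  proof -
    have "dist (x + s *\<^sub>R u + t *\<^sub>R v) x = norm (s *\<^sub>R u + t *\<^sub>R v)" by (simp add: dist_norm)
    also have "\<dots> \<le> \<bar>s\<bar> * norm u + \<bar>t\<bar> * norm v" by (metis norm_scaleR norm_triangle_ineq)
    also have "\<dots> \<le> h * norm u + h * norm v" by (intro add_mono mult_right_mono that) auto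
    also have "\<dots> \<le> h * (norm u + norm v + 1)" using h by (simp add: algebra_simps)
    also have "\<dots> = d / 2" using np unfolding h_def by (simp add: divide_simps)
    finally show ?thesis using d by simp
  qed
  have inS: "x + s *\<^sub>R u + t *\<^sub>R v \<in> S" if "\<bar>s\<bar> \<le> h" "\<bar>t\<bar> \<le> h" for s t
    using near[OF that] d3 by (auto simp: d_def dist_commute)
  have inS': "x + s *\<^sub>R v + t *\<^sub>R u \<in> S" if "\<bar>s\<bar> \<le> h" "\<bar>t\<bar> \<le> h" for s t
    using inS[OF that(2,1)] by (simp add: algebra_simps)
  obtain s t where st: "0 < s" "s < h" "0 < t" "t < h"
    "f (x + h *\<^sub>R u + h *\<^sub>R v) - f (x + h *\<^sub>R u) - f (x + h *\<^sub>R v) + f x = h * h * ?A (x + s *\<^sub>R u + t *\<^sub>R v)"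
    using second_difference_mvt[OF sm h inS] by blast
  obtain s' t' where st': "0 < s'" "s' < h" "0 < t'" "t' < h"
    "f (x + h *\<^sub>R v + h *\<^sub>R u) - f (x + h *\<^sub>R v) - f (x + h *\<^sub>R u) + f x = h * h * ?B (x + s' *\<^sub>R v + t' *\<^sub>R u)"
    using second_difference_mvt[OF sm h inS'] by blast
  have "h * h * ?A (x + s *\<^sub>R u + t *\<^sub>R v) = h * h * ?B (x + s' *\<^sub>R v + t' *\<^sub>R u)"
    using st(5) st'(5) by (simp add: algebra_simps)
  then have "?A (x + s *\<^sub>R u + t *\<^sub>R v) = ?B (x + s' *\<^sub>R v + t' *\<^sub>R u)" using h by simp
  moreover have "dist (?A (x + s *\<^sub>R u + t *\<^sub>R v)) (?A x) < e"
    using near[of s t] st by (intro d1) (auto simp: d_def)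
  moreover have "dist (?B (x + s' *\<^sub>R v + t' *\<^sub>R u)) (?B x) < e"
    using near[of t' s'] st' by (intro d2) (auto simp: d_def algebra_simps)
  ultimately have "\<bar>?A x - ?B x\<bar> < 2 * e" by (simp add: dist_real_def)
  then show False by (simp add: e_def)
qed

lemma frechet_derivative_inner:
  fixes f :: "'a::real_normed_vector \<Rightarrow> 'b::real_inner"
  assumes "f differentiable (at x)"
  shows "frechet_derivative (\<lambda>x. f x \<bullet> b) (at x) v = frechet_derivative f (at x) v \<bullet> b"
  using has_derivative_inner_left[OF assms[unfolded frechet_derivative_works], of b]
  by (metis frechet_derivative_at)

text \<open>Vector values are needed for the second derivative of a transition map; inner products
  with basis vectors reduce them to the real case.\<close>

lemma frechet_derivative_symmetric:
  fixes f :: "'a::real_normed_vector \<Rightarrow> 'b::euclidean_space"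
  assumes sm: "smooth_on S f" and x: "x \<in> S"
  shows "frechet_derivative (\<lambda>z. frechet_derivative f (at z) u) (at x) v =
         frechet_derivative (\<lambda>z. frechet_derivative f (at z) v) (at x) u"
proof (rule euclidean_eqI)
  fix b :: 'b
  let ?f = "\<lambda>x. f x \<bullet> b"
  have op: "open S" using sm smooth_on_open by blast
  have smb: "smooth_on S ?f" by (intro smooth_on_bounded_linear_compose[OF _ sm] bounded_linear_inner_left)
  have D: "frechet_derivative (\<lambda>z. frechet_derivative f (at z) u) (at x) v \<bullet> b
      = frechet_derivative (\<lambda>z. frechet_derivative ?f (at z) u) (at x) v" for u v
  proof -
    have "frechet_derivative (\<lambda>z. frechet_derivative f (at z) u) (at x) v \<bullet> b
       = frechet_derivative (\<lambda>z. frechet_derivative f (at z) u \<bullet> b) (at x) v"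
      using smooth_on_has_derivative[OF smooth_on_frechet_derivative[OF sm] x]
      by (intro frechet_derivative_inner[symmetric]) (auto simp: differentiable_def)
    also have "\<dots> = frechet_derivative (\<lambda>z. frechet_derivative ?f (at z) u) (at x) v"
    proof -
      have "frechet_derivative f (at z) u \<bullet> b = frechet_derivative ?f (at z) u" if "z \<in> S" for z
        using smooth_on_has_derivative[OF sm that]
        by (intro frechet_derivative_inner[symmetric]) (auto simp: differentiable_def)
      moreover have "(\<lambda>z. frechet_derivative f (at z) u \<bullet> b) differentiable at x"
        using smooth_on_has_derivative[OF smooth_on_frechet_derivative[OF sm] x]
        unfolding differentiable_def by (intro exI) (rule has_derivative_inner_left)
      ultimately show ?thesis
        by (subst frechet_derivative_transform_within_open[OF _ op x]) auto
    qed
    finally show ?thesis .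
  qed
  show "frechet_derivative (\<lambda>z. frechet_derivative f (at z) u) (at x) v \<bullet> b =
      frechet_derivative (\<lambda>z. frechet_derivative f (at z) v) (at x) u \<bullet> b"
    unfolding D by (rule frechet_derivative_symmetric_real[OF smb x])
qed

section \<open>Finsler functions in a chart\<close>

abbreviation slit :: "(real^'n::finite) set \<Rightarrow> ((real^'n) \<times> (real^'n)) set" where
  "slit U \<equiv> U \<times> (UNIV - {0})"

lemma open_slit: "open U \<Longrightarrow> open (slit U)"
  by (intro open_Times open_Diff) auto

lemma vec_eq_sum_axis: "v = (\<Sum>k\<in>UNIV. v $ k *\<^sub>R axis k (1::real))"
  by (simp add: vec_eq_iff axis_def if_distrib cong: if_cong)

lemma linear_pair_components:
  fixes f :: "(real^'n::finite) \<times> (real^'n) \<Rightarrow> real"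
  assumes "linear f"
  shows "f (u, v) = (\<Sum>k\<in>UNIV. u $ k * f (axis k 1, 0)) + (\<Sum>k\<in>UNIV. v $ k * f (0, axis k 1))"
proof -
  have "f (u, v) = f (u, 0) + f (0, v)"
    using linear_add[OF assms, of "(u, 0)" "(0, v)"] by simp
  also have "f (u, 0) = (\<Sum>k\<in>UNIV. u $ k * f (axis k 1, 0))"
  proof -
    have l: "linear (\<lambda>u. f (u, 0))"
      using linear_compose[OF _ assms, of "\<lambda>u. (u, 0)"]
      by (simp add: o_def linear_iff)
    show ?thesis
      by (subst vec_eq_sum_axis[of u]) (simp add: linear_sum[OF l] linear_cmul[OF l])
  qed
  also have "f (0, v) = (\<Sum>k\<in>UNIV. v $ k * f (0, axis k 1))"
  proof -
    have l: "linear (\<lambda>v. f (0, v))"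
      using linear_compose[OF _ assms, of "\<lambda>v. (0, v)"]
      by (simp add: o_def linear_iff)
    show ?thesis
      by (subst vec_eq_sum_axis[of v]) (simp add: linear_sum[OF l] linear_cmul[OF l])
  qed
  finally show ?thesis .
qed

lemma smooth_on_pdx: "smooth_on S f \<Longrightarrow> smooth_on S (pdx k f)"
  unfolding pdx_def[abs_def] by (rule smooth_on_frechet_derivative)

lemma smooth_on_pdy: "smooth_on S f \<Longrightarrow> smooth_on S (pdy k f)"
  unfolding pdy_def[abs_def] by (rule smooth_on_frechet_derivative)

lemma frechet_derivative_pd:
  assumes "smooth_on S f" "p \<in> S"
  shows "frechet_derivative f (at p) (u, v) =
    (\<Sum>k\<in>UNIV. u $ k * pdx k f p) + (\<Sum>k\<in>UNIV. v $ k * pdy k f p)"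
  unfolding pdx_def pdy_def
  by (rule linear_pair_components[OF smooth_on_linear_derivative[OF assms]])

lemma frechet_derivative_eqI:
  "(f has_derivative f') (at x) \<Longrightarrow> frechet_derivative f (at x) = f'"
  using frechet_derivative_at by metis

lemma pdy_commute:
  assumes "smooth_on S f" "p \<in> S"
  shows "pdy i (pdy j f) p = pdy j (pdy i f) p"
  unfolding pdy_def[abs_def] using frechet_derivative_symmetric[OF assms] by simp

lemma pd_cong:
  assumes "open S" "p \<in> S" "\<And>q. q \<in> S \<Longrightarrow> f q = g q" "f differentiable (at p)"
  shows "pdx k f p = pdx k g p" "pdy k f p = pdy k g p"
  unfolding pdx_def pdy_def
  using frechet_derivative_transform_within_open[OF assms(4,1,2,3)] by auto

lemma
  assumes f: "smooth_on S f" and g: "smooth_on S g" and p: "p \<in> S"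
  shows pdx_add: "pdx k (\<lambda>p. f p + g p) p = pdx k f p + pdx k g p"
    and pdy_add: "pdy k (\<lambda>p. f p + g p) p = pdy k f p + pdy k g p"
    and pdx_mult: "pdx k (\<lambda>p. f p * g p) p = f p * pdx k g p + pdx k f p * g p"
    and pdy_mult: "pdy k (\<lambda>p. f p * g p) p = f p * pdy k g p + pdy k f p * g p"
  unfolding pdx_def pdy_def
  using frechet_derivative_eqI[OF has_derivative_add[OF smooth_on_has_derivative[OF f p] smooth_on_has_derivative[OF g p]]]
    frechet_derivative_eqI[OF has_derivative_mult[OF smooth_on_has_derivative[OF f p] smooth_on_has_derivative[OF g p]]]
  by auto

lemma
  assumes f: "\<And>i. i \<in> I \<Longrightarrow> smooth_on S (f i)" and p: "p \<in> S"
  shows pdx_sum: "pdx k (\<lambda>p. \<Sum>i\<in>I. f i p) p = (\<Sum>i\<in>I. pdx k (f i) p)"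
    and pdy_sum: "pdy k (\<lambda>p. \<Sum>i\<in>I. f i p) p = (\<Sum>i\<in>I. pdy k (f i) p)"
  unfolding pdx_def pdy_def
  using frechet_derivative_eqI[OF has_derivative_sum[of I f, OF smooth_on_has_derivative[OF f p]]]
  by auto

lemma bounded_linear_snd_nth: "bounded_linear (\<lambda>p::(real^'n)\<times>(real^'n). snd p $ i)"
  using bounded_linear_compose[OF bounded_linear_vec_nth bounded_linear_snd] .

lemma smooth_on_snd_nth: "open S \<Longrightarrow> smooth_on S (\<lambda>p::(real^'n)\<times>(real^'n). snd p $ i)"
  by (rule smooth_on_bounded_linear[OF bounded_linear_snd_nth])

lemma pd_snd_nth:
  shows "pdx k (\<lambda>p. snd p $ i) p = 0" "pdy k (\<lambda>p. snd p $ i) p = (if i = k then 1 else 0)"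
  unfolding pdx_def pdy_def frechet_derivative_eqI[OF bounded_linear_imp_has_derivative[OF bounded_linear_snd_nth]]
  by (auto simp: axis_def)

section \<open>Homogeneous functions and Euler's relation\<close>

definition homog :: "nat \<Rightarrow> (real^'n::finite) set \<Rightarrow> ((real^'n) \<times> (real^'n) \<Rightarrow> real) \<Rightarrow> bool" where
  "homog r U f \<longleftrightarrow> (\<forall>x\<in>U. \<forall>y. \<forall>l>0. y \<noteq> 0 \<longrightarrow> f (x, l *\<^sub>R y) = l ^ r * f (x, y))"

lemma homogD: "homog r U f \<Longrightarrow> (x, y) \<in> slit U \<Longrightarrow> l > 0 \<Longrightarrow> f (x, l *\<^sub>R y) = l ^ r * f (x, y)"
  unfolding homog_def by simp

lemma homog_sum: "(\<And>i. i \<in> I \<Longrightarrow> homog r U (f i)) \<Longrightarrow> homog r U (\<lambda>p. \<Sum>i\<in>I. f i p)"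
  unfolding homog_def by (simp add: sum_distrib_left)

text \<open>Differentiation of f (x, l y) = l^r f (x, y) in both variables at once. Because the
  vertical direction is scaled along, one identity yields both facts needed: derivatives in x keep
  the degree and derivatives in y lower it by one.\<close>

lemma homog_frechet_derivative:
  assumes h: "homog r U f" and sm: "smooth_on (slit U) f" and p: "(x, y) \<in> slit U" and l: "l > 0"
  shows "frechet_derivative f (at (x, l *\<^sub>R y)) (u, l *\<^sub>R v) = l ^ r * frechet_derivative f (at (x, y)) (u, v)"
proof -
  have q: "(x, l *\<^sub>R y) \<in> slit U" using p l by simp
  let ?m = "\<lambda>q::(real^'a)\<times>(real^'a). (fst q, l *\<^sub>R snd q)"
  have eq: "l ^ r * f q = f (?m q)" if "q \<in> slit U" for q
    using homogD[OF h _ l, of "fst q" "snd q"] that by simp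
  have "(?m has_derivative ?m) (at (x, y))"
    by (auto intro!: derivative_eq_intros)
  from has_derivative_compose[OF this, of f] smooth_on_has_derivative[OF sm q]
  have 1: "((\<lambda>q. f (?m q)) has_derivative (\<lambda>h. frechet_derivative f (at (x, l *\<^sub>R y)) (?m h))) (at (x, y))"
    by simp
  have "((\<lambda>q. l ^ r * f q) has_derivative (\<lambda>h. l ^ r * frechet_derivative f (at (x, y)) h)) (at (x, y))"
    by (rule has_derivative_mult_right[OF smooth_on_has_derivative[OF sm p]])
  then have 2: "((\<lambda>q. f (?m q)) has_derivative (\<lambda>h. l ^ r * frechet_derivative f (at (x, y)) h)) (at (x, y))"
    by (rule has_derivative_transform_within_open[OF _ smooth_on_open[OF sm] p])
      (simp add: eq)
  from fun_cong[OF has_derivative_unique[OF 1 2], of "(u, v)"] show ?thesis by simp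
qed

lemma homog_pdx:
  assumes h: "homog r U f" and sm: "smooth_on (slit U) f"
  shows "homog r U (pdx k f)"
  unfolding homog_def pdx_def
  using homog_frechet_derivative[OF assms, of _ _ _ "axis k 1" 0] by simp

lemma homog_pdy:
  assumes h: "homog (Suc r) U f" and sm: "smooth_on (slit U) f"
  shows "homog r U (pdy k f)"
  unfolding homog_def pdy_def
proof (intro ballI allI impI)
  fix x y :: "real^'a" and l :: real assume a: "x \<in> U" "l > 0" "y \<noteq> 0"
  then have p: "(x, l *\<^sub>R y) \<in> slit U" by simp
  have "frechet_derivative f (at (x, l *\<^sub>R y)) (0, l *\<^sub>R axis k 1)
      = l * frechet_derivative f (at (x, l *\<^sub>R y)) (0, axis k 1)"
    using linear_cmul[OF smooth_on_linear_derivative[OF sm p], of l "(0, axis k 1)"] by simp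
  moreover have "frechet_derivative f (at (x, l *\<^sub>R y)) (0, l *\<^sub>R axis k 1)
      = l ^ Suc r * frechet_derivative f (at (x, y)) (0, axis k 1)"
    using a by (intro homog_frechet_derivative[OF assms]) auto
  ultimately show "frechet_derivative f (at (x, l *\<^sub>R y)) (0, axis k 1) =
      l ^ r * frechet_derivative f (at (x, y)) (0, axis k 1)"
    using a by simp
qed

text \<open>Both sides are the derivative at l = 1 of f (x, l y) = l^r f (x, y).\<close>

lemma euler_homog:
  assumes h: "homog r U f" and sm: "smooth_on (slit U) f" and p: "(x, y) \<in> slit U"
  shows "(\<Sum>k\<in>UNIV. y $ k * pdy k f (x, y)) = real r * f (x, y)"
proof -
  have "((\<lambda>l. f ((x, 0) + l *\<^sub>R (0, y))) has_real_derivative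
      frechet_derivative f (at ((x, 0) + 1 *\<^sub>R (0, y))) (0, y)) (at 1)"
    using p by (intro line_has_real_derivative[OF sm]) auto
  then have 1: "((\<lambda>l. f (x, l *\<^sub>R y)) has_real_derivative frechet_derivative f (at (x, y)) (0, y)) (at 1)"
    by simp
  have "((\<lambda>l. l ^ r * f (x, y)) has_real_derivative real r * f (x, y)) (at 1)"
    by (auto intro!: derivative_eq_intros)
  then have 2: "((\<lambda>l. f (x, l *\<^sub>R y)) has_real_derivative real r * f (x, y)) (at 1)"
    by (rule has_field_derivative_transform_within_open[where S="{0<..}"])
      (use h p in \<open>auto simp: homog_def\<close>)
  have "frechet_derivative f (at (x, y)) (0, y) = real r * f (x, y)"
    by (rule DERIV_unique[OF 1 2])
  then show ?thesis using frechet_derivative_pd[OF sm p, of 0 y] by simp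
qed

section \<open>Smooth dependence of the inverse of a matrix\<close>

lemma matrix_inv_mult_right:
  fixes M :: "real^'n^'n"
  assumes "invertible M"
  shows "M ** matrix_inv M = mat 1"
  using assms unfolding invertible_def matrix_inv_def by (rule someI2_ex) simp

text \<open>Writes an entry of the inverse as a quotient of determinants, hence of polynomials in
  the entries, so that smoothness of the inverse metric follows from sums, products and
  quotients.\<close>

lemma matrix_inv_cramer:
  fixes M :: "real^'n^'n"
  assumes "invertible M"
  shows "matrix_inv M $ i $ l = det (\<chi> a b. if b = i then (axis l 1 :: real^'n) $ a else M $ a $ b) / det M"
proof -
  have "M *v (matrix_inv M *v axis l 1) = axis l 1"
    by (simp add: matrix_vector_mul_assoc matrix_inv_mult_right[OF assms])
  then have "matrix_inv M *v axis l 1 = (\<chi> k. det (\<chi> a b. if b = k then (axis l 1 :: real^'n) $ a else M $ a $ b) / det M)"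
    using cramer[of M "matrix_inv M *v axis l 1" "axis l 1"] assms invertible_det_nz by blast
  moreover have "(matrix_inv M *v axis l 1) $ i = matrix_inv M $ i $ l"
    by (simp add: matrix_vector_mult_def axis_def if_distrib cong: if_cong)
  ultimately show ?thesis by simp
qed

lemma smooth_on_det:
  fixes M :: "'a::real_normed_vector \<Rightarrow> real^'n^'n"
  assumes "open S" "\<And>i j. smooth_on S (\<lambda>p. M p $ i $ j)"
  shows "smooth_on S (\<lambda>p. det (M p))"
  unfolding det_def
  by (intro smooth_on_sum finite_permutations smooth_on_cmult smooth_on_prod assms finite)

lemma smooth_on_matrix_inv:
  fixes M :: "'a::real_normed_vector \<Rightarrow> real^'n^'n"
  assumes op: "open S" and M: "\<And>i j. smooth_on S (\<lambda>p. M p $ i $ j)"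
    and inv: "\<And>p. p \<in> S \<Longrightarrow> invertible (M p)"
  shows "smooth_on S (\<lambda>p. matrix_inv (M p) $ i $ l)"
proof -
  have "smooth_on S (\<lambda>p. (\<chi> a b. if b = i then (axis l 1 :: real^'n) $ a else M p $ a $ b) $ a $ b)" for a b
    using M by (cases "b = i") (auto intro: smooth_on_const[OF op])
  then have "smooth_on S (\<lambda>p. det (\<chi> a b. if b = i then (axis l 1 :: real^'n) $ a else M p $ a $ b) / det (M p))"
    using inv by (intro smooth_on_divide smooth_on_det op M) (auto simp: invertible_det_nz)
  then show ?thesis
    by (rule smooth_on_cong[rotated]) (simp add: matrix_inv_cramer inv)
qed

lemma posdef_invertible:
  fixes M :: "real^'n^'n"
  assumes "\<And>\<xi>. \<xi> \<noteq> 0 \<Longrightarrow> (\<Sum>i\<in>UNIV. \<Sum>j\<in>UNIV. M $ i $ j * \<xi> $ i * \<xi> $ j) > 0"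
  shows "invertible M"
proof -
  have "\<xi> = 0" if "M *v \<xi> = 0" for \<xi>
  proof (rule ccontr)
    assume "\<xi> \<noteq> 0"
    then have "(\<Sum>i\<in>UNIV. \<Sum>j\<in>UNIV. M $ i $ j * \<xi> $ i * \<xi> $ j) > 0" by (rule assms)
    also have "(\<Sum>i\<in>UNIV. \<Sum>j\<in>UNIV. M $ i $ j * \<xi> $ i * \<xi> $ j) = (\<Sum>i\<in>UNIV. \<xi> $ i * (M *v \<xi>) $ i)"
      by (simp add: matrix_vector_mult_def sum_distrib_left algebra_simps)
    finally show False using that by simp
  qed
  then show ?thesis
    by (metis invertible_left_inverse matrix_left_invertible_ker)
qed

section \<open>The metric tensor and the spray of one Finsler metric in one chart\<close>

locale finsler_chart =
  fixes F :: "('m::topological_space, 'n::finite) chart \<Rightarrow> real^'n \<Rightarrow> real^'n \<Rightarrow> real"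
    and ch :: "('m, 'n) chart" and U :: "(real^'n) set"
  assumes U_open: "open U"
    and F_nonneg: "x \<in> U \<Longrightarrow> F ch x y \<ge> 0"
    and F_scale: "x \<in> U \<Longrightarrow> l > 0 \<Longrightarrow> F ch x (l *\<^sub>R y) = l * F ch x y"
    and F_smooth: "smooth_on (slit U) (\<lambda>p. F ch (fst p) (snd p))"
    and F_convex: "x \<in> U \<Longrightarrow> y \<noteq> 0 \<Longrightarrow> \<xi> \<noteq> 0 \<Longrightarrow>
      (\<Sum>i\<in>UNIV. \<Sum>j\<in>UNIV. gmat F ch (x, y) $ i $ j * \<xi> $ i * \<xi> $ j) > 0"
begin

definition "Fn p = F ch (fst p) (snd p)"

text \<open>The derivative along the geodesic spray, the vector field with components (y, - 2 G) on
  the slit tangent space. Its integral curves are the pairs of position and velocity of geodesics,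
  so \<open>spray f\<close> is the time derivative of \<open>f\<close> along a geodesic.\<close>

definition "spray f p = frechet_derivative f (at p) (snd p, - 2 *\<^sub>R Gvec F ch p)"

lemma slit_open: "open (slit U)"
  by (rule open_slit[OF U_open])

lemma Fn_smooth: "smooth_on (slit U) Fn"
  using F_smooth unfolding Fn_def[abs_def] .

lemma Fn_homog: "homog 1 U Fn"
  by (simp add: homog_def Fn_def F_scale)

lemma L_eq: "Lsq F ch = (\<lambda>p. Fn p * Fn p)"
  by (simp add: fun_eq_iff Lsq_def Fn_def power2_eq_square)

lemma L_smooth: "smooth_on (slit U) (Lsq F ch)"
  unfolding L_eq by (intro smooth_on_mult Fn_smooth)

lemma L_homog: "homog (Suc (Suc 0)) U (Lsq F ch)"
  by (simp add: homog_def Lsq_def F_scale power2_eq_square)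

lemma gmat_nth: "gmat F ch p $ i $ j = 1/2 * pdy i (pdy j (Lsq F ch)) p"
  by (simp add: gmat_def)

lemma gmat_sym: "p \<in> slit U \<Longrightarrow> gmat F ch p $ i $ j = gmat F ch p $ j $ i"
  unfolding gmat_nth using pdy_commute[OF L_smooth] by metis

lemma gmat_smooth: "smooth_on (slit U) (\<lambda>p. gmat F ch p $ i $ j)"
  unfolding gmat_nth by (intro smooth_on_cmult smooth_on_pdy L_smooth)

lemma gmat_invertible: "p \<in> slit U \<Longrightarrow> invertible (gmat F ch p)"
  by (cases p) (auto intro!: posdef_invertible F_convex)

lemma gmat_homog: "(x, y) \<in> slit U \<Longrightarrow> l > 0 \<Longrightarrow> gmat F ch (x, l *\<^sub>R y) = gmat F ch (x, y)"
  unfolding vec_eq_iff gmat_nth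
  using homogD[OF homog_pdy[OF homog_pdy[OF L_homog L_smooth] smooth_on_pdy[OF L_smooth]]] by simp

lemma gmat_radial:
  assumes "(x, y) \<in> slit U"
  shows "(\<Sum>j\<in>UNIV. y $ j * gmat F ch (x, y) $ j $ i) = 1/2 * pdy i (Lsq F ch) (x, y)"
  using euler_homog[OF homog_pdy[OF L_homog L_smooth] smooth_on_pdy[OF L_smooth] assms, of i]
  by (simp add: gmat_nth flip: sum_divide_distrib)

text \<open>Euler's relation, used twice, shows that the form \<open>gmat\<close> evaluated on y
  itself is F^2. Strict convexity thus upgrades the nonnegativity of F to positivity off the zero
  section.\<close>

lemma L_pos: "(x, y) \<in> slit U \<Longrightarrow> Lsq F ch (x, y) > 0"
proof -
  assume p: "(x, y) \<in> slit U"
  then have "0 < (\<Sum>i\<in>UNIV. \<Sum>j\<in>UNIV. gmat F ch (x, y) $ i $ j * y $ i * y $ j)"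
    by (intro F_convex) auto
  also have "\<dots> = (\<Sum>j\<in>UNIV. (\<Sum>i\<in>UNIV. y $ i * gmat F ch (x, y) $ i $ j) * y $ j)"
    by (subst sum.swap) (simp add: sum_distrib_left sum_distrib_right algebra_simps)
  also have "\<dots> = 1/2 * (\<Sum>j\<in>UNIV. y $ j * pdy j (Lsq F ch) (x, y))"
    unfolding gmat_radial[OF p] sum_distrib_left by (simp add: algebra_simps)
  also have "\<dots> = Lsq F ch (x, y)"
    unfolding euler_homog[OF L_homog L_smooth p] by simp
  finally show ?thesis .
qed

lemma F_pos: "x \<in> U \<Longrightarrow> y \<noteq> 0 \<Longrightarrow> F ch x y > 0"
  using L_pos[of x y] F_nonneg[of x y] by (auto simp: Lsq_def less_le)

lemma Fn_pos: "p \<in> slit U \<Longrightarrow> Fn p > 0"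
  unfolding Fn_def by (cases p) (auto intro: F_pos)

lemma Gc_smooth: "smooth_on (slit U) (Gc F ch i)"
  unfolding Gc_def[abs_def]
  by (intro smooth_on_cmult smooth_on_sum smooth_on_mult smooth_on_diff smooth_on_pdx smooth_on_pdy
      L_smooth slit_open smooth_on_snd_nth smooth_on_matrix_inv gmat_smooth gmat_invertible finite)

lemma Gc_homog: "homog (Suc (Suc 0)) U (Gc F ch i)"
  unfolding homog_def
proof (intro ballI allI impI)
  fix x y :: "real^'n" and l :: real assume "x \<in> U" and l: "l > 0" and "y \<noteq> 0"
  then have p: "(x, y) \<in> slit U" by simp
  have 1: "pdx k (pdy j (Lsq F ch)) (x, l *\<^sub>R y) = l * pdx k (pdy j (Lsq F ch)) (x, y)" for k j
    using homogD[OF homog_pdx[OF homog_pdy[OF L_homog L_smooth] smooth_on_pdy[OF L_smooth]] p l] by simp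
  have 2: "pdx k (Lsq F ch) (x, l *\<^sub>R y) = l * l * pdx k (Lsq F ch) (x, y)" for k
    using homogD[OF homog_pdx[OF L_homog L_smooth] p l] by simp
  define E where "E j q = (\<Sum>k\<in>UNIV. pdx k (pdy j (Lsq F ch)) q * snd q $ k) - pdx j (Lsq F ch) q" for j q
  have "E j (x, l *\<^sub>R y) = l * l * E j (x, y)" for j
    unfolding E_def 1 2 by (simp add: right_diff_distrib sum_distrib_left algebra_simps)
  then show "Gc F ch i (x, l *\<^sub>R y) = l ^ Suc (Suc 0) * Gc F ch i (x, y)"
    unfolding Gc_def gmat_homog[OF p l] E_def[symmetric] by (simp add: sum_distrib_left ac_simps)
qed

lemma gmat_mult_G:
  assumes "p \<in> slit U"
  shows "(\<Sum>i\<in>UNIV. gmat F ch p $ l $ i * Gc F ch i p) =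
    1/4 * ((\<Sum>k\<in>UNIV. pdx k (pdy l (Lsq F ch)) p * snd p $ k) - pdx l (Lsq F ch) p)"
proof -
  define E :: "real^'n" where "E = (\<chi> l. (\<Sum>k\<in>UNIV. pdx k (pdy l (Lsq F ch)) p * snd p $ k) - pdx l (Lsq F ch) p)"
  have "Gvec F ch p = (1/4) *\<^sub>R (matrix_inv (gmat F ch p) *v E)"
    by (simp add: vec_eq_iff Gvec_def Gc_def E_def matrix_vector_mult_def)
  then have "gmat F ch p *v Gvec F ch p = (1/4) *\<^sub>R (gmat F ch p *v (matrix_inv (gmat F ch p) *v E))"
    by (simp add: matrix_vector_mult_scaleR)
  also have "\<dots> = (1/4) *\<^sub>R E"
    by (simp add: matrix_vector_mul_assoc matrix_inv_mult_right[OF gmat_invertible[OF assms]])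
  finally have "(gmat F ch p *v Gvec F ch p) $ l = (1/4) * E $ l" by simp
  then show ?thesis by (simp add: E_def Gvec_def matrix_vector_mult_def)
qed

text \<open>The left-hand side is the Euler--Lagrange expression of \<open>F\<^sup>2\<close> along a curve with velocity
  \<open>snd p\<close> and acceleration \<open>a\<close>.\<close>

lemma euler_lagrange:
  assumes "p \<in> slit U"
  shows "(\<Sum>k\<in>UNIV. snd p $ k * pdx k (pdy l (Lsq F ch)) p) + (\<Sum>k\<in>UNIV. a $ k * pdy k (pdy l (Lsq F ch)) p)
     - pdx l (Lsq F ch) p = 2 * (gmat F ch p *v (a + 2 *\<^sub>R Gvec F ch p)) $ l"
proof -
  have "(gmat F ch p *v (a + 2 *\<^sub>R Gvec F ch p)) $ l = (\<Sum>i\<in>UNIV. gmat F ch p $ l $ i * a $ i)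
     + 2 * (\<Sum>i\<in>UNIV. gmat F ch p $ l $ i * Gc F ch i p)"
    by (simp add: matrix_vector_mult_def Gvec_def sum_distrib_left sum.distrib algebra_simps)
  also have "(\<Sum>i\<in>UNIV. gmat F ch p $ l $ i * a $ i) = (\<Sum>i\<in>UNIV. 1/2 * (a $ i * pdy i (pdy l (Lsq F ch)) p))"
    by (intro sum.cong refl) (subst gmat_sym[OF assms], simp add: gmat_nth)
  finally show ?thesis
    unfolding gmat_mult_G[OF assms] sum_distrib_left[symmetric]
    by (simp add: mult.commute algebra_simps)
qed

lemma spray_pd:
  assumes "smooth_on (slit U) f" "p \<in> slit U"
  shows "spray f p = (\<Sum>k\<in>UNIV. snd p $ k * pdx k f p) - 2 * (\<Sum>k\<in>UNIV. Gc F ch k p * pdy k f p)"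
  unfolding spray_def frechet_derivative_pd[OF assms]
  by (simp add: Gvec_def sum_distrib_left sum_negf[symmetric] mult.assoc)

text \<open>Conservation of energy. By \<open>gmat_radial\<close> the vertical derivative of L along
  G is G with its index lowered, paired with y; \<open>gmat_mult_G\<close> replaces this by
  derivatives of L. The mixed second derivatives contribute 2 y^k dL/dx^k, of which one half cancels
  within the formula and the other against the horizontal part of the spray.\<close>

lemma spray_L:
  assumes p: "(x, y) \<in> slit U"
  shows "spray (Lsq F ch) (x, y) = 0"
proof -
  let ?L = "Lsq F ch"
  \<comment> \<open>Euler's relation for L differentiated in x^k, with y as an independent
    variable.\<close>
  have mixed: "(\<Sum>l\<in>UNIV. y $ l * pdx k (pdy l ?L) (x, y)) = 2 * pdx k ?L (x, y)" for k
  proof -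
    have sm: "smooth_on (slit U) (\<lambda>q. snd q $ l * pdy l ?L q)" for l
      by (intro smooth_on_mult smooth_on_snd_nth slit_open smooth_on_pdy L_smooth)
    have "pdx k (\<lambda>q. \<Sum>l\<in>UNIV. snd q $ l * pdy l ?L q) (x, y) = pdx k (\<lambda>q. 2 * ?L q) (x, y)"
    proof (rule pd_cong(1)[OF slit_open p])
      show "(\<Sum>l\<in>UNIV. snd q $ l * pdy l ?L q) = 2 * ?L q" if "q \<in> slit U" for q
        using euler_homog[OF L_homog L_smooth, of "fst q" "snd q"] that by simp
      show "(\<lambda>q. \<Sum>l\<in>UNIV. snd q $ l * pdy l ?L q) differentiable (at (x, y))"
        unfolding differentiable_def
        by (intro exI) (rule smooth_on_has_derivative[OF smooth_on_sum[OF finite slit_open sm] p])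
    qed
    also have "pdx k (\<lambda>q. \<Sum>l\<in>UNIV. snd q $ l * pdy l ?L q) (x, y) =
       (\<Sum>l\<in>UNIV. pdx k (\<lambda>q. snd q $ l * pdy l ?L q) (x, y))"
      by (rule pdx_sum[OF sm p])
    also have "\<dots> = (\<Sum>l\<in>UNIV. y $ l * pdx k (pdy l ?L) (x, y))"
      by (intro sum.cong refl)
        (subst pdx_mult[OF smooth_on_snd_nth[OF slit_open] smooth_on_pdy[OF L_smooth] p],
          simp add: pd_snd_nth)
    also have "pdx k (\<lambda>q. 2 * ?L q) (x, y) = 2 * pdx k ?L (x, y)"
      by (subst pdx_mult[OF smooth_on_const[OF slit_open] L_smooth p]) (simp add: pdx_def)
    finally show ?thesis .
  qed
  have "2 * (\<Sum>i\<in>UNIV. Gc F ch i (x, y) * pdy i ?L (x, y)) =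
      4 * (\<Sum>i\<in>UNIV. Gc F ch i (x, y) * (\<Sum>l\<in>UNIV. y $ l * gmat F ch (x, y) $ l $ i))"
    unfolding gmat_radial[OF p] by (simp add: sum_distrib_left)
  also have "\<dots> = 4 * (\<Sum>l\<in>UNIV. y $ l * (\<Sum>i\<in>UNIV. gmat F ch (x, y) $ l $ i * Gc F ch i (x, y)))"
    unfolding sum_distrib_left by (subst sum.swap) (simp add: algebra_simps)
  also have "\<dots> = (\<Sum>l\<in>UNIV. y $ l * (\<Sum>k\<in>UNIV. pdx k (pdy l ?L) (x, y) * y $ k)) - (\<Sum>l\<in>UNIV. y $ l * pdx l ?L (x, y))"
    unfolding gmat_mult_G[OF p] by (simp add: sum_distrib_left sum_subtractf algebra_simps)
  also have "(\<Sum>l\<in>UNIV. y $ l * (\<Sum>k\<in>UNIV. pdx k (pdy l ?L) (x, y) * y $ k))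
     = (\<Sum>k\<in>UNIV. y $ k * (\<Sum>l\<in>UNIV. y $ l * pdx k (pdy l ?L) (x, y)))"
    unfolding sum_distrib_left by (subst sum.swap) (simp add: algebra_simps)
  also have "\<dots> = 2 * (\<Sum>k\<in>UNIV. y $ k * pdx k ?L (x, y))"
    unfolding mixed by (simp add: sum_distrib_left algebra_simps)
  finally show ?thesis unfolding spray_pd[OF L_smooth p] by simp
qed

lemma spray_mult:
  fixes f g :: "(real^'n) \<times> (real^'n) \<Rightarrow> real"
  assumes "smooth_on (slit U) f" "smooth_on (slit U) g" "p \<in> slit U"
  shows "spray (\<lambda>p. f p * g p) p = f p * spray g p + spray f p * g p"
  unfolding spray_def
  using frechet_derivative_eqI[OF has_derivative_mult[OF smooth_on_has_derivative[OF assms(1,3)] smooth_on_has_derivative[OF assms(2,3)]]]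
  by simp

lemma spray_F:
  assumes p: "p \<in> slit U"
  shows "spray Fn p = 0"
proof -
  have "spray (Lsq F ch) p = 2 * Fn p * spray Fn p"
    unfolding L_eq spray_mult[OF Fn_smooth Fn_smooth p] by simp
  then show ?thesis using spray_L[of "fst p" "snd p"] p Fn_pos[OF p] by simp
qed

end

section \<open>Projective change of the Ricci curvature\<close>

lemma linear_pair_shift:
  fixes D :: "'a::real_vector \<times> 'b::real_vector \<Rightarrow> real"
  assumes "linear D"
  shows "D (a, b + c *\<^sub>R v) = D (a, b) + c * D (0, v)"
  using linear_add[OF assms, of "(a, b)" "c *\<^sub>R (0, v)"] linear_cmul[OF assms, of c "(0, v)"] by simp

context finsler_chart
begin

definition "divG p = (\<Sum>i\<in>UNIV. pdy i (Gc F ch i) p)"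

lemma div_smooth: "smooth_on (slit U) divG"
  unfolding divG_def[abs_def] by (intro smooth_on_sum finite slit_open smooth_on_pdy Gc_smooth)

lemma div_homog: "homog (Suc 0) U divG"
  unfolding divG_def[abs_def] by (intro homog_sum homog_pdy Gc_homog Gc_smooth)

lemma pd_div:
  assumes "p \<in> slit U"
  shows "pdx j divG p = (\<Sum>i\<in>UNIV. pdx j (pdy i (Gc F ch i)) p)"
    "pdy j divG p = (\<Sum>i\<in>UNIV. pdy j (pdy i (Gc F ch i)) p)"
proof -
  have sm: "smooth_on (slit U) (pdy i (Gc F ch i))" for i by (intro smooth_on_pdy Gc_smooth)
  show "pdx j divG p = (\<Sum>i\<in>UNIV. pdx j (pdy i (Gc F ch i)) p)"
    unfolding divG_def[abs_def] by (rule pdx_sum[OF sm assms])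
  show "pdy j divG p = (\<Sum>i\<in>UNIV. pdy j (pdy i (Gc F ch i)) p)"
    unfolding divG_def[abs_def] by (rule pdy_sum[OF sm assms])
qed

text \<open>After tracing, the two middle terms of \<open>Rc\<close> merge into the derivative of
  \<open>divG\<close> along the spray. In this form each summand has a manageable change under Gt =
  G + P y.\<close>

lemma Ric_eq:
  assumes "(x, y) \<in> slit U"
  shows "Ric F ch x y = 2 * (\<Sum>i\<in>UNIV. pdx i (Gc F ch i) (x, y)) - spray divG (x, y)
    - (\<Sum>i\<in>UNIV. \<Sum>j\<in>UNIV. pdy j (Gc F ch i) (x, y) * pdy i (Gc F ch j) (x, y))"
proof -
  have 1: "(\<Sum>i\<in>UNIV. \<Sum>j\<in>UNIV. pdx j (pdy i (Gc F ch i)) (x, y) * y $ j) = (\<Sum>k\<in>UNIV. y $ k * pdx k divG (x, y))"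
    unfolding pd_div[OF assms] sum_distrib_left by (subst sum.swap) (simp add: mult.commute)
  have 2: "(\<Sum>i\<in>UNIV. \<Sum>j\<in>UNIV. Gc F ch j (x, y) * pdy j (pdy i (Gc F ch i)) (x, y)) =
     (\<Sum>k\<in>UNIV. Gc F ch k (x, y) * pdy k divG (x, y))"
    unfolding pd_div[OF assms] sum_distrib_left by (rule sum.swap)
  show ?thesis
    unfolding Ric_def Rc_def spray_pd[OF div_smooth assms]
    using 1 2 by (simp add: sum.distrib sum_subtractf flip: sum_distrib_left)
qed

lemma spray_add_scale:
  fixes f g :: "(real^'n) \<times> (real^'n) \<Rightarrow> real"
  assumes "smooth_on (slit U) f" "smooth_on (slit U) g" "p \<in> slit U"
  shows "spray (\<lambda>p. f p + c * g p) p = spray f p + c * spray g p"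
  unfolding spray_def
  using frechet_derivative_eqI[OF has_derivative_add[OF smooth_on_has_derivative[OF assms(1,3)]
      has_derivative_mult_right[OF smooth_on_has_derivative[OF assms(2,3)], of c]]]
  by simp

end

text \<open>The expansion of the trace of (N + P I + y q^T)^2. With N the matrix of y-derivatives of
  G and q the y-gradient of P, the bracket is the corresponding matrix for Gt = G + P y.\<close>

lemma trace_square_rank_one_update:
  fixes N :: "'n::finite \<Rightarrow> 'n \<Rightarrow> real" and q y :: "'n \<Rightarrow> real"
  shows "(\<Sum>i\<in>UNIV. \<Sum>j\<in>UNIV. (N i j + (P * (if i = j then 1 else 0) + q j * y i))
        * (N j i + (P * (if j = i then 1 else 0) + q i * y j))) =
     (\<Sum>i\<in>UNIV. \<Sum>j\<in>UNIV. N i j * N j i) + 2 * P * (\<Sum>i\<in>UNIV. N i i)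
     + 2 * (\<Sum>i\<in>UNIV. q i * (\<Sum>j\<in>UNIV. y j * N i j)) + real CARD('n) * P\<^sup>2
     + 2 * P * (\<Sum>i\<in>UNIV. y i * q i) + (\<Sum>i\<in>UNIV. y i * q i)\<^sup>2"
proof -
  define \<delta> where "\<delta> i j = (if i = j then 1 else 0 :: real)" for i j :: 'n
  have d: "\<delta> j i = \<delta> i j" for i j by (simp add: \<delta>_def)
  have ds: "(\<Sum>j\<in>UNIV. \<delta> i j * f j) = f i" for i and f :: "'n \<Rightarrow> real"
    by (simp add: \<delta>_def if_distrib[of "\<lambda>x. x * _"] cong: if_cong)
  have "(N i j + (P * \<delta> i j + q j * y i)) * (N j i + (P * \<delta> j i + q i * y j)) =
      N i j * N j i + P * (\<delta> i j * N j i) + P * (\<delta> i j * N i j)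
      + q i * (y j * N i j) + q j * (y i * N j i) + P\<^sup>2 * (\<delta> i j * \<delta> i j)
      + P * (\<delta> i j * (q i * y j)) + P * (\<delta> i j * (q j * y i)) + (y i * q i) * (y j * q j)" for i j
    by (simp add: d[of i j] algebra_simps power2_eq_square)
  then have "(\<Sum>i\<in>UNIV. \<Sum>j\<in>UNIV. (N i j + (P * \<delta> i j + q j * y i)) * (N j i + (P * \<delta> j i + q i * y j))) =
      (\<Sum>i\<in>UNIV. \<Sum>j\<in>UNIV. N i j * N j i) + P * (\<Sum>i\<in>UNIV. N i i) + P * (\<Sum>i\<in>UNIV. N i i)
      + (\<Sum>i\<in>UNIV. q i * (\<Sum>j\<in>UNIV. y j * N i j)) + (\<Sum>i\<in>UNIV. \<Sum>j\<in>UNIV. q j * (y i * N j i))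
      + P\<^sup>2 * (\<Sum>i\<in>UNIV. \<delta> i i) + P * (\<Sum>i\<in>UNIV. q i * y i) + P * (\<Sum>i\<in>UNIV. q i * y i)
      + (\<Sum>i\<in>UNIV. y i * q i) * (\<Sum>i\<in>UNIV. y i * q i)"
    by (simp add: sum.distrib sum_product ds flip: sum_distrib_left)
  also have "(\<Sum>i\<in>UNIV. \<Sum>j\<in>UNIV. q j * (y i * N j i)) = (\<Sum>i\<in>UNIV. q i * (\<Sum>j\<in>UNIV. y j * N i j))"
    unfolding sum_distrib_left by (rule sum.swap)
  also have "(\<Sum>i\<in>UNIV. \<delta> i i) = real CARD('n)" by (simp add: \<delta>_def)
  finally show ?thesis
    unfolding \<delta>_def by (simp add: algebra_simps power2_eq_square)
qed

text \<open>The factor \<open>c\<close> is an arbitrary function of the tangent vector here;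
  smoothness and homogeneity come only from its identification with \<open>P\<close>.\<close>

locale finsler_pair = M: finsler_chart F ch U + T: finsler_chart Ft ch U
  for F Ft :: "('m::topological_space, 'n::finite) chart \<Rightarrow> real^'n \<Rightarrow> real^'n \<Rightarrow> real"
    and ch and U :: "(real^'n) set" +
  assumes parallel: "p \<in> slit U \<Longrightarrow> \<exists>c. Gvec Ft ch p = Gvec F ch p + c *\<^sub>R snd p"
begin

definition "P p = M.spray T.Fn p / (2 * T.Fn p)"

text \<open>Ft is constant along its own spray, which differs from the spray of F by - 2 c y in the
  vertical direction. Euler's relation evaluates that difference on Ft as - 2 c Ft, so the spray of
  F maps Ft to 2 c Ft.\<close>

lemma P_eq:
  assumes p: "p \<in> slit U"
  shows "Gvec Ft ch p = Gvec F ch p + P p *\<^sub>R snd p"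
proof -
  obtain c where c: "Gvec Ft ch p = Gvec F ch p + c *\<^sub>R snd p" using parallel[OF p] by blast
  let ?D = "frechet_derivative T.Fn (at p)"
  have l: "linear ?D" by (rule smooth_on_linear_derivative[OF T.Fn_smooth p])
  have "- 2 *\<^sub>R Gvec Ft ch p = - 2 *\<^sub>R Gvec F ch p + (- 2 * c) *\<^sub>R snd p"
    unfolding c by (simp add: algebra_simps)
  then have "?D (snd p, - 2 *\<^sub>R Gvec Ft ch p) = ?D (snd p, - 2 *\<^sub>R Gvec F ch p) + (- 2 * c) * ?D (0, snd p)"
    using linear_pair_shift[OF l] by metis
  then have "0 = M.spray T.Fn p - 2 * c * ?D (0, snd p)"
    using T.spray_F[OF p] unfolding T.spray_def M.spray_def by simp
  also have "?D (0, snd p) = T.Fn p"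
    using euler_homog[OF T.Fn_homog T.Fn_smooth, of "fst p" "snd p"] p
      frechet_derivative_pd[OF T.Fn_smooth p, of 0 "snd p"] by simp
  finally have "P p = c" unfolding P_def using T.Fn_pos[OF p] by (simp add: field_simps)
  then show ?thesis using c by simp
qed

lemma spray_smooth:
  fixes f :: "(real^'n) \<times> (real^'n) \<Rightarrow> real"
  assumes "smooth_on (slit U) f"
  shows "smooth_on (slit U) (M.spray f)"
proof -
  have "smooth_on (slit U) (\<lambda>p. (\<Sum>k\<in>UNIV. snd p $ k * pdx k f p) - 2 * (\<Sum>k\<in>UNIV. Gc F ch k p * pdy k f p))"
    by (intro smooth_on_diff smooth_on_cmult smooth_on_sum smooth_on_mult smooth_on_snd_nth
        M.slit_open finite smooth_on_pdx smooth_on_pdy assms M.Gc_smooth)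
  then show ?thesis by (rule smooth_on_cong[rotated]) (simp add: M.spray_pd[OF assms])
qed

lemma P_smooth: "smooth_on (slit U) P"
  unfolding P_def[abs_def]
  by (intro smooth_on_divide spray_smooth smooth_on_cmult T.Fn_smooth) (use T.Fn_pos in force)

lemma P_homog: "homog (Suc 0) U P"
  unfolding homog_def
proof (intro ballI allI impI)
  fix x y :: "real^'n" and l :: real assume "x \<in> U" and l: "l > 0" and "y \<noteq> 0"
  then have p: "(x, y) \<in> slit U" and q: "(x, l *\<^sub>R y) \<in> slit U" by auto
  have G: "Gvec F ch (x, l *\<^sub>R y) = l *\<^sub>R (l *\<^sub>R Gvec F ch (x, y))"
    unfolding vec_eq_iff Gvec_def using homogD[OF M.Gc_homog p l] by simp
  have D: "frechet_derivative T.Fn (at (x, l *\<^sub>R y)) (u, l *\<^sub>R v) = l * frechet_derivative T.Fn (at (x, y)) (u, v)" for u v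
    using homog_frechet_derivative[OF T.Fn_homog T.Fn_smooth p l] by simp
  have "M.spray T.Fn (x, l *\<^sub>R y) = frechet_derivative T.Fn (at (x, l *\<^sub>R y)) (l *\<^sub>R y, l *\<^sub>R (l *\<^sub>R (- 2 *\<^sub>R Gvec F ch (x, y))))"
    unfolding M.spray_def G by (simp add: algebra_simps)
  also have "\<dots> = l * frechet_derivative T.Fn (at (x, y)) (l *\<^sub>R (y, - 2 *\<^sub>R Gvec F ch (x, y)))"
    unfolding D by simp
  also have "\<dots> = l * (l * M.spray T.Fn (x, y))"
    unfolding linear_cmul[OF smooth_on_linear_derivative[OF T.Fn_smooth p]] M.spray_def by simp
  finally show "P (x, l *\<^sub>R y) = l ^ Suc 0 * P (x, y)"
    unfolding P_def using homogD[OF T.Fn_homog p l] l by simp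
qed

lemma Gc_eq: "p \<in> slit U \<Longrightarrow> Gc Ft ch i p = Gc F ch i p + P p * snd p $ i"
  using P_eq[of p] unfolding vec_eq_iff Gvec_def by simp

lemma Py_smooth: "smooth_on (slit U) (\<lambda>p. P p * snd p $ i)"
  by (intro smooth_on_mult P_smooth smooth_on_snd_nth M.slit_open)

lemma pd_Gc:
  assumes p: "p \<in> slit U"
  shows "pdx j (Gc Ft ch i) p = pdx j (Gc F ch i) p + pdx j P p * snd p $ i"
    and "pdy j (Gc Ft ch i) p = pdy j (Gc F ch i) p + (P p * (if i = j then 1 else 0) + pdy j P p * snd p $ i)"
proof -
  have d: "Gc Ft ch i differentiable (at p)"
    unfolding differentiable_def by (intro exI) (rule smooth_on_has_derivative[OF T.Gc_smooth p])
  have c: "pdx j (Gc Ft ch i) p = pdx j (\<lambda>p. Gc F ch i p + P p * snd p $ i) p"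
      "pdy j (Gc Ft ch i) p = pdy j (\<lambda>p. Gc F ch i p + P p * snd p $ i) p"
    by (rule pd_cong[OF M.slit_open p _ d], erule Gc_eq)+
  note S = smooth_on_snd_nth[OF M.slit_open]
  show "pdx j (Gc Ft ch i) p = pdx j (Gc F ch i) p + pdx j P p * snd p $ i"
    unfolding c pdx_add[OF M.Gc_smooth Py_smooth p] pdx_mult[OF P_smooth S p] pd_snd_nth by simp
  show "pdy j (Gc Ft ch i) p = pdy j (Gc F ch i) p + (P p * (if i = j then 1 else 0) + pdy j P p * snd p $ i)"
    unfolding c pdy_add[OF M.Gc_smooth Py_smooth p] pdy_mult[OF P_smooth S p] pd_snd_nth by simp
qed

lemma euler_P: "(x, y) \<in> slit U \<Longrightarrow> (\<Sum>k\<in>UNIV. y $ k * pdy k P (x, y)) = P (x, y)"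
  using euler_homog[OF P_homog P_smooth] by simp

text \<open>In n + 1, the n is the trace of P times the identity and the 1 is Euler's relation for
  P.\<close>

lemma div_eq:
  assumes p: "p \<in> slit U"
  shows "T.divG p = M.divG p + (real CARD('n) + 1) * P p"
proof -
  have "T.divG p = M.divG p + (real CARD('n) * P p + (\<Sum>k\<in>UNIV. snd p $ k * pdy k P p))"
    unfolding T.divG_def M.divG_def pd_Gc[OF p] by (simp add: sum.distrib mult.commute)
  also have "(\<Sum>k\<in>UNIV. snd p $ k * pdy k P p) = P p"
    using euler_P[of "fst p" "snd p"] p by simp
  finally show ?thesis by (simp add: algebra_simps)
qed

lemma T_spray:
  fixes f :: "(real^'n) \<times> (real^'n) \<Rightarrow> real"
  assumes f: "smooth_on (slit U) f" "homog (Suc 0) U f" and p: "p \<in> slit U"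
  shows "T.spray f p = M.spray f p - 2 * P p * f p"
proof -
  let ?D = "frechet_derivative f (at p)"
  have l: "linear ?D" by (rule smooth_on_linear_derivative[OF f(1) p])
  have "- 2 *\<^sub>R Gvec Ft ch p = - 2 *\<^sub>R Gvec F ch p + (- 2 * P p) *\<^sub>R snd p"
    unfolding P_eq[OF p] by (simp add: algebra_simps)
  then have "?D (snd p, - 2 *\<^sub>R Gvec Ft ch p) = ?D (snd p, - 2 *\<^sub>R Gvec F ch p) + (- 2 * P p) * ?D (0, snd p)"
    using linear_pair_shift[OF l] by metis
  also have "?D (0, snd p) = f p"
    using euler_homog[OF f(2,1), of "fst p" "snd p"] p
      frechet_derivative_pd[OF f(1) p, of 0 "snd p"] by simp
  finally show ?thesis unfolding T.spray_def M.spray_def by simp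
qed

lemma T_spray_div:
  assumes p: "p \<in> slit U"
  shows "T.spray T.divG p = M.spray M.divG p + (real CARD('n) + 1) * M.spray P p
    - 2 * P p * M.divG p - 2 * (real CARD('n) + 1) * (P p)\<^sup>2"
proof -
  have "frechet_derivative T.divG (at p) = frechet_derivative (\<lambda>p. M.divG p + (real CARD('n) + 1) * P p) (at p)"
  proof (rule frechet_derivative_transform_within_open[OF _ M.slit_open p])
    show "T.divG differentiable at p"
      unfolding differentiable_def by (intro exI) (rule smooth_on_has_derivative[OF T.div_smooth p])
  qed (rule div_eq)
  then have "M.spray T.divG p = M.spray M.divG p + (real CARD('n) + 1) * M.spray P p"
    using M.spray_add_scale[OF M.div_smooth P_smooth p] unfolding M.spray_def by simp
  then show ?thesis
    unfolding T_spray[OF T.div_smooth T.div_homog p] div_eq[OF p]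
    by (simp add: algebra_simps power2_eq_square)
qed

text \<open>The terms with \<open>M.divG\<close> cancel. The square of P occurs 2 (n + 1) times from
  the spray of \<open>T.divG\<close> and - (n + 3) times from the trace, leaving n - 1. The
  contributions 2 \<open>?XP\<close> and - 4 \<open>?GP\<close> make up 2 S P, which together with -
  (n + 1) S P leaves - (n - 1) S P.\<close>

theorem Ric_projective:
  assumes p: "(x, y) \<in> slit U"
  shows "Ric Ft ch x y = Ric F ch x y + (real CARD('n) - 1) * ((P (x, y))\<^sup>2 - M.spray P (x, y))"
proof -
  let ?p = "(x, y)" and ?n = "real CARD('n)"
  let ?GP = "\<Sum>k\<in>UNIV. Gc F ch k ?p * pdy k P ?p" and ?XP = "\<Sum>k\<in>UNIV. y $ k * pdx k P ?p"
  have e: "(\<Sum>j\<in>UNIV. y $ j * pdy j (Gc F ch i) ?p) = 2 * Gc F ch i ?p" for i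
    using euler_homog[OF M.Gc_homog M.Gc_smooth p] by simp
  have GP: "(\<Sum>i\<in>UNIV. pdy i P ?p * (\<Sum>j\<in>UNIV. y $ j * pdy j (Gc F ch i) ?p)) = 2 * ?GP"
    unfolding e by (simp add: sum_distrib_left mult.commute mult.left_commute)
  have X: "(\<Sum>i\<in>UNIV. pdx i (Gc Ft ch i) ?p) = (\<Sum>i\<in>UNIV. pdx i (Gc F ch i) ?p) + ?XP"
    unfolding pd_Gc[OF p] by (simp add: sum.distrib mult.commute)
  have tr: "(\<Sum>i\<in>UNIV. \<Sum>j\<in>UNIV. pdy j (Gc Ft ch i) ?p * pdy i (Gc Ft ch j) ?p) =
     (\<Sum>i\<in>UNIV. \<Sum>j\<in>UNIV. pdy j (Gc F ch i) ?p * pdy i (Gc F ch j) ?p)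
     + 2 * P ?p * M.divG ?p + 2 * (2 * ?GP) + ?n * (P ?p)\<^sup>2 + 2 * P ?p * P ?p + (P ?p)\<^sup>2"
    unfolding pd_Gc[OF p] snd_conv
      trace_square_rank_one_update[of "\<lambda>i j. pdy j (Gc F ch i) ?p" "P ?p" "\<lambda>j. pdy j P ?p" "\<lambda>i. y $ i"]
      GP euler_P[OF p] M.divG_def ..
  have SP: "M.spray P ?p = ?XP - 2 * ?GP" using M.spray_pd[OF P_smooth p] by simp
  show ?thesis
    unfolding M.Ric_eq[OF p] T.Ric_eq[OF p] X tr T_spray_div[OF p] SP
    by (simp add: algebra_simps power2_eq_square)
qed

end

section \<open>The Euler--Lagrange expression under a change of chart\<close>

context finsler_chart
begin

text \<open>The expression d/dt (dL/dy v) - dL/dx v along a curve through \<open>p\<close> with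
  acceleration \<open>a\<close>, tested on a constant vector \<open>v\<close>. A pairing with
  vectors is easier to carry from chart to chart than the components in
  \<open>euler_lagrange\<close>.\<close>

definition "EL p a v = frechet_derivative (\<lambda>q. frechet_derivative (Lsq F ch) (at q) (0, v)) (at p) (snd p, a)
    - frechet_derivative (Lsq F ch) (at p) (v, 0)"

lemma EL_eq:
  assumes p: "p \<in> slit U"
  shows "EL p a v = 2 * (v \<bullet> (gmat F ch p *v (a + 2 *\<^sub>R Gvec F ch p)))"
proof -
  let ?L = "Lsq F ch"
  have 1: "frechet_derivative ?L (at q) (0, v) = (\<Sum>l\<in>UNIV. v $ l * pdy l ?L q)" if "q \<in> slit U" for q
    using frechet_derivative_pd[OF L_smooth that, of 0 v] by simp
  have "frechet_derivative (\<lambda>q. frechet_derivative ?L (at q) (0, v)) (at p)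
      = frechet_derivative (\<lambda>q. \<Sum>l\<in>UNIV. v $ l * pdy l ?L q) (at p)"
  proof (rule frechet_derivative_transform_within_open[OF _ slit_open p 1])
    show "(\<lambda>q. frechet_derivative ?L (at q) (0, v)) differentiable at p"
      unfolding differentiable_def
      by (intro exI) (rule smooth_on_has_derivative[OF smooth_on_frechet_derivative[OF L_smooth] p])
  qed
  also have "\<dots> = (\<lambda>h. \<Sum>l\<in>UNIV. v $ l * frechet_derivative (pdy l ?L) (at p) h)"
    by (intro frechet_derivative_eqI has_derivative_sum has_derivative_mult_right
        smooth_on_has_derivative[OF smooth_on_pdy[OF L_smooth] p])
  finally have "EL p a v = (\<Sum>l\<in>UNIV. v $ l * (frechet_derivative (pdy l ?L) (at p) (snd p, a) - pdx l ?L p))"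
    unfolding EL_def using frechet_derivative_pd[OF L_smooth p, of v 0]
    by (simp add: right_diff_distrib sum_subtractf)
  also have "\<dots> = (\<Sum>l\<in>UNIV. v $ l * (2 * (gmat F ch p *v (a + 2 *\<^sub>R Gvec F ch p)) $ l))"
    unfolding frechet_derivative_pd[OF smooth_on_pdy[OF L_smooth] p] euler_lagrange[OF p] ..
  finally show ?thesis by (simp add: inner_vec_def sum_distrib_left mult.left_commute)
qed

lemma EL_zero_iff:
  assumes p: "p \<in> slit U"
  shows "(\<forall>v. EL p a v = 0) \<longleftrightarrow> a + 2 *\<^sub>R Gvec F ch p = 0"
proof
  assume "\<forall>v. EL p a v = 0"
  then have "gmat F ch p *v (a + 2 *\<^sub>R Gvec F ch p) = 0"
    unfolding EL_eq[OF p] by (metis inner_eq_zero_iff mult_eq_0_iff zero_neq_numeral)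
  then show "a + 2 *\<^sub>R Gvec F ch p = 0"
    using gmat_invertible[OF p] by (metis invertible_left_inverse matrix_left_invertible_ker)
qed (simp add: EL_eq[OF p])

end

text \<open>\<open>Ck\<close> controls the derivative of T only on one fixed vector at a time.
  Expanding the vector argument in the standard basis turns the map, which depends on point and
  vector jointly, into a finite sum of products of differentiable functions.\<close>

lemma smooth_derivative_apply_has_derivative:
  fixes T :: "real^'n::finite \<Rightarrow> real^'n"
  assumes T: "smooth_on W T" and x: "x \<in> W"
  shows "((\<lambda>q. frechet_derivative T (at (fst q)) (snd q)) has_derivative
     (\<lambda>h. frechet_derivative (\<lambda>z. frechet_derivative T (at z) y) (at x) (fst h)
        + frechet_derivative T (at x) (snd h))) (at (x, y))"
proof -
  let ?D = "\<lambda>z. frechet_derivative T (at z)"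
  have lin: "linear (?D z)" if "z \<in> W" for z by (rule smooth_on_linear_derivative[OF T that])
  have rep: "?D z w = (\<Sum>k\<in>UNIV. w $ k *\<^sub>R ?D z (axis k 1))" if "z \<in> W" for z w
    by (subst vec_eq_sum_axis[of w]) (simp add: linear_sum[OF lin[OF that]] linear_cmul[OF lin[OF that]])
  have op: "open (W \<times> (UNIV :: (real^'n) set))" by (intro open_Times smooth_on_open[OF T]) auto
  let ?E = "\<lambda>k. frechet_derivative (\<lambda>z. ?D z (axis k 1)) (at x)"
  have dE: "((\<lambda>z. ?D z (axis k 1)) has_derivative ?E k) (at x)" for k
    by (rule smooth_on_has_derivative[OF smooth_on_frechet_derivative[OF T] x])
  have "((\<lambda>z. \<Sum>k\<in>UNIV. y $ k *\<^sub>R ?D z (axis k 1)) has_derivative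
      (\<lambda>h. \<Sum>k\<in>UNIV. y $ k *\<^sub>R ?E k h)) (at x)"
    by (intro has_derivative_sum has_derivative_scaleR_right dE)
  then have "((\<lambda>z. ?D z y) has_derivative (\<lambda>h. \<Sum>k\<in>UNIV. y $ k *\<^sub>R ?E k h)) (at x)"
    by (rule has_derivative_transform_within_open[OF _ smooth_on_open[OF T] x]) (rule rep[symmetric])
  then have D2: "frechet_derivative (\<lambda>z. ?D z y) (at x) h = (\<Sum>k\<in>UNIV. y $ k *\<^sub>R ?E k h)" for h
    by (simp add: frechet_derivative_eqI)
  have dE': "((\<lambda>q. ?D (fst q) (axis k 1)) has_derivative (\<lambda>h. ?E k (fst h))) (at (x, y))" for k
    using has_derivative_compose[OF has_derivative_fst[OF has_derivative_ident], of "\<lambda>z. ?D z (axis k 1)" "?E k" "(x, y)"]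
      dE[of k] by simp
  have "((\<lambda>q. \<Sum>k\<in>UNIV. snd q $ k *\<^sub>R ?D (fst q) (axis k 1)) has_derivative
     (\<lambda>h. \<Sum>k\<in>UNIV. snd (x, y) $ k *\<^sub>R ?E k (fst h) + snd h $ k *\<^sub>R ?D (fst (x, y)) (axis k 1))) (at (x, y))"
    by (intro has_derivative_sum has_derivative_scaleR dE' bounded_linear_imp_has_derivative
        bounded_linear_snd_nth)
  moreover have "(\<Sum>k\<in>UNIV. snd (x, y) $ k *\<^sub>R ?E k (fst h) + snd h $ k *\<^sub>R ?D (fst (x, y)) (axis k 1))
     = frechet_derivative (\<lambda>z. ?D z y) (at x) (fst h) + ?D x (snd h)" for h
    using rep[OF x, of "snd h"] D2[of "fst h"] by (simp only: sum.distrib fst_conv snd_conv)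
  ultimately have "((\<lambda>q. \<Sum>k\<in>UNIV. snd q $ k *\<^sub>R ?D (fst q) (axis k 1)) has_derivative
     (\<lambda>h. frechet_derivative (\<lambda>z. ?D z y) (at x) (fst h) + ?D x (snd h))) (at (x, y))"
    by simp
  then show ?thesis
    by (rule has_derivative_transform_within_open[OF _ op]) (use x in \<open>auto intro!: rep[symmetric]\<close>)
qed

locale finsler_transition = A: finsler_chart F ch U + B: finsler_chart F ch' U'
  for F :: "('m::topological_space, 'n::finite) chart \<Rightarrow> real^'n \<Rightarrow> real^'n \<Rightarrow> real"
    and ch ch' :: "('m, 'n) chart" and U U' :: "(real^'n) set" +
  fixes T :: "real^'n \<Rightarrow> real^'n" and W :: "(real^'n) set"
  assumes T_smooth: "smooth_on W T" and W_sub: "W \<subseteq> U" and T_into: "T ` W \<subseteq> U'"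
    and T_surj: "x \<in> W \<Longrightarrow> surj (frechet_derivative T (at x))"
    and T_isometry: "x \<in> W \<Longrightarrow> F ch' (T x) (frechet_derivative T (at x) y) = F ch x y"
begin

abbreviation "DT x \<equiv> frechet_derivative T (at x)"
definition "D2T x u w = frechet_derivative (\<lambda>z. DT z w) (at x) u"
definition "lift q = (T (fst q), DT (fst q) (snd q))"

lemma DT_linear: "x \<in> W \<Longrightarrow> linear (DT x)"
  by (rule smooth_on_linear_derivative[OF T_smooth])

lemma DT_nonzero: "x \<in> W \<Longrightarrow> y \<noteq> 0 \<Longrightarrow> DT x y \<noteq> 0"
  using linear_surjective_imp_injective[OF DT_linear T_surj] linear_injective_0[OF DT_linear] by blast

lemma lift_in: "q \<in> slit W \<Longrightarrow> lift q \<in> slit U'"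
  using T_into DT_nonzero by (auto simp: lift_def)

lemma W_open: "open W"
  by (rule smooth_on_open[OF T_smooth])

lemma lift_has_derivative:
  assumes x: "x \<in> W"
  shows "(lift has_derivative (\<lambda>h. (DT x (fst h), D2T x (fst h) y + DT x (snd h)))) (at (x, y))"
proof -
  have "((\<lambda>q. T (fst q)) has_derivative (\<lambda>h. DT x (fst h))) (at (x, y))"
    using has_derivative_compose[OF has_derivative_fst[OF has_derivative_ident], of T "DT x" "(x, y)"]
      smooth_on_has_derivative[OF T_smooth x] by simp
  from has_derivative_Pair[OF this smooth_derivative_apply_has_derivative[OF T_smooth x, of y]]
  show ?thesis unfolding lift_def[abs_def] D2T_def .
qed

lemma L_lift: "q \<in> slit W \<Longrightarrow> Lsq F ch q = Lsq F ch' (lift q)"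
  using T_isometry by (auto simp: Lsq_def lift_def)

lemma dL_lift:
  assumes q: "q \<in> slit W"
  shows "frechet_derivative (Lsq F ch) (at q) (u, b) =
    frechet_derivative (Lsq F ch') (at (lift q)) (DT (fst q) u, D2T (fst q) u (snd q) + DT (fst q) b)"
proof -
  obtain x y where xy: "q = (x, y)" "x \<in> W" using q by auto
  have "((\<lambda>q. Lsq F ch' (lift q)) has_derivative
      (\<lambda>h. frechet_derivative (Lsq F ch') (at (lift q)) (DT x (fst h), D2T x (fst h) y + DT x (snd h)))) (at q)"
    using has_derivative_compose[OF lift_has_derivative[OF xy(2), of y]
        smooth_on_has_derivative[OF B.L_smooth, of "lift (x, y)"]] lift_in q xy by simp
  then have "(Lsq F ch has_derivative
      (\<lambda>h. frechet_derivative (Lsq F ch') (at (lift q)) (DT x (fst h), D2T x (fst h) y + DT x (snd h)))) (at q)"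
    by (rule has_derivative_transform_within_open[OF _ open_slit[OF W_open] q]) (simp add: L_lift)
  from frechet_derivative_eqI[OF this] show ?thesis using xy by simp
qed

text \<open>The Euler-Lagrange expression is a covector: L is the pullback of L' under
  \<open>lift\<close>, while accelerations acquire the extra term \<open>D2T x y y\<close>. Working
  with L avoids transforming \<open>Gvec\<close>, whose formula contains the inverse metric.\<close>

lemma EL_transition:
  assumes x: "x \<in> W" and y: "y \<noteq> 0"
  shows "A.EL (x, y) a v = B.EL (lift (x, y)) (D2T x y y + DT x a) (DT x v)"
proof -
  let ?L = "Lsq F ch" and ?L' = "Lsq F ch'" and ?p = "(x, y)"
  have p: "?p \<in> slit W" using x y by simp
  have p': "lift ?p \<in> slit U'" by (rule lift_in[OF p])
  \<comment> \<open>The fibre derivative of L is the one of L' on the transported vector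
    \<open>DT (fst q) v\<close>. That vector moves with the base point, and differentiating it
    produces the additional second-derivative term.\<close>
  have 1: "frechet_derivative ?L (at q) (0, v) = (\<Sum>i\<in>UNIV. DT (fst q) v $ i * pdy i ?L' (lift q))"
    if "q \<in> slit W" for q
  proof -
    have z: "fst q \<in> W" using that by auto
    have "D2T (fst q) 0 (snd q) = 0"
      unfolding D2T_def
      by (rule linear_0[OF smooth_on_linear_derivative[OF smooth_on_frechet_derivative[OF T_smooth] z]])
    then show ?thesis
      unfolding dL_lift[OF that] frechet_derivative_pd[OF B.L_smooth lift_in[OF that]]
      by (simp add: linear_0[OF DT_linear[OF z]] mult.commute)
  qed
  have dpdy: "(pdy i ?L' has_derivative frechet_derivative (pdy i ?L') (at (lift ?p))) (at (lift ?p))" for i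
    by (rule smooth_on_has_derivative[OF smooth_on_pdy[OF B.L_smooth] p'])
  have "((\<lambda>q. DT (fst q) v) has_derivative (\<lambda>h. D2T x (fst h) v)) (at ?p)"
    using has_derivative_compose[OF has_derivative_fst[OF has_derivative_ident], of "\<lambda>z. DT z v" _ ?p]
      smooth_on_has_derivative[OF smooth_on_frechet_derivative[OF T_smooth] x] by (simp add: D2T_def)
  then have dDT: "((\<lambda>q. DT (fst q) v $ i) has_derivative (\<lambda>h. D2T x (fst h) v $ i)) (at ?p)" for i
    by (rule bounded_linear.has_derivative[OF bounded_linear_vec_nth])
  have "((\<lambda>q. \<Sum>i\<in>UNIV. DT (fst q) v $ i * pdy i ?L' (lift q)) has_derivative
     (\<lambda>h. \<Sum>i\<in>UNIV. DT (fst ?p) v $ i *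
        frechet_derivative (pdy i ?L') (at (lift ?p)) (DT x (fst h), D2T x (fst h) y + DT x (snd h))
        + D2T x (fst h) v $ i * pdy i ?L' (lift ?p))) (at ?p)"
    by (intro has_derivative_sum has_derivative_mult dDT
        has_derivative_compose[OF lift_has_derivative[OF x] dpdy])
  then have "((\<lambda>q. frechet_derivative ?L (at q) (0, v)) has_derivative
     (\<lambda>h. \<Sum>i\<in>UNIV. DT (fst ?p) v $ i *
        frechet_derivative (pdy i ?L') (at (lift ?p)) (DT x (fst h), D2T x (fst h) y + DT x (snd h))
        + D2T x (fst h) v $ i * pdy i ?L' (lift ?p))) (at ?p)"
    by (rule has_derivative_transform_within_open[OF _ open_slit[OF W_open] p]) (simp add: 1)
  note dM = frechet_derivative_eqI[OF this]
  let ?u = "DT x v" and ?b = "D2T x y y + DT x a"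
  have 2: "frechet_derivative (\<lambda>q. frechet_derivative ?L' (at q) (0, ?u)) (at (lift ?p)) h
      = (\<Sum>i\<in>UNIV. ?u $ i * frechet_derivative (pdy i ?L') (at (lift ?p)) h)" for h
  proof -
    have "((\<lambda>q. \<Sum>i\<in>UNIV. ?u $ i * pdy i ?L' q) has_derivative
        (\<lambda>h. \<Sum>i\<in>UNIV. ?u $ i * frechet_derivative (pdy i ?L') (at (lift ?p)) h)) (at (lift ?p))"
      by (intro has_derivative_sum has_derivative_mult_right dpdy)
    then have "((\<lambda>q. frechet_derivative ?L' (at q) (0, ?u)) has_derivative
        (\<lambda>h. \<Sum>i\<in>UNIV. ?u $ i * frechet_derivative (pdy i ?L') (at (lift ?p)) h)) (at (lift ?p))"
      by (rule has_derivative_transform_within_open[OF _ B.slit_open p'])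
        (simp add: frechet_derivative_pd[OF B.L_smooth])
    from frechet_derivative_eqI[OF this] show ?thesis by simp
  qed
  \<comment> \<open>the non-tensorial terms cancel by this symmetry\<close>
  have sym: "D2T x v y = D2T x y v"
    unfolding D2T_def by (rule frechet_derivative_symmetric[OF T_smooth x])
  have "A.EL ?p a v = (\<Sum>i\<in>UNIV. ?u $ i * frechet_derivative (pdy i ?L') (at (lift ?p)) (DT x y, ?b))
      + (\<Sum>i\<in>UNIV. D2T x y v $ i * pdy i ?L' (lift ?p))
      - frechet_derivative ?L' (at (lift ?p)) (DT x v, D2T x v y)"
    unfolding A.EL_def dM dL_lift[OF p] by (simp add: sum.distrib linear_0[OF DT_linear[OF x]])
  also have "frechet_derivative ?L' (at (lift ?p)) (DT x v, D2T x v y)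
     = frechet_derivative ?L' (at (lift ?p)) (DT x v, 0) + (\<Sum>i\<in>UNIV. D2T x y v $ i * pdy i ?L' (lift ?p))"
    unfolding sym frechet_derivative_pd[OF B.L_smooth p'] by simp
  finally show ?thesis unfolding B.EL_def 2 by (simp add: lift_def)
qed

lemma geodesic_equation_transition:
  assumes x: "x \<in> W" and y: "y \<noteq> 0" and g: "a + 2 *\<^sub>R Gvec F ch (x, y) = 0"
  shows "(D2T x y y + DT x a) + 2 *\<^sub>R Gvec F ch' (lift (x, y)) = 0"
proof -
  have p: "(x, y) \<in> slit U" and p': "lift (x, y) \<in> slit U'" using x y W_sub lift_in by auto
  have "B.EL (lift (x, y)) (D2T x y y + DT x a) w = 0" for w
  proof -
    obtain v where "w = DT x v" using T_surj[OF x] by (metis surjD)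
    moreover have "A.EL (x, y) a v = 0" using A.EL_zero_iff[OF p] g by blast
    ultimately show ?thesis using EL_transition[OF x y, of a v] by simp
  qed
  then show ?thesis using B.EL_zero_iff[OF p'] by blast
qed

end

section \<open>Local solutions of ordinary differential equations\<close>

lemma vector_derivative_bound:
  fixes g :: "real \<Rightarrow> 'a::real_normed_vector"
  assumes g: "\<And>t. t \<in> {a..b} \<Longrightarrow> (g has_vector_derivative g' t) (at t within {a..b})"
    and B: "\<And>t. t \<in> {a..b} \<Longrightarrow> norm (g' t) \<le> B" and st: "s \<in> {a..b}" "t \<in> {a..b}"
  shows "norm (g s - g t) \<le> B * \<bar>s - t\<bar>"
proof -
  have "norm (g s - g t) \<le> B * norm (s - t)"
  proof (rule differentiable_bound[where S="{a..b}" and f'="\<lambda>t h. h *\<^sub>R g' t"])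
    show "onorm (\<lambda>h. h *\<^sub>R g' t) \<le> B" if "t \<in> {a..b}" for t
      using B[OF that] by (intro onorm_le) (simp add: mult.commute[of B] mult_left_mono)
  qed (use g st in \<open>auto simp: has_vector_derivative_def\<close>)
  then show ?thesis by simp
qed

text \<open>Each partial derivative is bounded on the compact ball; the sum of the bounds dominates
  the operator norm, and convexity of the ball allows the mean value inequality.\<close>

lemma smooth_on_locally_lipschitz:
  fixes f :: "'a::euclidean_space \<Rightarrow> 'b::real_normed_vector"
  assumes sm: "smooth_on S f" and r: "cball z0 r \<subseteq> S"
  shows "\<exists>K\<ge>0. \<forall>z\<in>cball z0 r. \<forall>w\<in>cball z0 r. norm (f z - f w) \<le> K * norm (z - w)"
proof -
  have "\<exists>K\<ge>0. \<forall>z\<in>cball z0 r. norm (frechet_derivative f (at z) b) \<le> K" for b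
  proof -
    have "continuous_on (cball z0 r) (\<lambda>z. frechet_derivative f (at z) b)"
      using smooth_on_continuous_on[OF smooth_on_frechet_derivative[OF sm]] r continuous_on_subset by blast
    then have "bounded ((\<lambda>z. frechet_derivative f (at z) b) ` cball z0 r)"
      by (intro compact_imp_bounded compact_continuous_image compact_cball)
    then obtain B where "B > 0" "\<forall>x\<in>(\<lambda>z. frechet_derivative f (at z) b) ` cball z0 r. norm x \<le> B"
      unfolding bounded_pos by blast
    then show ?thesis by (intro exI[of _ B]) simp
  qed
  then obtain K where K: "\<And>b. K b \<ge> (0::real)"
    "\<And>b z. z \<in> cball z0 r \<Longrightarrow> norm (frechet_derivative f (at z) b) \<le> K b" by metis
  define C where "C = (\<Sum>b\<in>Basis. K b)"
  have "norm (f z - f w) \<le> C * norm (z - w)" if "z \<in> cball z0 r" "w \<in> cball z0 r" for z w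
  proof (rule differentiable_bound[where S="cball z0 r" and f'="\<lambda>z. frechet_derivative f (at z)"])
    show "(f has_derivative frechet_derivative f (at z)) (at z within cball z0 r)" if "z \<in> cball z0 r" for z
      using smooth_on_has_derivative[OF sm] that r has_derivative_at_withinI by blast
    show "onorm (frechet_derivative f (at z)) \<le> C" if z: "z \<in> cball z0 r" for z
    proof (rule onorm_le)
      fix h :: 'a
      have l: "linear (frechet_derivative f (at z))"
        using smooth_on_linear_derivative[OF sm] z r by blast
      have "frechet_derivative f (at z) h = (\<Sum>b\<in>Basis. (h \<bullet> b) *\<^sub>R frechet_derivative f (at z) b)"
        by (subst euclidean_representation[of h, symmetric]) (simp add: linear_sum[OF l] linear_cmul[OF l])
      also have "norm \<dots> \<le> (\<Sum>b\<in>Basis. \<bar>h \<bullet> b\<bar> * norm (frechet_derivative f (at z) b))"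
        by (rule order_trans[OF norm_sum]) simp
      also have "\<dots> \<le> (\<Sum>b\<in>Basis. norm h * K b)"
        using K z by (intro sum_mono mult_mono) (auto simp: Basis_le_norm)
      also have "\<dots> = C * norm h" unfolding C_def sum_distrib_right by (intro sum.cong refl mult.commute)
      finally show "norm (frechet_derivative f (at z) h) \<le> C * norm h" .
    qed
  qed (use that in auto)
  moreover have "C \<ge> 0" unfolding C_def by (intro sum_nonneg K)
  ultimately show ?thesis by blast
qed

text \<open>Picard-Lindelof through the contraction principle. The interval is symmetric, so that
  the initial time is interior and two-sided derivative tests apply there later.\<close>

lemma ode_local_solution:
  fixes X :: "'a::euclidean_space \<Rightarrow> 'a"
  assumes sm: "smooth_on S X" and z0: "z0 \<in> S"
  shows "\<exists>\<epsilon>>0. \<exists>z. z 0 = z0 \<and> (\<forall>t\<in>{-\<epsilon>..\<epsilon>}. z t \<in> S \<and> (z has_vector_derivative X (z t)) (at t within {-\<epsilon>..\<epsilon>}))"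
proof -
  obtain r where r: "r > 0" "cball z0 r \<subseteq> S"
    using smooth_on_open[OF sm] z0 open_contains_cball by blast
  obtain K where K: "K \<ge> 0" "\<And>z w. z \<in> cball z0 r \<Longrightarrow> w \<in> cball z0 r \<Longrightarrow> norm (X z - X w) \<le> K * norm (z - w)"
    using smooth_on_locally_lipschitz[OF sm r(2)] by blast
  have cX: "continuous_on (cball z0 r) X"
    using smooth_on_continuous_on[OF sm] r(2) continuous_on_subset by blast
  have "bounded (X ` cball z0 r)"
    by (intro compact_imp_bounded compact_continuous_image cX compact_cball)
  then obtain M where M: "M > 0" "\<And>z. z \<in> cball z0 r \<Longrightarrow> norm (X z) \<le> M"
    unfolding bounded_pos by auto
  \<comment> \<open>The bound r / M keeps the iterates in the ball; 1 / (2 (K + 1)) makes the Picard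
    operator a contraction with factor 1/2, the summand 1 covering K = 0.\<close>
  define \<epsilon> where "\<epsilon> = min (r / M) (1 / (2 * (K + 1)))"
  have eps: "\<epsilon> > 0" "M * \<epsilon> \<le> r" "K * \<epsilon> \<le> 1/2"
  proof -
    show "\<epsilon> > 0" using r M K by (simp add: \<epsilon>_def)
    have "\<epsilon> \<le> r / M" by (simp add: \<epsilon>_def)
    then show "M * \<epsilon> \<le> r" using M by (simp add: field_simps)
    have "K * \<epsilon> \<le> K * (1 / (2 * (K + 1)))" using K by (intro mult_left_mono) (auto simp: \<epsilon>_def)
    also have "\<dots> \<le> 1/2" using K by (simp add: field_simps)
    finally show "K * \<epsilon> \<le> 1/2" .
  qed
  let ?I = "{-\<epsilon>..\<epsilon>}"
  \<comment> \<open>time is clamped so that the Picard operator acts on bounded continuous functions on all of \<open>\<real>\<close>\<close>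
  define cl where "cl t = max (-\<epsilon>) (min \<epsilon> t)" for t
  have cl: "cl t \<in> ?I" "\<bar>cl t\<bar> \<le> \<epsilon>" for t using eps by (auto simp: cl_def)
  have ccl: "continuous_on UNIV cl" unfolding cl_def by (intro continuous_intros)
  \<comment> \<open>The primitive starts at the left end because \<open>integral\<close> over an
    interval with reversed ends is zero; subtracting \<open>G f 0\<close> in \<open>Q\<close>
    restores the initial time 0.\<close>
  define G where "G f s = integral {-\<epsilon>..s} (\<lambda>u. X (f u))" for f :: "real \<Rightarrow> 'a" and s
  define Q where "Q f t = z0 + (G f (cl t) - G f 0)" for f :: "real \<Rightarrow> 'a" and t
  define C where "C = PiC (UNIV :: real set) (\<lambda>_. cball z0 r)"
  have inC: "f \<in> C \<longleftrightarrow> (\<forall>t. apply_bcontfun f t \<in> cball z0 r)" for f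
    unfolding C_def mem_PiC_iff by auto
  have dG: "(G f has_vector_derivative X (f t)) (at t within ?I)" if "f \<in> C" "t \<in> ?I" for f t
    unfolding G_def
    using that by (intro integral_has_vector_derivative continuous_on_compose2[OF cX]) (auto simp: inC)
  have Q_in: "Q f t \<in> cball z0 r" if f: "f \<in> C" for f t
  proof -
    have "norm (G f (cl t) - G f 0) \<le> M * \<bar>cl t - 0\<bar>"
      using cl eps f by (intro vector_derivative_bound[where a="-\<epsilon>" and b=\<epsilon>, OF dG[OF f]] M) (auto simp: inC)
    also have "\<dots> \<le> M * \<epsilon>" using cl M by (intro mult_left_mono) auto
    finally show ?thesis using eps by (simp add: Q_def dist_norm norm_minus_commute)
  qed
  have Q_cont: "Q f \<in> bcontfun" if f: "f \<in> C" for f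
  proof -
    have "continuous_on ?I (G f)"
      by (rule continuous_on_vector_derivative[OF dG[OF f]])
    then have "continuous_on UNIV (\<lambda>t. G f (cl t))"
      by (rule continuous_on_compose2[OF _ ccl]) (use cl in auto)
    then have "continuous_on UNIV (Q f)" unfolding Q_def[abs_def] by (intro continuous_intros)
    moreover have "bounded (range (Q f))"
      using Q_in[OF f] by (intro bounded_subset[OF bounded_cball[of z0 r]]) auto
    ultimately show ?thesis by (simp add: bcontfun_def)
  qed
  define \<Phi> where "\<Phi> f = Bcontfun (Q (apply_bcontfun f))" for f
  have \<Phi>: "apply_bcontfun (\<Phi> f) = Q f" if "f \<in> C" for f
    unfolding \<Phi>_def using Q_cont[OF that] by (rule Bcontfun_inverse)
  have "complete C"
    unfolding C_def complete_eq_closed by (rule closed_PiC) (rule closed_cball)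
  moreover have "C \<noteq> {}"
  proof -
    have "const_bcontfun z0 \<in> C" using r by (simp add: inC const_bcontfun.rep_eq)
    then show ?thesis by blast
  qed
  moreover have "\<Phi> ` C \<subseteq> C"
  proof (rule image_subsetI)
    show "\<Phi> f \<in> C" if "f \<in> C" for f
      unfolding inC[of "\<Phi> f"] \<Phi>[OF that] using Q_in[OF that] by blast
  qed
  moreover have "dist (\<Phi> f) (\<Phi> g) \<le> 1/2 * dist f g" if f: "f \<in> C" and g: "g \<in> C" for f g
  proof (rule dist_bound)
    fix t
    have bd: "norm (X (f u) - X (g u)) \<le> K * dist f g" for u
    proof -
      have "norm (X (f u) - X (g u)) \<le> K * norm (f u - g u)" using f g by (intro K) (auto simp: inC)
      also have "\<dots> \<le> K * dist f g" using K dist_bounded[of f u g] by (intro mult_left_mono) (auto simp: dist_norm)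
      finally show ?thesis .
    qed
    have "norm ((\<lambda>s. G f s - G g s) (cl t) - (\<lambda>s. G f s - G g s) 0) \<le> (K * dist f g) * \<bar>cl t - 0\<bar>"
      by (rule vector_derivative_bound[OF has_vector_derivative_diff[OF dG[OF f] dG[OF g]] bd])
        (use cl eps in simp_all)
    also have "\<dots> \<le> (K * dist f g) * \<epsilon>" using cl K by (intro mult_left_mono) auto
    also have "\<dots> = (K * \<epsilon>) * dist f g" by simp
    also have "\<dots> \<le> 1/2 * dist f g" using eps by (intro mult_right_mono) auto
    finally show "dist (\<Phi> f t) (\<Phi> g t) \<le> 1/2 * dist f g"
      unfolding \<Phi>[OF f] \<Phi>[OF g] by (simp add: Q_def dist_norm algebra_simps)
  qed
  ultimately have "\<exists>!f\<in>C. \<Phi> f = f" by (intro Banach_fix[where c="1/2"]) simp_all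
  then obtain f where f: "f \<in> C" "\<Phi> f = f" by blast
  have fQ: "f t = Q f t" for t by (rule fun_cong[OF \<Phi>[OF f(1), unfolded f(2)]])
  have "f 0 = z0" unfolding fQ[of 0] Q_def using eps by (simp add: cl_def)
  moreover have "(f has_vector_derivative X (f t)) (at t within ?I)" if t: "t \<in> ?I" for t
  proof -
    have "((\<lambda>t. z0 + (G f t - G f 0)) has_vector_derivative X (f t)) (at t within ?I)"
      using has_vector_derivative_add[OF has_vector_derivative_const
          has_vector_derivative_diff[OF dG[OF f(1) t] has_vector_derivative_const]] by simp
    then show ?thesis
    proof (rule has_vector_derivative_transform[OF t, rotated])
      fix s assume "s \<in> ?I"
      then have "cl s = s" by (auto simp: cl_def)
      then show "f s = z0 + (G f s - G f 0)" unfolding fQ[of s] Q_def by simp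
    qed
  qed
  moreover have "f t \<in> S" for t using f(1) r(2) by (auto simp: inC)
  ultimately show ?thesis using eps(1) by (intro exI[of _ \<epsilon>] conjI exI[of _ "apply_bcontfun f"] ballI)
qed

section \<open>Geodesics\<close>

abbreviation (input) chart_dom :: "('m, 'n::finite) chart \<Rightarrow> (real^'n) set" where
  "chart_dom ch \<equiv> snd ch ` fst ch"

abbreviation transition :: "('m, 'n::finite) chart \<Rightarrow> ('m, 'n) chart \<Rightarrow> real^'n \<Rightarrow> real^'n" where
  "transition ch ch' \<equiv> snd ch' \<circ> inv_into (fst ch) (snd ch)"

text \<open>The condition that \<open>geodesic\<close> puts on its domain. It makes derivatives
  within the interval unique at every point, end points included.\<close>

definition nondegenerate_interval :: "real set \<Rightarrow> bool" where
  "nondegenerate_interval I \<longleftrightarrow> is_interval I \<and> (\<exists>a b. a < b \<and> a \<in> I \<and> b \<in> I)"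

lemma nondegenerate_interval_Icc: "a < b \<Longrightarrow> nondegenerate_interval {a..b}"
  unfolding nondegenerate_interval_def by (intro conjI exI[of _ a] exI[of _ b]) (simp_all add: is_interval_cc)

lemma at_within_interval_neq_bot:
  assumes "nondegenerate_interval I" "t \<in> I"
  shows "at t within I \<noteq> bot"
proof -
  have "connected I" using assms is_interval_connected_1 by (simp add: nondegenerate_interval_def)
  moreover have "I \<noteq> {x}" for x using assms by (auto simp: nondegenerate_interval_def)
  ultimately show ?thesis using connected_imp_perfect[of I t] assms(2) trivial_limit_within by blast
qed

lemma geodesic_imp:
  assumes "geodesic A F I c"
  shows "nondegenerate_interval I" "continuous_on I c"
  using assms by (auto simp: geodesic_def nondegenerate_interval_def)

lemma has_vector_derivative_chain:
  assumes "(f has_vector_derivative v) (at t within I)" "(T has_derivative T') (at (f t))"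
  shows "((\<lambda>s. T (f s)) has_vector_derivative T' v) (at t within I)"
proof -
  have "((\<lambda>s. T (f s)) has_derivative (\<lambda>h. T' (h *\<^sub>R v))) (at t within I)"
    by (rule has_derivative_compose[OF assms(1)[unfolded has_vector_derivative_def] assms(2)])
  then show ?thesis
    unfolding has_vector_derivative_def linear_cmul[OF has_derivative_linear[OF assms(2)]] .
qed

lemma has_vector_derivative_pair:
  assumes "(f has_vector_derivative u) (at t within I)" "(g has_vector_derivative v) (at t within I)"
  shows "((\<lambda>s. (f s, g s)) has_vector_derivative (u, v)) (at t within I)"
  using has_derivative_Pair[OF assms[unfolded has_vector_derivative_def]]
  by (simp add: has_vector_derivative_def)

lemma continuous_on_near:
  assumes "continuous_on I c" "t \<in> I" "open V" "c t \<in> V"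
  obtains d where "d > (0::real)" "\<And>s. s \<in> I \<Longrightarrow> dist s t < d \<Longrightarrow> c s \<in> V"
proof -
  have "eventually (\<lambda>s. c s \<in> V) (at t within I)"
    using assms topological_tendstoD unfolding continuous_on_def by blast
  then obtain d where "d > 0" "\<forall>s\<in>I. s \<noteq> t \<and> dist s t < d \<longrightarrow> c s \<in> V"
    unfolding eventually_at by blast
  then show thesis using that assms(4) by metis
qed

section \<open>Charts and coordinate changes of tangent vectors\<close>

lemma atlas_chart:
  assumes "smooth_atlas A" "ch \<in> A"
  shows "open (fst ch)" "open (chart_dom ch)" "continuous_on (fst ch) (snd ch)"
    "continuous_on (chart_dom ch) (inv_into (fst ch) (snd ch))" "inj_on (snd ch) (fst ch)"
proof -
  have "is_chart ch" using assms by (auto simp: smooth_atlas_def)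
  then show "open (fst ch)" "open (chart_dom ch)" "continuous_on (fst ch) (snd ch)"
    "continuous_on (chart_dom ch) (inv_into (fst ch) (snd ch))" "inj_on (snd ch) (fst ch)"
    unfolding is_chart_def case_prod_beta homeomorphism_def by (auto intro: inj_on_inverseI)
qed

lemma atlas_inv:
  assumes "smooth_atlas A" "ch \<in> A" "p \<in> fst ch"
  shows "inv_into (fst ch) (snd ch) (snd ch p) = p"
  using atlas_chart(5)[OF assms(1,2)] assms(3) by (rule inv_into_f_f)

lemma atlas_cover:
  assumes "smooth_atlas A"
  shows "\<exists>ch\<in>A. p \<in> fst ch"
proof -
  have "p \<in> \<Union>(fst ` A)" using assms unfolding smooth_atlas_def by blast
  then show ?thesis by blast
qed

lemma atlas_transition_smooth:
  assumes "smooth_atlas A" "ch \<in> A" "ch' \<in> A"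
  shows "smooth_on (snd ch ` (fst ch \<inter> fst ch')) (transition ch ch')"
  using assms unfolding smooth_atlas_def by (cases ch; cases ch') fastforce

lemma atlas_transition_has_derivative:
  assumes "smooth_atlas A" "ch \<in> A" "ch' \<in> A" "p \<in> fst ch \<inter> fst ch'"
  shows "(transition ch ch' has_derivative coord_change ch ch' p) (at (snd ch p))"
  using smooth_on_has_derivative[OF atlas_transition_smooth[OF assms(1-3)], of "snd ch p"] assms(4)
  unfolding coord_change_def[abs_def] case_prod_beta by blast

lemma coord_change_inverse:
  assumes "smooth_atlas A" "ch \<in> A" "ch' \<in> A" "p \<in> fst ch \<inter> fst ch'"
  shows "coord_change ch' ch p (coord_change ch ch' p y) = y"
proof -
  have e: "transition ch ch' (snd ch p) = snd ch' p" using atlas_inv[OF assms(1,2)] assms(4) by simp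
  have "((\<lambda>x. transition ch' ch (transition ch ch' x)) has_derivative (\<lambda>y. coord_change ch' ch p (coord_change ch ch' p y))) (at (snd ch p))"
    using assms(4)
    by (intro has_derivative_compose[OF atlas_transition_has_derivative[OF assms]])
      (use atlas_transition_has_derivative[OF assms(1,3,2), of p] e in \<open>simp add: o_def\<close>)
  then have "((\<lambda>x. x) has_derivative (\<lambda>y. coord_change ch' ch p (coord_change ch ch' p y))) (at (snd ch p))"
  proof (rule has_derivative_transform_within_open)
    show "open (snd ch ` (fst ch \<inter> fst ch'))"
      using smooth_on_open[OF atlas_transition_smooth[OF assms(1-3)]] .
  qed (use assms(4) atlas_inv[OF assms(1,2)] atlas_inv[OF assms(1,3)] in auto)
  from fun_cong[OF has_derivative_unique[OF this has_derivative_ident], of y] show ?thesis .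
qed

lemma coord_change_nonzero:
  assumes "smooth_atlas A" "ch \<in> A" "ch' \<in> A" "p \<in> fst ch \<inter> fst ch'" "y \<noteq> 0"
  shows "coord_change ch ch' p y \<noteq> 0"
proof
  assume "coord_change ch ch' p y = 0"
  then have "coord_change ch' ch p 0 = y" using coord_change_inverse[OF assms(1-4), of y] by simp
  moreover have "coord_change ch' ch p 0 = 0"
    using linear_0[OF has_derivative_linear[OF atlas_transition_has_derivative[OF assms(1,3,2), of p]]] assms(4) by auto
  ultimately show False using assms(5) by simp
qed

lemma finsler_metric_chart:
  assumes "smooth_atlas A" "finsler_metric A F" "ch \<in> A"
  shows "finsler_chart F ch (chart_dom ch)"
proof
  show "open (chart_dom ch)" using atlas_chart[OF assms(1,3)] by blast
qed (use assms(2,3) in \<open>auto simp: finsler_metric_def\<close>)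

lemma finsler_metric_transition:
  assumes "smooth_atlas A" "finsler_metric A F" "ch \<in> A" "ch' \<in> A"
  shows "finsler_transition F ch ch' (chart_dom ch) (chart_dom ch') (transition ch ch') (snd ch ` (fst ch \<inter> fst ch'))"
proof -
  have d: "frechet_derivative (transition ch ch') (at (snd ch p)) = coord_change ch ch' p" for p
    by (auto simp: coord_change_def case_prod_beta)
  have inv: "coord_change ch ch' p (coord_change ch' ch p y) = y" if "p \<in> fst ch \<inter> fst ch'" for p y
    using coord_change_inverse[OF assms(1,4,3)] that by blast
  show ?thesis
  proof (intro finsler_transition.intro finsler_metric_chart[OF assms(1,2,3)]
      finsler_metric_chart[OF assms(1,2,4)] finsler_transition_axioms.intro)
    fix x assume "x \<in> snd ch ` (fst ch \<inter> fst ch')"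
    then obtain p where p: "p \<in> fst ch \<inter> fst ch'" "x = snd ch p" by blast
    show "surj (frechet_derivative (transition ch ch') (at x))"
      unfolding p(2) d by (metis inv[OF p(1)] surjI)
    show "F ch' (transition ch ch' x) (frechet_derivative (transition ch ch') (at x) y) = F ch x y" for y
      unfolding p(2) d using assms p(1) atlas_inv[OF assms(1,3), of p]
      by (simp add: finsler_metric_def)
  qed (use atlas_transition_smooth[OF assms(1,3,4)] atlas_inv[OF assms(1,3)] in auto)
qed

text \<open>Says that local expressions fit together to a function on the slit tangent bundle. Zero
  vectors are left out since the projective factor has no meaning there.\<close>

definition tangent_function :: "('m::topological_space, 'n::finite) chart set
    \<Rightarrow> (('m, 'n) chart \<Rightarrow> real^'n \<Rightarrow> real^'n \<Rightarrow> real) \<Rightarrow> bool" where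
  "tangent_function A \<Phi> \<longleftrightarrow> (\<forall>ch\<in>A. \<forall>ch'\<in>A. \<forall>p\<in>fst ch \<inter> fst ch'. \<forall>y. y \<noteq> 0 \<longrightarrow>
      \<Phi> ch' (snd ch' p) (coord_change ch ch' p y) = \<Phi> ch (snd ch p) y)"

lemma finsler_metric_tangent_function: "finsler_metric A F \<Longrightarrow> tangent_function A F"
  unfolding finsler_metric_def tangent_function_def by blast

section \<open>Velocities, and functions of the velocity, along geodesics\<close>

lemma velocity_transition:
  assumes A: "smooth_atlas A" "ch \<in> A" "ch' \<in> A" and I: "nondegenerate_interval I"
    and c: "continuous_on I c" "t \<in> I" "c t \<in> fst ch \<inter> fst ch'"
    and v: "((snd ch \<circ> c) has_vector_derivative v) (at t within I)"
  shows "((snd ch' \<circ> c) has_vector_derivative coord_change ch ch' (c t) v) (at t within I)"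
proof -
  obtain d where d: "d > 0" "\<And>s. s \<in> I \<Longrightarrow> dist s t < d \<Longrightarrow> c s \<in> fst ch"
    using continuous_on_near[OF c(1,2) atlas_chart(1)[OF A(1,2)]] c(3) by blast
  have "((\<lambda>s. transition ch ch' ((snd ch \<circ> c) s)) has_vector_derivative coord_change ch ch' (c t) v) (at t within I)"
    using has_vector_derivative_chain[OF v] atlas_transition_has_derivative[OF A c(3)] by (simp add: o_def)
  then show ?thesis
    by (rule has_vector_derivative_transform_within[OF _ d(1) c(2)])
      (use d(2) atlas_inv[OF A(1,2)] in simp)
qed

lemma cvel_eq:
  assumes "nondegenerate_interval I" "t \<in> I" "((snd ch \<circ> c) has_vector_derivative v) (at t within I)"
  shows "cvel ch I c t = v"
  unfolding cvel_def by (rule vector_derivative_within[OF at_within_interval_neq_bot[OF assms(1,2)] assms(3)])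

lemma geodesicD:
  assumes "geodesic A F I c" "ch \<in> A" "t \<in> I" "c t \<in> fst ch"
  shows "((snd ch \<circ> c) has_vector_derivative cvel ch I c t) (at t within I)"
    "cvel ch I c t \<noteq> 0"
    "(cvel ch I c has_vector_derivative - 2 *\<^sub>R Gvec F ch (snd ch (c t), cvel ch I c t)) (at t within I)"
proof -
  from assms obtain acc where a: "(snd ch \<circ> c) differentiable (at t within I)" "cvel ch I c t \<noteq> 0"
    "(cvel ch I c has_vector_derivative acc) (at t within I)"
    "acc + 2 *\<^sub>R Gvec F ch (snd ch (c t), cvel ch I c t) = 0"
    unfolding geodesic_def by blast
  show "((snd ch \<circ> c) has_vector_derivative cvel ch I c t) (at t within I)"
    using a(1) unfolding cvel_def vector_derivative_works .
  show "cvel ch I c t \<noteq> 0" by fact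
  have "acc = - 2 *\<^sub>R Gvec F ch (snd ch (c t), cvel ch I c t)" using a(4) by (simp add: eq_neg_iff_add_eq_0)
  then show "(cvel ch I c has_vector_derivative - 2 *\<^sub>R Gvec F ch (snd ch (c t), cvel ch I c t)) (at t within I)"
    using a(3) by simp
qed

lemma geodesic_cvel_transition:
  assumes A: "smooth_atlas A" "ch \<in> A" "ch' \<in> A" and g: "geodesic A F I c" "t \<in> I" "c t \<in> fst ch \<inter> fst ch'"
  shows "cvel ch' I c t = coord_change ch ch' (c t) (cvel ch I c t)"
  using velocity_transition[OF A geodesic_imp[OF g(1)] g(2,3)] geodesicD(1)[OF g(1) A(2) g(2)] g(3)
    cvel_eq[OF geodesic_imp(1)[OF g(1)] g(2)] by blast

text \<open>\<open>speed\<close> picks its chart by choice; chart independence of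
  \<open>\<Phi>\<close> allows any chart around the point. As \<open>\<Phi>\<close> need not be a
  metric, the projective factor and quotients of metrics along a geodesic are also handled as a
  \<open>speed\<close>.\<close>

lemma speed_eq:
  assumes A: "smooth_atlas A" "ch \<in> A" and g: "geodesic A F I c" "t \<in> I" "c t \<in> fst ch"
    and \<Phi>: "tangent_function A \<Phi>"
  shows "speed A \<Phi> I c t = \<Phi> ch (snd ch (c t)) (cvel ch I c t)"
proof -
  define ch' where "ch' = (SOME ch. ch \<in> A \<and> c t \<in> fst ch)"
  have ch': "ch' \<in> A \<and> c t \<in> fst ch'"
    unfolding ch'_def by (rule someI[of _ ch]) (use A g in blast)
  have "speed A \<Phi> I c t = \<Phi> ch' (snd ch' (c t)) (cvel ch' I c t)"
    unfolding speed_def Let_def ch'_def ..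
  also have "cvel ch' I c t = coord_change ch ch' (c t) (cvel ch I c t)"
    using geodesic_cvel_transition[OF A(1,2) _ g(1,2)] ch' g(3) by blast
  also have "\<Phi> ch' (snd ch' (c t)) \<dots> = \<Phi> ch (snd ch (c t)) (cvel ch I c t)"
    using \<Phi> A(2) ch' g(3) geodesicD(2)[OF g(1) A(2) g(2,3)] unfolding tangent_function_def by blast
  finally show ?thesis .
qed

text \<open>The chain rule: the pair of position and velocity moves with the spray, and continuity
  of \<open>c\<close> keeps it in one chart for nearby times.\<close>

lemma speed_has_derivative:
  assumes A: "smooth_atlas A" "ch \<in> A" and M: "finsler_chart F ch (chart_dom ch)"
    and g: "geodesic A F I c" "t \<in> I" "c t \<in> fst ch"
    and \<Phi>: "tangent_function A \<Phi>" "smooth_on (slit (chart_dom ch)) (\<lambda>p. \<Phi> ch (fst p) (snd p))"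
  shows "(speed A \<Phi> I c has_real_derivative
     finsler_chart.spray F ch (\<lambda>p. \<Phi> ch (fst p) (snd p)) (snd ch (c t), cvel ch I c t)) (at t within I)"
proof -
  let ?f = "\<lambda>p. \<Phi> ch (fst p) (snd p)" and ?z = "\<lambda>s. ((snd ch \<circ> c) s, cvel ch I c s)"
  obtain d where d: "d > 0" "\<And>s. s \<in> I \<Longrightarrow> dist s t < d \<Longrightarrow> c s \<in> fst ch"
    using continuous_on_near[OF geodesic_imp(2)[OF g(1)] g(2) atlas_chart(1)[OF A]] g(3) by blast
  note G = geodesicD[OF g(1) A(2) g(2,3)]
  have "(?f has_derivative frechet_derivative ?f (at (?z t))) (at (?z t))"
    using G(2) g(3) by (intro smooth_on_has_derivative[OF \<Phi>(2)]) auto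
  from has_vector_derivative_chain[OF has_vector_derivative_pair[OF G(1,3)] this]
  have "((\<lambda>s. ?f (?z s)) has_vector_derivative finsler_chart.spray F ch ?f (?z t)) (at t within I)"
    by (simp add: finsler_chart.spray_def[OF M])
  then have "(speed A \<Phi> I c has_vector_derivative finsler_chart.spray F ch ?f (?z t)) (at t within I)"
    by (rule has_vector_derivative_transform_within[OF _ d(1) g(2)])
      (use speed_eq[OF A g(1) _ _ \<Phi>(1)] d(2) in simp)
  then show ?thesis by (simp add: has_real_derivative_iff_has_vector_derivative)
qed

text \<open>The equation is verified in one chart only; covariance of the Euler-Lagrange expression
  carries it to every other chart that the curve meets, as the definition of \<open>geodesic\<close>
  demands.\<close>

lemma geodesicI_chart:
  assumes A: "smooth_atlas A" "ch \<in> A" and F: "finsler_metric A F" and I: "nondegenerate_interval I"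
    and x: "\<And>t. t \<in> I \<Longrightarrow> x t \<in> chart_dom ch" and y: "\<And>t. t \<in> I \<Longrightarrow> y t \<noteq> 0"
    and dx: "\<And>t. t \<in> I \<Longrightarrow> (x has_vector_derivative y t) (at t within I)"
    and dy: "\<And>t. t \<in> I \<Longrightarrow> (y has_vector_derivative - 2 *\<^sub>R Gvec F ch (x t, y t)) (at t within I)"
  defines "c \<equiv> inv_into (fst ch) (snd ch) \<circ> x"
  shows "geodesic A F I c" "\<And>t. t \<in> I \<Longrightarrow> c t \<in> fst ch \<and> snd ch (c t) = x t \<and> cvel ch I c t = y t"
proof -
  have c: "c t \<in> fst ch" "snd ch (c t) = x t" if "t \<in> I" for t
    using x[OF that] by (auto simp: c_def inv_into_into f_inv_into_f)
  have dc: "((snd ch \<circ> c) has_vector_derivative y t) (at t within I)" if "t \<in> I" for t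
    by (rule has_vector_derivative_transform[OF that _ dx[OF that]]) (simp add: c(2))
  have cv: "cvel ch I c t = y t" if "t \<in> I" for t by (rule cvel_eq[OF I that dc[OF that]])
  show "c t \<in> fst ch \<and> snd ch (c t) = x t \<and> cvel ch I c t = y t" if "t \<in> I" for t
    using c[OF that] cv[OF that] by blast
  have cont: "continuous_on I c"
    unfolding c_def
    by (rule continuous_on_compose[OF continuous_on_vector_derivative[OF dx]
          continuous_on_subset[OF atlas_chart(4)[OF A]]]) (use x in auto)
  have main: "(snd ch' \<circ> c) differentiable (at t within I) \<and> cvel ch' I c t \<noteq> 0 \<and>
        (\<exists>acc. (cvel ch' I c has_vector_derivative acc) (at t within I) \<and>
               acc + 2 *\<^sub>R Gvec F ch' (snd ch' (c t), cvel ch' I c t) = 0)"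
    if ch': "ch' \<in> A" and t: "t \<in> I" "c t \<in> fst ch'" for ch' t
  proof -
    interpret finsler_transition F ch ch' "chart_dom ch" "chart_dom ch'" "transition ch ch'" "snd ch ` (fst ch \<inter> fst ch')"
      by (rule finsler_metric_transition[OF A(1) F A(2) ch'])
    have DT: "DT (x s) = coord_change ch ch' (c s)" if "s \<in> I" for s
      using c(2)[OF that] by (auto simp: coord_change_def case_prod_beta)
    have V: "((snd ch' \<circ> c) has_vector_derivative coord_change ch ch' (c s) (y s)) (at s within I)"
      if "s \<in> I" "c s \<in> fst ch'" for s
      using c(1)[OF that(1)] that by (intro velocity_transition[OF A ch' I cont _ _ dc]) auto
    have cv': "cvel ch' I c s = snd (lift (x s, y s))" if "s \<in> I" "c s \<in> fst ch'" for s
      using cvel_eq[OF I that(1) V[OF that]] DT[OF that(1)] by (simp add: lift_def)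
    have xW: "x t \<in> snd ch ` (fst ch \<inter> fst ch')" using c[OF t(1)] t(2) by (auto intro!: image_eqI[of _ _ "c t"])
    have lift: "lift (x t, y t) = (snd ch' (c t), cvel ch' I c t)"
      using cv'[OF t] atlas_inv[OF A c(1)[OF t(1)]] c(2)[OF t(1)] by (simp add: lift_def)
    obtain d where d: "d > 0" "\<And>s. s \<in> I \<Longrightarrow> dist s t < d \<Longrightarrow> c s \<in> fst ch'"
      using continuous_on_near[OF cont t(1) atlas_chart(1)[OF A(1) ch'] t(2)] by blast
    let ?a = "D2T (x t) (y t) (y t) + DT (x t) (- 2 *\<^sub>R Gvec F ch (x t, y t))"
    have "((\<lambda>s. snd (lift (x s, y s))) has_vector_derivative ?a) (at t within I)"
      using has_vector_derivative_chain[OF has_vector_derivative_pair[OF dx[OF t(1)] dy[OF t(1)]]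
          has_derivative_snd[OF lift_has_derivative[OF xW]]] by simp
    then have "(cvel ch' I c has_vector_derivative ?a) (at t within I)"
      by (rule has_vector_derivative_transform_within[OF _ d(1) t(1)]) (use cv' d(2) in simp)
    moreover have "?a + 2 *\<^sub>R Gvec F ch' (snd ch' (c t), cvel ch' I c t) = 0"
      using geodesic_equation_transition[OF xW y[OF t(1)], of "- 2 *\<^sub>R Gvec F ch (x t, y t)"]
      unfolding lift by simp
    moreover have "cvel ch' I c t \<noteq> 0"
      using DT_nonzero[OF xW y[OF t(1)]] unfolding cv'[OF t] lift_def by simp
    ultimately show ?thesis using differentiableI_vector[OF V[OF t]] by blast
  qed
  show "geodesic A F I c"
    unfolding geodesic_def using I cont main by (auto simp: nondegenerate_interval_def)
qed

lemma geodesic_exists: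
  assumes A: "smooth_atlas A" "ch \<in> A" and F: "finsler_metric A F" and x0: "x0 \<in> chart_dom ch" and y0: "y0 \<noteq> 0"
  obtains \<epsilon> c where "\<epsilon> > 0" "geodesic A F {-\<epsilon>..\<epsilon>} c" "\<And>t. t \<in> {-\<epsilon>..\<epsilon>} \<Longrightarrow> c t \<in> fst ch"
    "snd ch (c 0) = x0" "cvel ch {-\<epsilon>..\<epsilon>} c 0 = y0"
proof -
  interpret finsler_chart F ch "chart_dom ch" by (rule finsler_metric_chart[OF A(1) F A(2)])
  define X where "X p = (snd p, - 2 *\<^sub>R Gvec F ch p)" for p
  \<comment> \<open>Smoothness of the spray coefficients is available component by component, so the
    vector field is written as a sum of scalar functions times constant vectors.\<close>
  have "X p = (snd p, 0) + (\<Sum>i\<in>UNIV. (0, (- 2 * Gc F ch i p) *\<^sub>R axis i 1))" for p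
  proof -
    have "- 2 *\<^sub>R Gvec F ch p = (\<Sum>i\<in>UNIV. (- 2 * Gc F ch i p) *\<^sub>R axis i 1)"
      by (subst vec_eq_sum_axis) (simp add: Gvec_def)
    moreover have "(\<Sum>i\<in>UNIV. (0 :: real^'b, (- 2 * Gc F ch i p) *\<^sub>R axis i (1::real))) =
        (0, \<Sum>i\<in>UNIV. (- 2 * Gc F ch i p) *\<^sub>R axis i 1)"
      by (simp add: prod_eq_iff fst_sum snd_sum)
    ultimately show ?thesis by (simp add: X_def)
  qed
  moreover have "smooth_on (slit (chart_dom ch)) (\<lambda>p. (snd p, 0 :: real^'b) + (\<Sum>i\<in>UNIV. (0, (- 2 * Gc F ch i p) *\<^sub>R axis i 1)))"
  proof (intro smooth_on_add smooth_on_sum finite slit_open)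
    show "smooth_on (slit (chart_dom ch)) (\<lambda>p. (snd p, 0 :: real^'b))"
      by (intro smooth_on_bounded_linear slit_open bounded_linear_Pair bounded_linear_snd bounded_linear_zero)
    show "smooth_on (slit (chart_dom ch)) (\<lambda>p. (0 :: real^'b, (- 2 * Gc F ch i p) *\<^sub>R axis i (1::real)))" for i
      by (rule smooth_on_bounded_linear_compose[OF _ Gc_smooth, of "\<lambda>r. (0, (- 2 * r) *\<^sub>R axis i 1)"])
        (intro bounded_linear_Pair bounded_linear_zero bounded_linear_scaleR_const bounded_linear_mult_right)
  qed
  ultimately have "smooth_on (slit (chart_dom ch)) X" by presburger
  then obtain \<epsilon> z where \<epsilon>: "\<epsilon> > 0" "z 0 = (x0, y0)"
    "\<And>t. t \<in> {-\<epsilon>..\<epsilon>} \<Longrightarrow> z t \<in> slit (chart_dom ch)"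
    "\<And>t. t \<in> {-\<epsilon>..\<epsilon>} \<Longrightarrow> (z has_vector_derivative X (z t)) (at t within {-\<epsilon>..\<epsilon>})"
    using ode_local_solution[of "slit (chart_dom ch)" X "(x0, y0)"] x0 y0 by auto
  define x where "x t = fst (z t)" for t
  define y where "y t = snd (z t)" for t
  have I: "nondegenerate_interval {-\<epsilon>..\<epsilon>}"
    using \<epsilon>(1) by (intro nondegenerate_interval_Icc) simp
  have zt: "z t = (x t, y t)" for t by (simp add: x_def y_def)
  have dz: "(x has_vector_derivative y t) (at t within {-\<epsilon>..\<epsilon>})"
    "(y has_vector_derivative - 2 *\<^sub>R Gvec F ch (x t, y t)) (at t within {-\<epsilon>..\<epsilon>})" if "t \<in> {-\<epsilon>..\<epsilon>}" for t
    using has_derivative_fst[OF \<epsilon>(4)[OF that, unfolded has_vector_derivative_def]]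
      has_derivative_snd[OF \<epsilon>(4)[OF that, unfolded has_vector_derivative_def]]
    unfolding has_vector_derivative_def x_def[abs_def] y_def[abs_def] X_def by simp_all
  have sl: "x t \<in> chart_dom ch" "y t \<noteq> 0" if "t \<in> {-\<epsilon>..\<epsilon>}" for t
    using \<epsilon>(3)[OF that] unfolding zt by auto
  note G = geodesicI_chart[OF A F I sl dz]
  have "x 0 = x0" "y 0 = y0" using \<epsilon>(2) zt[of 0] by simp_all
  then show thesis
    by (intro that[OF \<epsilon>(1) G(1)]) (use G(2) G(2)[of 0] \<epsilon>(1) in simp_all)
qed

section \<open>Extrema on the sphere bundle and projectively related metrics\<close>

text \<open>The sphere bundle is replaced by finitely many products of a closed coordinate ball with
  the Euclidean unit sphere of its chart, over balls whose interiors cover the manifold. Any tangent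
  vector can be moved to one of these charts and rescaled to unit length without changing
  \<open>h\<close>, so the largest of the finitely many maxima is global.\<close>

lemma sphere_bundle_attains_max:
  fixes A :: "('m::{t2_space, second_countable_topology}, 'n::finite) chart set"
  assumes A: "smooth_atlas A" and cpt: "compact (UNIV :: 'm set)" and h: "tangent_function A h"
    and homog: "\<And>ch x y l. ch \<in> A \<Longrightarrow> x \<in> chart_dom ch \<Longrightarrow> l > 0 \<Longrightarrow> y \<noteq> 0 \<Longrightarrow> h ch x (l *\<^sub>R y) = h ch x y"
    and cont: "\<And>ch. ch \<in> A \<Longrightarrow> continuous_on (slit (chart_dom ch)) (\<lambda>p. h ch (fst p) (snd p))"
  shows "\<exists>ch0\<in>A. \<exists>x0\<in>chart_dom ch0. \<exists>y0. y0 \<noteq> 0 \<and>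
    (\<forall>ch\<in>A. \<forall>x\<in>chart_dom ch. \<forall>y. y \<noteq> 0 \<longrightarrow> h ch x y \<le> h ch0 x0 y0)"
proof -
  have "\<forall>p. \<exists>w. fst w \<in> A \<and> p \<in> fst (fst w) \<and> snd w > 0 \<and> cball (snd (fst w) p) (snd w) \<subseteq> chart_dom (fst w)"
  proof
    fix p
    obtain ch where ch: "ch \<in> A" "p \<in> fst ch" using atlas_cover[OF A] by blast
    then obtain r where "r > 0" "cball (snd ch p) r \<subseteq> chart_dom ch"
      using atlas_chart(2)[OF A ch(1)] open_contains_cball by blast
    then show "\<exists>w. fst w \<in> A \<and> p \<in> fst (fst w) \<and> snd w > 0 \<and> cball (snd (fst w) p) (snd w) \<subseteq> chart_dom (fst w)"
      using ch by (intro exI[of _ "(ch, r)"]) simp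
  qed
  from choice[OF this] obtain w where w: "\<forall>p. fst (w p) \<in> A \<and> p \<in> fst (fst (w p)) \<and> snd (w p) > 0
      \<and> cball (snd (fst (w p)) p) (snd (w p)) \<subseteq> chart_dom (fst (w p))" by blast
  define C where "C p = fst (w p)" for p
  define r where "r p = snd (w p)" for p
  have C: "C p \<in> A" "p \<in> fst (C p)" "r p > 0" "cball (snd (C p) p) (r p) \<subseteq> chart_dom (C p)" for p
    using w unfolding C_def r_def by blast+
  define N where "N p = fst (C p) \<inter> snd (C p) -` ball (snd (C p) p) (r p)" for p
  have N: "open (N p)" "p \<in> N p" for p
  proof -
    have "\<forall>B. open B \<longrightarrow> open (snd (C p) -` B \<inter> fst (C p))"
      using continuous_on_open_vimage[OF atlas_chart(1)[OF A C(1)]] atlas_chart(3)[OF A C(1)] by blast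
    then show "open (N p)" unfolding N_def Int_commute[of "fst (C p)"] by blast
    show "p \<in> N p" unfolding N_def using C(2,3) by simp
  qed
  obtain D where D: "finite D" "UNIV \<subseteq> (\<Union>p\<in>D. N p)"
    by (rule compactE_image[OF cpt, of UNIV N]) (use N in auto)
  have "D \<noteq> {}" using D(2) by blast
  have "\<forall>p. \<exists>z. z \<in> cball (snd (C p) p) (r p) \<times> sphere 0 1 \<and>
     (\<forall>w\<in>cball (snd (C p) p) (r p) \<times> sphere 0 1. h (C p) (fst w) (snd w) \<le> h (C p) (fst z) (snd z))"
  proof
    fix p
    let ?K = "cball (snd (C p) p) (r p) \<times> sphere (0 :: real^'n) 1"
    have "compact ?K" by (intro compact_Times compact_cball compact_sphere)
    moreover have "?K \<noteq> {}" using C(3)[of p] by (auto simp: less_imp_le)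
    moreover have "continuous_on ?K (\<lambda>w. h (C p) (fst w) (snd w))"
      by (rule continuous_on_subset[OF cont[OF C(1)]]) (use C(4) in auto)
    ultimately obtain z where "z \<in> ?K" "\<forall>w\<in>?K. h (C p) (fst w) (snd w) \<le> h (C p) (fst z) (snd z)"
      using continuous_attains_sup[of ?K "\<lambda>w. h (C p) (fst w) (snd w)"] by blast
    then show "\<exists>z. z \<in> ?K \<and> (\<forall>w\<in>?K. h (C p) (fst w) (snd w) \<le> h (C p) (fst z) (snd z))" by blast
  qed
  from choice[OF this] obtain z where z: "\<And>p. z p \<in> cball (snd (C p) p) (r p) \<times> sphere 0 1"
     "\<And>p w. w \<in> cball (snd (C p) p) (r p) \<times> sphere 0 1 \<Longrightarrow> h (C p) (fst w) (snd w) \<le> h (C p) (fst (z p)) (snd (z p))"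
    by blast
  define m where "m p = h (C p) (fst (z p)) (snd (z p))" for p
  have "Max (m ` D) \<in> m ` D" using D(1) \<open>D \<noteq> {}\<close> by (intro Max_in) simp_all
  then obtain p0 where "p0 \<in> D" "Max (m ` D) = m p0" by blast
  moreover have "m p \<le> Max (m ` D)" if "p \<in> D" for p using D(1) that by (intro Max_ge) simp_all
  ultimately have p0: "p0 \<in> D" "\<And>p. p \<in> D \<Longrightarrow> m p \<le> m p0" by simp_all
  show ?thesis
  proof (rule bexI[of _ "C p0"], rule bexI[of _ "fst (z p0)"], rule exI[of _ "snd (z p0)"], intro conjI ballI allI impI)
    show "C p0 \<in> A" by (rule C(1))
    show "fst (z p0) \<in> chart_dom (C p0)" using z(1)[of p0] C(4)[of p0] by auto
    show "snd (z p0) \<noteq> 0" using z(1)[of p0] by auto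
    fix ch x y assume ch: "ch \<in> A" and x: "x \<in> chart_dom ch" and y: "y \<noteq> (0 :: real^'n)"
    obtain q where q: "q \<in> fst ch" "x = snd ch q" using x by blast
    obtain p where p: "p \<in> D" "q \<in> N p" using D(2) by blast
    then have qp: "q \<in> fst ch \<inter> fst (C p)" "snd (C p) q \<in> cball (snd (C p) p) (r p)"
      using q by (auto simp: N_def)
    define v where "v = coord_change ch (C p) q y"
    have v: "v \<noteq> 0" unfolding v_def by (rule coord_change_nonzero[OF A ch C(1) qp(1) y])
    have "h ch x y = h (C p) (snd (C p) q) v"
      using h[unfolded tangent_function_def, rule_format, OF ch C(1) qp(1) y] unfolding q(2) v_def by simp
    also have "\<dots> = h (C p) (snd (C p) q) (inverse (norm v) *\<^sub>R v)"
      using homog[OF C(1)[of p] subsetD[OF C(4) qp(2)], of "inverse (norm v)" v] v by simp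
    also have "\<dots> \<le> m p"
      using z(2)[of "(snd (C p) q, inverse (norm v) *\<^sub>R v)" p] qp(2) v unfolding m_def by simp
    also have "\<dots> \<le> m p0" by (rule p0(2)[OF p(1)])
    finally show "h ch x y \<le> h (C p0) (fst (z p0)) (snd (z p0))" unfolding m_def .
  qed
qed

text \<open>A second derivative test at a maximum of \<open>f\<close>, phrased through half its
  logarithmic derivative: if \<open>p\<close> passed through 0 with positive slope, \<open>f\<close>
  would increase just after time 0.\<close>

lemma critical_point_of_log_derivative:
  fixes f p :: "real \<Rightarrow> real"
  assumes e: "\<epsilon> > 0" and f: "\<And>t. t \<in> {-\<epsilon>..\<epsilon>} \<Longrightarrow> (f has_real_derivative 2 * p t * f t) (at t within {-\<epsilon>..\<epsilon>})"
    and pos: "\<And>t. t \<in> {-\<epsilon>..\<epsilon>} \<Longrightarrow> f t > 0" and p: "(p has_real_derivative d) (at 0 within {-\<epsilon>..\<epsilon>})"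
    and max: "\<And>t. t \<in> {-\<epsilon>..\<epsilon>} \<Longrightarrow> f t \<le> f 0"
  shows "p 0 = 0" "d \<le> 0"
proof -
  have f': "(f has_real_derivative 2 * p t * f t) (at t)" if "-\<epsilon> < t" "t < \<epsilon>" for t
    using f[of t] at_within_Icc_at[OF that] that by simp
  have p': "(p has_real_derivative d) (at 0)"
    using p at_within_Icc_at[of "-\<epsilon>" 0 \<epsilon>] e by simp
  have "2 * p 0 * f 0 = 0"
    by (rule DERIV_local_max[OF f'[of 0] e]) (use e max in \<open>auto simp: abs_less_iff\<close>)
  then show p0: "p 0 = 0" using pos[of 0] e by simp
  show "d \<le> 0"
  proof (rule ccontr)
    assume "\<not> d \<le> 0"
    then obtain \<delta> where \<delta>: "\<delta> > 0" "\<And>h. h > 0 \<Longrightarrow> h < \<delta> \<Longrightarrow> p 0 < p (0 + h)"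
      using DERIV_pos_inc_right[OF p'] by auto
    define t where "t = min \<delta> \<epsilon> / 2"
    have t: "0 < t" "t < \<delta>" "t < \<epsilon>" using \<delta>(1) e by (auto simp: t_def)
    \<comment> \<open>The hypotheses give a derivative of \<open>p\<close> at 0 only. Hence its sign
      just after 0 is used, and the mean value theorem is applied to \<open>f\<close>.\<close>
    obtain \<xi> where \<xi>: "0 < \<xi>" "\<xi> < t" "f t - f 0 = (t - 0) * (2 * p \<xi> * f \<xi>)"
      using MVT2[OF t(1), of f "\<lambda>t. 2 * p t * f t"] f' t e by force
    have "p \<xi> > 0" using \<delta>(2)[of \<xi>] \<xi> t p0 by simp
    moreover have "f \<xi> > 0" using pos \<xi> t by simp
    ultimately have "f t - f 0 > 0" unfolding \<xi>(3) using t(1) by simp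
    then show False using max[of t] t by simp
  qed
qed

section \<open>From common geodesics to spray coefficients that differ by a multiple of y\<close>

lemma Gvec_scale:
  assumes "finsler_chart F ch U" "(x, y) \<in> slit U" "l > 0"
  shows "Gvec F ch (x, l *\<^sub>R y) = l\<^sup>2 *\<^sub>R Gvec F ch (x, y)"
  using homogD[OF finsler_chart.Gc_homog[OF assms(1)] assms(2,3)]
  by (simp add: vec_eq_iff Gvec_def power2_eq_square)

lemma proj_related_sym: "proj_related A F Ft \<Longrightarrow> proj_related A Ft F"
  unfolding proj_related_def by blast

lemma reparam_velocity:
  assumes r: "reparam J I \<sigma>" and g: "geodesic A F I c" "geodesic A Ft J (c \<circ> \<sigma>)"
    and ch: "ch \<in> A" and s: "s \<in> J" "c (\<sigma> s) \<in> fst ch" and d: "(\<sigma> has_real_derivative d) (at s within J)"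
  shows "cvel ch J (c \<circ> \<sigma>) s = d *\<^sub>R cvel ch I c (\<sigma> s)"
proof -
  have I: "\<sigma> ` J = I" using r by (auto simp: reparam_def bij_betw_def)
  then have "\<sigma> s \<in> I" using s by blast
  then have "((snd ch \<circ> c) has_vector_derivative cvel ch I c (\<sigma> s)) (at (\<sigma> s) within \<sigma> ` J)"
    using geodesicD(1)[OF g(1) ch _ s(2)] I by simp
  then have "(((snd ch \<circ> c) \<circ> \<sigma>) has_vector_derivative d *\<^sub>R cvel ch I c (\<sigma> s)) (at s within J)"
    using d by (intro vector_diff_chain_within) (simp_all add: has_real_derivative_iff_has_vector_derivative)
  then show ?thesis
    by (intro cvel_eq[OF geodesic_imp(1)[OF g(2)] s(1)]) (simp add: o_assoc)
qed

text \<open>A geodesic of F is launched in the given direction and reparametrized to a geodesic of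
  Ft. Its acceleration, computed once from the equation of Ft and once from the reparametrized
  equation of F, agrees up to a multiple of the velocity; this is the claim at that tangent
  vector.\<close>

lemma proj_related_parallel:
  assumes A: "smooth_atlas A" "ch \<in> A" and F: "finsler_metric A F" "finsler_metric A Ft"
    and proj: "proj_related A F Ft" and p: "p \<in> slit (chart_dom ch)"
  shows "\<exists>k. Gvec Ft ch p = Gvec F ch p + k *\<^sub>R snd p"
proof -
  obtain x0 y0 where xy: "p = (x0, y0)" "x0 \<in> chart_dom ch" "y0 \<noteq> 0" using p by auto
  obtain \<epsilon> c where c: "\<epsilon> > 0" "geodesic A F {-\<epsilon>..\<epsilon>} c" "\<And>t. t \<in> {-\<epsilon>..\<epsilon>} \<Longrightarrow> c t \<in> fst ch"
    "snd ch (c 0) = x0" "cvel ch {-\<epsilon>..\<epsilon>} c 0 = y0"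
    using geodesic_exists[OF A F(1) xy(2,3)] by metis
  let ?I = "{-\<epsilon>..\<epsilon>}"
  obtain J \<sigma> where r: "reparam J ?I \<sigma>" and g: "geodesic A Ft J (c \<circ> \<sigma>)"
    using proj c(2) unfolding proj_related_def by blast
  have img: "\<sigma> ` J = ?I" using r by (auto simp: reparam_def bij_betw_def)
  obtain d where d: "\<And>s. s \<in> J \<Longrightarrow> d s > 0" "\<And>s. s \<in> J \<Longrightarrow> (\<sigma> has_real_derivative d s) (at s within J)"
    using r unfolding reparam_def by metis
  have inI: "\<sigma> s \<in> ?I" if "s \<in> J" for s using img that by blast
  have ch_s: "c (\<sigma> s) \<in> fst ch" if "s \<in> J" for s using c(3)[OF inI[OF that]] .
  obtain s0 where s0: "s0 \<in> J" "\<sigma> s0 = 0" using img c(1) by (metis atLeastAtMost_iff imageE less_imp_le neg_le_0_iff_le)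
  define Y where "Y = cvel ch J (c \<circ> \<sigma>)"
  define y where "y s = cvel ch ?I c (\<sigma> s)" for s
  have Yy: "Y s = d s *\<^sub>R y s" if "s \<in> J" for s
    unfolding Y_def y_def by (rule reparam_velocity[OF r c(2) g A(2) that ch_s[OF that] d(2)[OF that]])
  have y0: "y s0 = y0" using s0 c(5) by (simp add: y_def)
  have y_nz: "y s \<noteq> 0" if "s \<in> J" for s
    unfolding y_def by (rule geodesicD(2)[OF c(2) A(2) inI[OF that] ch_s[OF that]])
  have "Y s0 = d s0 *\<^sub>R y0" using Yy[OF s0(1)] y0 by simp
  then have dY: "(Y has_vector_derivative - 2 *\<^sub>R Gvec Ft ch (x0, d s0 *\<^sub>R y0)) (at s0 within J)"
    using geodesicD(3)[OF g A(2) s0(1)] ch_s[OF s0(1)] s0(2) c(4) unfolding Y_def[symmetric] by simp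
  have "(cvel ch ?I c has_vector_derivative - 2 *\<^sub>R Gvec F ch (x0, y0)) (at (\<sigma> s0) within \<sigma> ` J)"
    using geodesicD(3)[OF c(2) A(2) inI[OF s0(1)] ch_s[OF s0(1)]] s0(2) c(4,5) unfolding img by simp
  then have "((cvel ch ?I c \<circ> \<sigma>) has_vector_derivative d s0 *\<^sub>R (- 2 *\<^sub>R Gvec F ch (x0, y0))) (at s0 within J)"
    using d(2)[OF s0(1)] by (intro vector_diff_chain_within) (simp_all add: has_real_derivative_iff_has_vector_derivative)
  then have dy: "(y has_vector_derivative d s0 *\<^sub>R (- 2 *\<^sub>R Gvec F ch (x0, y0))) (at s0 within J)"
    unfolding y_def[abs_def] o_def .
  \<comment> \<open>\<open>d\<close> is not known to be continuous, but this quotient is differentiable and agrees with it on \<open>J\<close>\<close>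
  define \<phi> where "\<phi> s = (Y s \<bullet> y s) / (y s \<bullet> y s)" for s
  have \<phi>: "\<phi> s = d s" if "s \<in> J" for s using Yy[OF that] y_nz[OF that] by (simp add: \<phi>_def)
  have "\<phi> differentiable (at s0 within J)"
  proof -
    have "Y differentiable (at s0 within J)" "y differentiable (at s0 within J)"
      using dY dy differentiableI_vector by blast+
    then show ?thesis
      unfolding \<phi>_def[abs_def] using y_nz[OF s0(1)]
      by (intro differentiable_divide differentiable_inner) auto
  qed
  then obtain e where e: "(\<phi> has_vector_derivative e) (at s0 within J)"
    unfolding vector_derivative_works by blast
  have "((\<lambda>s. \<phi> s *\<^sub>R y s) has_vector_derivative \<phi> s0 *\<^sub>R (d s0 *\<^sub>R (- 2 *\<^sub>R Gvec F ch (x0, y0))) + e *\<^sub>R y s0) (at s0 within J)"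
    using has_vector_derivative_scaleR[OF _ dy, of \<phi> e] e
    by (simp add: has_real_derivative_iff_has_vector_derivative)
  then have "(Y has_vector_derivative \<phi> s0 *\<^sub>R (d s0 *\<^sub>R (- 2 *\<^sub>R Gvec F ch (x0, y0))) + e *\<^sub>R y s0) (at s0 within J)"
    by (rule has_vector_derivative_transform[OF s0(1), rotated]) (simp add: Yy \<phi>)
  from vector_derivative_unique_within[OF at_within_interval_neq_bot[OF geodesic_imp(1)[OF g] s0(1)] dY this]
  have eq: "- 2 *\<^sub>R Gvec Ft ch (x0, d s0 *\<^sub>R y0) = (d s0 * d s0) *\<^sub>R (- 2 *\<^sub>R Gvec F ch (x0, y0)) + e *\<^sub>R y0"
    using \<phi>[OF s0(1)] y0 by simp
  let ?d = "d s0"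
  have dp: "?d > 0" using d(1)[OF s0(1)] .
  \<comment> \<open>Homogeneity of degree two moves the speed factor out of the argument, where it
    cancels against the square produced by the reparametrization.\<close>
  have "Gvec Ft ch (x0, ?d *\<^sub>R y0) = ?d\<^sup>2 *\<^sub>R Gvec Ft ch (x0, y0)"
    by (rule Gvec_scale[OF finsler_metric_chart[OF A(1) F(2) A(2)]]) (use xy dp in auto)
  then have "(- 2 * ?d\<^sup>2) *\<^sub>R Gvec Ft ch (x0, y0) = (- 2 * ?d\<^sup>2) *\<^sub>R (Gvec F ch (x0, y0) + (- e / (2 * ?d\<^sup>2)) *\<^sub>R y0)"
    using eq dp by (simp add: power2_eq_square scaleR_add_right algebra_simps)
  then have "Gvec Ft ch (x0, y0) = Gvec F ch (x0, y0) + (- e / (2 * ?d\<^sup>2)) *\<^sub>R y0"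
    using dp by (subst (asm) scaleR_cancel_left) simp
  then show ?thesis unfolding xy(1) snd_conv by blast
qed

lemma speed_pos:
  assumes A: "smooth_atlas A" and g: "geodesic A F I c" "t \<in> I" and E: "finsler_metric A E"
  shows "speed A E I c t > 0"
proof -
  obtain ch where ch: "ch \<in> A" "c t \<in> fst ch" using atlas_cover[OF A] by blast
  show ?thesis
    unfolding speed_eq[OF A ch(1) g ch(2) finsler_metric_tangent_function[OF E]]
    using geodesicD(2)[OF g(1) ch(1) g(2) ch(2)] ch
    by (intro finsler_chart.F_pos[OF finsler_metric_chart[OF A E ch(1)]]) auto
qed

lemma tangent_function_divide:
  "tangent_function A f \<Longrightarrow> tangent_function A g \<Longrightarrow> tangent_function A (\<lambda>ch x y. f ch x y / g ch x y)"
  unfolding tangent_function_def by simp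

lemma speed_divide:
  "speed A (\<lambda>ch x y. f ch x y / g ch x y) I c t = speed A f I c t / speed A g I c t"
  by (simp add: speed_def Let_def)

lemma metric_ratio:
  assumes A: "smooth_atlas A" and F: "finsler_metric A F" and E: "finsler_metric A E"
  shows "tangent_function A (\<lambda>ch x y. E ch x y / F ch x y)"
    and "\<And>ch x y l. ch \<in> A \<Longrightarrow> x \<in> chart_dom ch \<Longrightarrow> l > 0 \<Longrightarrow> y \<noteq> 0 \<Longrightarrow>
      E ch x (l *\<^sub>R y) / F ch x (l *\<^sub>R y) = E ch x y / F ch x y"
    and "\<And>ch. ch \<in> A \<Longrightarrow> continuous_on (slit (chart_dom ch)) (\<lambda>p. E ch (fst p) (snd p) / F ch (fst p) (snd p))"
proof -
  show "tangent_function A (\<lambda>ch x y. E ch x y / F ch x y)"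
    by (intro tangent_function_divide finsler_metric_tangent_function F E)
  fix ch assume ch: "ch \<in> A"
  interpret M: finsler_chart F ch "chart_dom ch" by (rule finsler_metric_chart[OF A F ch])
  interpret T: finsler_chart E ch "chart_dom ch" by (rule finsler_metric_chart[OF A E ch])
  show "E ch x (l *\<^sub>R y) / F ch x (l *\<^sub>R y) = E ch x y / F ch x y"
    if "x \<in> chart_dom ch" "l > 0" "y \<noteq> 0" for x y l
    using M.F_scale[OF that(1,2)] T.F_scale[OF that(1,2)] that by simp
  show "continuous_on (slit (chart_dom ch)) (\<lambda>p. E ch (fst p) (snd p) / F ch (fst p) (snd p))"
  proof (intro smooth_on_continuous_on smooth_on_divide M.F_smooth T.F_smooth)
    show "F ch (fst p) (snd p) \<noteq> 0" if "p \<in> slit (chart_dom ch)" for p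
      using M.Fn_pos[OF that] by (simp add: M.Fn_def)
  qed
qed

section \<open>Projectively related Einstein metrics on a closed manifold\<close>

locale projective_einstein =
  fixes A :: "('m::{t2_space, second_countable_topology}, 'n::finite) chart set"
    and F Ft :: "('m, 'n) chart \<Rightarrow> real^'n \<Rightarrow> real^'n \<Rightarrow> real"
    and lam lamt :: real
  assumes dim: "CARD('n) \<ge> 2"
    and manifold: "closed_manifold A"
    and F: "finsler_metric A F" and Ft: "finsler_metric A Ft"
    and einstein_F: "einstein A F lam" and einstein_Ft: "einstein A Ft lamt"
    and proj: "proj_related A F Ft"
begin

lemma atlas: "smooth_atlas A" and compact_M: "compact (UNIV :: 'm set)"
  using manifold by (simp_all add: closed_manifold_def)

lemma pair: "ch \<in> A \<Longrightarrow> finsler_pair F Ft ch (chart_dom ch)"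
  by (intro finsler_pair.intro finsler_metric_chart[OF atlas F] finsler_metric_chart[OF atlas Ft]
      finsler_pair_axioms.intro proj_related_parallel[OF atlas _ F Ft proj])

definition "Pf ch x y = finsler_pair.P F Ft ch (x, y)"

lemma Pf_eq: "(\<lambda>p. Pf ch (fst p) (snd p)) = finsler_pair.P F Ft ch"
  by (simp add: Pf_def)

lemma spray_Pf:
  assumes ch: "ch \<in> A" and p: "(x, y) \<in> slit (chart_dom ch)"
  shows "finsler_chart.spray F ch (\<lambda>p. Pf ch (fst p) (snd p)) (x, y) =
    (Pf ch x y)\<^sup>2 - lamt * (Ft ch x y)\<^sup>2 + lam * (F ch x y)\<^sup>2"
proof -
  interpret finsler_pair F Ft ch "chart_dom ch" by (rule pair[OF ch])
  let ?n = "real CARD('n) - 1"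
  have "?n * lamt * (Ft ch x y)\<^sup>2 = ?n * lam * (F ch x y)\<^sup>2 + ?n * ((P (x, y))\<^sup>2 - M.spray P (x, y))"
    using Ric_projective[OF p] einstein_F einstein_Ft ch p unfolding einstein_def by auto
  then have "?n * (lamt * (Ft ch x y)\<^sup>2) = ?n * (lam * (F ch x y)\<^sup>2 + ((P (x, y))\<^sup>2 - M.spray P (x, y)))"
    by (simp add: algebra_simps)
  \<comment> \<open>Dimension at least two enters here: n - 1 is cancelled from both Einstein
    conditions.\<close>
  moreover have "?n \<noteq> 0" using dim by simp
  ultimately have "lamt * (Ft ch x y)\<^sup>2 = lam * (F ch x y)\<^sup>2 + ((P (x, y))\<^sup>2 - M.spray P (x, y))"
    by (metis mult_cancel_left)
  then show ?thesis unfolding Pf_eq unfolding Pf_def by simp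
qed

lemma speed_F_derivative:
  assumes g: "geodesic A F I c" "t \<in> I"
  shows "(speed A F I c has_real_derivative 0) (at t within I)"
proof -
  obtain ch where ch: "ch \<in> A" "c t \<in> fst ch" using atlas_cover[OF atlas] by blast
  interpret M: finsler_chart F ch "chart_dom ch" by (rule finsler_metric_chart[OF atlas F ch(1)])
  have "(snd ch (c t), cvel ch I c t) \<in> slit (chart_dom ch)"
    using geodesicD(2)[OF g(1) ch(1) g(2) ch(2)] ch by simp
  from M.spray_F[OF this]
  have "M.spray (\<lambda>p. F ch (fst p) (snd p)) (snd ch (c t), cvel ch I c t) = 0"
    unfolding M.Fn_def[abs_def] .
  then show ?thesis
    using speed_has_derivative[OF atlas ch(1) M.finsler_chart_axioms g ch(2)
        finsler_metric_tangent_function[OF F] M.F_smooth] by simp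
qed

lemma speed_Ft_derivative_chart:
  assumes g: "geodesic A F I c" "t \<in> I" and ch: "ch \<in> A" "c t \<in> fst ch"
  shows "(speed A Ft I c has_real_derivative
     2 * Pf ch (snd ch (c t)) (cvel ch I c t) * Ft ch (snd ch (c t)) (cvel ch I c t)) (at t within I)"
proof -
  interpret finsler_pair F Ft ch "chart_dom ch" by (rule pair[OF ch(1)])
  let ?z = "(snd ch (c t), cvel ch I c t)"
  have "?z \<in> slit (chart_dom ch)"
    using geodesicD(2)[OF g(1) ch(1) g(2) ch(2)] ch by simp
  then have "T.Fn ?z > 0" by (rule T.Fn_pos)
  then have "M.spray T.Fn ?z = 2 * P ?z * T.Fn ?z" by (simp add: P_def)
  then have "M.spray (\<lambda>p. Ft ch (fst p) (snd p)) ?z = 2 * P ?z * T.Fn ?z"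
    unfolding T.Fn_def[abs_def] .
  then show ?thesis
    using speed_has_derivative[OF atlas ch(1) M.finsler_chart_axioms g ch(2)
        finsler_metric_tangent_function[OF Ft] T.F_smooth]
    by (simp add: Pf_def T.Fn_def)
qed

text \<open>Along a geodesic with initial velocity y, the derivative of the Ft-speed at time 0
  equals 2 P Ft in either chart. Uniqueness of derivatives and positivity of Ft give the equality,
  with no transformation of the formula for P.\<close>

lemma Pf_tangent_function: "tangent_function A Pf"
  unfolding tangent_function_def
proof (intro ballI allI impI)
  fix ch ch' p and y :: "real^'n" assume ch: "ch \<in> A" "ch' \<in> A" and p: "p \<in> fst ch \<inter> fst ch'" and y: "y \<noteq> 0"
  obtain \<epsilon> c where c: "\<epsilon> > 0" "geodesic A F {-\<epsilon>..\<epsilon>} c" "\<And>t. t \<in> {-\<epsilon>..\<epsilon>} \<Longrightarrow> c t \<in> fst ch"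
    "snd ch (c 0) = snd ch p" "cvel ch {-\<epsilon>..\<epsilon>} c 0 = y"
    using geodesic_exists[OF atlas ch(1) F, of "snd ch p" y] p y by blast
  have 0: "0 \<in> {-\<epsilon>..\<epsilon>}" using c(1) by simp
  have c0: "c 0 = p" using inj_onD[OF atlas_chart(5)[OF atlas ch(1)] c(4)] c(3)[OF 0] p by blast
  have v: "cvel ch' {-\<epsilon>..\<epsilon>} c 0 = coord_change ch ch' p y"
    using geodesic_cvel_transition[OF atlas ch c(2) 0] p c0 c(5) by simp
  have "2 * Pf ch (snd ch p) y * Ft ch (snd ch p) y =
      2 * Pf ch' (snd ch' p) (coord_change ch ch' p y) * Ft ch' (snd ch' p) (coord_change ch ch' p y)"
  proof (rule vector_derivative_unique_within[OF at_within_interval_neq_bot[OF geodesic_imp(1)[OF c(2)] 0]])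
    show "(speed A Ft {-\<epsilon>..\<epsilon>} c has_vector_derivative 2 * Pf ch (snd ch p) y * Ft ch (snd ch p) y) (at 0 within {-\<epsilon>..\<epsilon>})"
      using speed_Ft_derivative_chart[OF c(2) 0 ch(1)] p c0 c(5)
      by (simp add: has_real_derivative_iff_has_vector_derivative)
    show "(speed A Ft {-\<epsilon>..\<epsilon>} c has_vector_derivative 2 * Pf ch' (snd ch' p) (coord_change ch ch' p y) *
        Ft ch' (snd ch' p) (coord_change ch ch' p y)) (at 0 within {-\<epsilon>..\<epsilon>})"
      using speed_Ft_derivative_chart[OF c(2) 0 ch(2)] p c0 v
      by (simp add: has_real_derivative_iff_has_vector_derivative)
  qed
  moreover have "Ft ch' (snd ch' p) (coord_change ch ch' p y) = Ft ch (snd ch p) y"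
    using finsler_metric_tangent_function[OF Ft] ch p y unfolding tangent_function_def by blast
  moreover have "Ft ch (snd ch p) y > 0"
    using finsler_chart.F_pos[OF finsler_metric_chart[OF atlas Ft ch(1)]] p y by auto
  ultimately show "Pf ch' (snd ch' p) (coord_change ch ch' p y) = Pf ch (snd ch p) y" by simp
qed

lemma speed_Ft_derivative:
  assumes g: "geodesic A F I c" "t \<in> I"
  shows "(speed A Ft I c has_real_derivative 2 * speed A Pf I c t * speed A Ft I c t) (at t within I)"
proof -
  obtain ch where ch: "ch \<in> A" "c t \<in> fst ch" using atlas_cover[OF atlas] by blast
  show ?thesis
    using speed_Ft_derivative_chart[OF g ch]
    by (simp add: speed_eq[OF atlas ch(1) g ch(2)] Pf_tangent_function finsler_metric_tangent_function[OF Ft])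
qed

lemma Pf_smooth: "ch \<in> A \<Longrightarrow> smooth_on (slit (chart_dom ch)) (\<lambda>p. Pf ch (fst p) (snd p))"
  unfolding Pf_eq by (rule finsler_pair.P_smooth[OF pair])

lemma speed_Pf_derivative:
  assumes g: "geodesic A F I c" "t \<in> I"
  shows "(speed A Pf I c has_real_derivative
    (speed A Pf I c t)\<^sup>2 - lamt * (speed A Ft I c t)\<^sup>2 + lam * (speed A F I c t)\<^sup>2) (at t within I)"
proof -
  obtain ch where ch: "ch \<in> A" "c t \<in> fst ch" using atlas_cover[OF atlas] by blast
  have z: "(snd ch (c t), cvel ch I c t) \<in> slit (chart_dom ch)"
    using geodesicD(2)[OF g(1) ch(1) g(2) ch(2)] ch by simp
  show ?thesis
    using speed_has_derivative[OF atlas ch(1) finsler_metric_chart[OF atlas F ch(1)] g ch(2)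
        Pf_tangent_function Pf_smooth[OF ch(1)]]
    by (simp add: speed_eq[OF atlas ch(1) g ch(2)] Pf_tangent_function
        finsler_metric_tangent_function[OF Ft] finsler_metric_tangent_function[OF F] spray_Pf[OF ch(1) z])
qed

lemma speed_F_constant:
  assumes "geodesic A F I c"
  shows "\<exists>k. \<forall>t\<in>I. speed A F I c t = k"
proof (rule has_field_derivative_zero_constant)
  show "convex I" using geodesic_imp(1)[OF assms]
    by (simp add: nondegenerate_interval_def is_interval_convex)
qed (rule speed_F_derivative[OF assms])

text \<open>Everything an extremum argument needs about nearby tangent vectors: along a short
  geodesic, chart-independent functions take values that they attain on nonzero vectors of the one
  chart, so a global bound applies to them.\<close>

lemma geodesic_at:
  assumes "ch \<in> A" "x \<in> chart_dom ch" "y \<noteq> 0"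
  obtains \<epsilon> c where "\<epsilon> > 0" "geodesic A F {-\<epsilon>..\<epsilon>} c"
    "\<And>\<Phi>. tangent_function A \<Phi> \<Longrightarrow> speed A \<Phi> {-\<epsilon>..\<epsilon>} c 0 = \<Phi> ch x y"
    "\<And>\<Phi> t. tangent_function A \<Phi> \<Longrightarrow> t \<in> {-\<epsilon>..\<epsilon>} \<Longrightarrow>
       \<exists>x'\<in>chart_dom ch. \<exists>y'. y' \<noteq> 0 \<and> speed A \<Phi> {-\<epsilon>..\<epsilon>} c t = \<Phi> ch x' y'"
proof -
  obtain \<epsilon> c where c: "\<epsilon> > 0" "geodesic A F {-\<epsilon>..\<epsilon>} c" "\<And>t. t \<in> {-\<epsilon>..\<epsilon>} \<Longrightarrow> c t \<in> fst ch"
    "snd ch (c 0) = x" "cvel ch {-\<epsilon>..\<epsilon>} c 0 = y"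
    using geodesic_exists[OF atlas assms(1) F assms(2,3)] by blast
  note s = speed_eq[OF atlas assms(1) c(2) _ c(3)]
  show thesis
  proof (rule that[OF c(1,2)])
    fix \<Phi> assume \<Phi>: "tangent_function A \<Phi>"
    show "speed A \<Phi> {-\<epsilon>..\<epsilon>} c 0 = \<Phi> ch x y" using s[OF _ _ \<Phi>, of 0] c by simp
    fix t assume t: "t \<in> {-\<epsilon>..\<epsilon>}"
    show "\<exists>x'\<in>chart_dom ch. \<exists>y'. y' \<noteq> 0 \<and> speed A \<Phi> {-\<epsilon>..\<epsilon>} c t = \<Phi> ch x' y'"
      using s[OF t t \<Phi>] c(3)[OF t] geodesicD(2)[OF c(2) assms(1) t c(3)[OF t]] by blast
  qed
qed

lemma ratio_max:
  "\<exists>m>0. lam \<le> lamt * m\<^sup>2 \<and> (\<forall>ch\<in>A. \<forall>x\<in>chart_dom ch. \<forall>y. y \<noteq> 0 \<longrightarrow> Ft ch x y / F ch x y \<le> m)"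
proof -
  let ?h = "\<lambda>ch x y. Ft ch x y / F ch x y"
  note h = metric_ratio[OF atlas F Ft]
  obtain ch x y where z: "ch \<in> A" "x \<in> chart_dom ch" "y \<noteq> 0"
    and max: "\<And>ch' x' y'. ch' \<in> A \<Longrightarrow> x' \<in> chart_dom ch' \<Longrightarrow> y' \<noteq> 0 \<Longrightarrow> ?h ch' x' y' \<le> ?h ch x y"
  proof -
    have "\<exists>ch0\<in>A. \<exists>x0\<in>chart_dom ch0. \<exists>y0. y0 \<noteq> 0 \<and>
        (\<forall>ch\<in>A. \<forall>x\<in>chart_dom ch. \<forall>y. y \<noteq> 0 \<longrightarrow> ?h ch x y \<le> ?h ch0 x0 y0)"
      by (rule sphere_bundle_attains_max[OF atlas compact_M h(1)], (rule h(2); assumption), rule h(3))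
    then show thesis using that by blast
  qed
  obtain \<epsilon> c where c: "\<epsilon> > 0" "geodesic A F {-\<epsilon>..\<epsilon>} c"
    and v: "\<And>\<Phi>. tangent_function A \<Phi> \<Longrightarrow> speed A \<Phi> {-\<epsilon>..\<epsilon>} c 0 = \<Phi> ch x y"
    "\<And>\<Phi> t. tangent_function A \<Phi> \<Longrightarrow> t \<in> {-\<epsilon>..\<epsilon>} \<Longrightarrow>
       \<exists>x'\<in>chart_dom ch. \<exists>y'. y' \<noteq> 0 \<and> speed A \<Phi> {-\<epsilon>..\<epsilon>} c t = \<Phi> ch x' y'"
    using geodesic_at[OF z] by blast
  let ?I = "{-\<epsilon>..\<epsilon>}"
  let ?s = "\<lambda>t. speed A Ft ?I c t / speed A F ?I c t"
  have pos: "speed A Ft ?I c t > 0" "speed A F ?I c t > 0" if "t \<in> ?I" for t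
    using speed_pos[OF atlas c(2) that] F Ft by blast+
  \<comment> \<open>F is constant along the geodesic, so the quotient inherits the logarithmic
    derivative 2 P of Ft.\<close>
  have d: "(?s has_real_derivative 2 * speed A Pf ?I c t * ?s t) (at t within ?I)" if "t \<in> ?I" for t
    using DERIV_divide[OF speed_Ft_derivative[OF c(2) that] speed_F_derivative[OF c(2) that]] pos[OF that]
    by (simp add: field_simps)
  have 0: "0 \<in> ?I" using c(1) by simp
  have le: "?s t \<le> ?s 0" if "t \<in> ?I" for t
    using v(1)[OF h(1)] v(2)[OF h(1) that] max[OF z(1)] unfolding speed_divide by force
  note cp = critical_point_of_log_derivative[OF c(1) d _ speed_Pf_derivative[OF c(2) 0] le]
  have "speed A Pf ?I c 0 = 0" by (rule cp) (use pos in auto)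
  moreover have "(speed A Pf ?I c 0)\<^sup>2 - lamt * (speed A Ft ?I c 0)\<^sup>2 + lam * (speed A F ?I c 0)\<^sup>2 \<le> 0"
    by (rule cp) (use pos in auto)
  ultimately have "lam * (speed A F ?I c 0)\<^sup>2 \<le> lamt * (speed A Ft ?I c 0)\<^sup>2" by simp
  then have "lam \<le> lamt * (?s 0)\<^sup>2"
    using pos[OF 0] by (simp add: power_divide field_simps)
  moreover have "?s 0 = ?h ch x y"
    using v(1)[OF h(1)] unfolding speed_divide by simp
  moreover have "?s 0 > 0" using pos[OF 0] by simp
  ultimately show ?thesis using max by (intro exI[of _ "?s 0"]) simp
qed

text \<open>The sign \<open>s\<close> treats the maximum and the minimum of P / F together. At the
  extremum the derivative s P^2 / F along a geodesic vanishes, so P is zero there and the extremal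
  value is 0.\<close>

lemma projective_factor_le_zero:
  assumes "lam = 0" "lamt = 0" "s = 1 \<or> s = -1" "ch' \<in> A" "x' \<in> chart_dom ch'" "y' \<noteq> 0"
  shows "s * Pf ch' x' y' \<le> 0"
proof -
  let ?h = "\<lambda>ch x y. s * (Pf ch x y / F ch x y)"
  have h1: "tangent_function A ?h"
    using tangent_function_divide[OF Pf_tangent_function finsler_metric_tangent_function[OF F]]
    unfolding tangent_function_def by (simp del: times_divide_eq_right)
  have h2: "?h ch x (l *\<^sub>R y) = ?h ch x y" if "ch \<in> A" "x \<in> chart_dom ch" "l > 0" "y \<noteq> 0" for ch x y l
    using homogD[OF finsler_pair.P_homog[OF pair[OF that(1)]], of x y l] that
      finsler_chart.F_scale[OF finsler_metric_chart[OF atlas F that(1)] that(2,3)]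
    by (simp add: Pf_def)
  have h3: "continuous_on (slit (chart_dom ch)) (\<lambda>p. ?h ch (fst p) (snd p))" if ch: "ch \<in> A" for ch
  proof -
    interpret M: finsler_chart F ch "chart_dom ch" by (rule finsler_metric_chart[OF atlas F ch])
    show ?thesis
    proof (intro smooth_on_continuous_on smooth_on_cmult smooth_on_divide M.F_smooth Pf_smooth ch)
      show "F ch (fst p) (snd p) \<noteq> 0" if "p \<in> slit (chart_dom ch)" for p
        using M.Fn_pos[OF that] by (simp add: M.Fn_def)
    qed
  qed
  obtain ch x y where z: "ch \<in> A" "x \<in> chart_dom ch" "y \<noteq> 0"
    and max: "\<And>ch' x' y'. ch' \<in> A \<Longrightarrow> x' \<in> chart_dom ch' \<Longrightarrow> y' \<noteq> 0 \<Longrightarrow> ?h ch' x' y' \<le> ?h ch x y"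
  proof -
    have "\<exists>ch0\<in>A. \<exists>x0\<in>chart_dom ch0. \<exists>y0. y0 \<noteq> 0 \<and>
        (\<forall>ch\<in>A. \<forall>x\<in>chart_dom ch. \<forall>y. y \<noteq> 0 \<longrightarrow> ?h ch x y \<le> ?h ch0 x0 y0)"
      by (rule sphere_bundle_attains_max[OF atlas compact_M h1], (rule h2; assumption), rule h3)
    then show thesis using that by blast
  qed
  obtain \<epsilon> c where c: "\<epsilon> > 0" "geodesic A F {-\<epsilon>..\<epsilon>} c"
    and v: "\<And>\<Phi>. tangent_function A \<Phi> \<Longrightarrow> speed A \<Phi> {-\<epsilon>..\<epsilon>} c 0 = \<Phi> ch x y"
    "\<And>\<Phi> t. tangent_function A \<Phi> \<Longrightarrow> t \<in> {-\<epsilon>..\<epsilon>} \<Longrightarrow>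
       \<exists>x'\<in>chart_dom ch. \<exists>y'. y' \<noteq> 0 \<and> speed A \<Phi> {-\<epsilon>..\<epsilon>} c t = \<Phi> ch x' y'"
    using geodesic_at[OF z] by blast
  let ?I = "{-\<epsilon>..\<epsilon>}"
  let ?s = "\<lambda>t. s * (speed A Pf ?I c t / speed A F ?I c t)"
  have 0: "0 \<in> ?I" using c(1) by simp
  have pos: "speed A F ?I c 0 > 0" by (rule speed_pos[OF atlas c(2) 0 F])
  have sp: "speed A ?h ?I c t = ?s t" for t by (simp add: speed_def Let_def)
  have "(?s has_real_derivative s * ((speed A Pf ?I c 0)\<^sup>2 / speed A F ?I c 0)) (at 0 within ?I)"
    using DERIV_cmult[OF DERIV_divide[OF speed_Pf_derivative[OF c(2) 0] speed_F_derivative[OF c(2) 0]], of s] pos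
    by (simp add: assms(1,2))
  then have d: "(?s has_real_derivative s * ((speed A Pf ?I c 0)\<^sup>2 / speed A F ?I c 0)) (at 0)"
    using at_within_Icc_at[of "-\<epsilon>" 0 \<epsilon>] c(1) by simp
  have le: "?s t \<le> ?s 0" if "t \<in> ?I" for t
    using v(1)[OF h1] v(2)[OF h1 that] max[OF z(1)] unfolding sp by force
  have "s * ((speed A Pf ?I c 0)\<^sup>2 / speed A F ?I c 0) = 0"
    by (rule DERIV_local_max[OF d c(1)]) (use le in \<open>auto simp: abs_less_iff\<close>)
  then have "speed A Pf ?I c 0 = 0" using pos assms(3) by auto
  then have h0: "?h ch x y = 0" using v(1)[OF h1] unfolding sp by simp
  have "?h ch' x' y' \<le> 0" using max[OF assms(4-6)] unfolding h0 .
  moreover have "F ch' x' y' > 0"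
    by (rule finsler_chart.F_pos[OF finsler_metric_chart[OF atlas F assms(4)] assms(5,6)])
  ultimately show ?thesis by (simp add: divide_le_0_iff)
qed

lemma projective_factor_zero:
  assumes "lam = 0" "lamt = 0" "ch \<in> A" "x \<in> chart_dom ch" "y \<noteq> 0"
  shows "Pf ch x y = 0"
  using projective_factor_le_zero[OF assms(1,2) _ assms(3-5), of 1]
    projective_factor_le_zero[OF assms(1,2) _ assms(3-5), of "-1"] by simp

lemma flat_ratio_constant:
  assumes "lam = 0" "lamt = 0" and g: "geodesic A F I c"
  shows "\<exists>k. \<forall>t\<in>I. speed A F I c t / speed A Ft I c t = k"
proof -
  have "speed A Pf I c t = 0" if t: "t \<in> I" for t
  proof -
    obtain ch where ch: "ch \<in> A" "c t \<in> fst ch" using atlas_cover[OF atlas] by blast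
    then show ?thesis
      unfolding speed_eq[OF atlas ch(1) g t ch(2) Pf_tangent_function]
      using projective_factor_zero[OF assms(1,2) ch(1)] geodesicD(2)[OF g ch(1) t ch(2)] by simp
  qed
  then have d: "(speed A Ft I c has_real_derivative 0) (at t within I)" if "t \<in> I" for t
    using speed_Ft_derivative[OF g that] that by simp
  have "convex I" using geodesic_imp(1)[OF g]
    by (simp add: nondegenerate_interval_def is_interval_convex)
  from has_field_derivative_zero_constant[OF this d] speed_F_constant[OF g] show ?thesis by force
qed

end

section \<open>The spherical case\<close>

text \<open>The reciprocal of the speed turns the nonlinear system for \<open>f\<close> and
  \<open>p\<close> into a linear oscillator of frequency 2 around a constant. The origin
  \<open>t0\<close> of the parameter is free: the constants a and b depend on it, the shape of the
  formula does not.\<close>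

lemma spherical_profile_ode:
  fixes f p :: "real \<Rightarrow> real"
  assumes I: "convex I" "I \<noteq> {}" and pos: "\<And>t. t \<in> I \<Longrightarrow> f t > 0"
    and df: "\<And>t. t \<in> I \<Longrightarrow> (f has_real_derivative 2 * p t * f t) (at t within I)"
    and dp: "\<And>t. t \<in> I \<Longrightarrow> (p has_real_derivative (p t)\<^sup>2 - (f t)\<^sup>2 + 1) (at t within I)"
  shows "\<exists>a b. a > 0 \<and> (\<forall>t\<in>I. f t =
     2 / ((a\<^sup>2 - 1 / a\<^sup>2 - b\<^sup>2) * cos (2 * (t - t0)) + 2 * a * b * sin (2 * (t - t0)) + (a\<^sup>2 + 1 / a\<^sup>2 + b\<^sup>2)))"
proof -
  define w where "w t = 1 / f t" for t
  have w: "w t > 0" "w t * f t = 1" if "t \<in> I" for t using pos[OF that] by (simp_all add: w_def)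
  have dw: "(w has_real_derivative - 2 * p t * w t) (at t within I)" if "t \<in> I" for t
    unfolding w_def[abs_def] using pos[OF that]
    by (auto intro!: derivative_eq_intros df[OF that])
  \<comment> \<open>first integral: \<open>w'' + 4 w = 4 C\<close>\<close>
  define C where "C t = ((p t)\<^sup>2 * w t + f t + w t) / 2" for t
  have "(C has_real_derivative 0) (at t within I)" if t: "t \<in> I" for t
  proof -
    have "(C has_real_derivative
        ((2 * p t * ((p t)\<^sup>2 - (f t)\<^sup>2 + 1)) * w t + (p t)\<^sup>2 * (- 2 * p t * w t) + 2 * p t * f t - 2 * p t * w t) / 2) (at t within I)"
      unfolding C_def[abs_def]
      by (auto intro!: derivative_eq_intros df[OF t] dp[OF t] dw[OF t])
    moreover have "(2 * p t * ((p t)\<^sup>2 - (f t)\<^sup>2 + 1)) * w t + (p t)\<^sup>2 * (- 2 * p t * w t) + 2 * p t * f t - 2 * p t * w t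
        = 2 * p t * f t * (1 - w t * f t)"
      by (simp add: algebra_simps power2_eq_square)
    ultimately show ?thesis using w(2)[OF t] by simp
  qed
  from has_field_derivative_zero_constant[OF I(1) this]
  obtain K where K: "\<And>t. t \<in> I \<Longrightarrow> C t = K" by blast
  \<comment> \<open>\<open>q = - w' / 2\<close>; \<open>U\<close> and \<open>V\<close> below are the Fourier coefficients of \<open>w\<close>\<close>
  define q where "q t = p t * w t" for t
  have dq: "(q has_real_derivative 2 * (w t - K)) (at t within I)" if t: "t \<in> I" for t
  proof -
    have 1: "(q has_real_derivative ((p t)\<^sup>2 - (f t)\<^sup>2 + 1) * w t + p t * (- 2 * p t * w t)) (at t within I)"
      unfolding q_def[abs_def] by (auto intro!: derivative_eq_intros dp[OF t] dw[OF t])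
    have 2: "((p t)\<^sup>2 - (f t)\<^sup>2 + 1) * w t + p t * (- 2 * p t * w t) = - (p t)\<^sup>2 * w t - f t * (w t * f t) + w t"
      by (simp add: algebra_simps power2_eq_square)
    have 3: "- (p t)\<^sup>2 * w t - f t * (w t * f t) + w t = 2 * (w t - K)"
      unfolding K[OF t, symmetric] C_def w(2)[OF t] by (simp add: field_simps)
    show ?thesis by (rule DERIV_cong[OF 1 HOL.trans[OF 2 3]])
  qed
  have dw': "(w has_real_derivative - 2 * q t) (at t within I)" if t: "t \<in> I" for t
    using dw[OF t] by (simp add: q_def mult.assoc)
  \<comment> \<open>The pair (w - K, q) rotates with angular velocity 2; \<open>U\<close> and
    \<open>V\<close> undo this rotation, up to the sign of the second component, and are therefore
    constant.\<close>
  define U where "U t = (w t - K) * cos (2 * (t - t0)) + q t * sin (2 * (t - t0))" for t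
  define V where "V t = (w t - K) * sin (2 * (t - t0)) - q t * cos (2 * (t - t0))" for t
  have dU: "(U has_real_derivative 0) (at t within I)" if t: "t \<in> I" for t
    unfolding U_def[abs_def]
    by (auto intro!: derivative_eq_intros dw'[OF t] dq[OF t] simp: algebra_simps)
  have dV: "(V has_real_derivative 0) (at t within I)" if t: "t \<in> I" for t
    unfolding V_def[abs_def]
    by (auto intro!: derivative_eq_intros dw'[OF t] dq[OF t] simp: algebra_simps)
  obtain \<alpha> where \<alpha>: "\<And>t. t \<in> I \<Longrightarrow> U t = \<alpha>"
    using has_field_derivative_zero_constant[OF I(1) dU] by blast
  obtain \<beta> where \<beta>: "\<And>t. t \<in> I \<Longrightarrow> V t = \<beta>"
    using has_field_derivative_zero_constant[OF I(1) dV] by blast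
  have rotation: "(x * c + y * s) * c + (x * s - y * c) * s = x * (s\<^sup>2 + c\<^sup>2)"
    "(x * c + y * s)\<^sup>2 + (x * s - y * c)\<^sup>2 = (x\<^sup>2 + y\<^sup>2) * (s\<^sup>2 + c\<^sup>2)" for x y c s :: real
    by (simp_all add: algebra_simps power2_eq_square)
  have sol: "w t = \<alpha> * cos (2 * (t - t0)) + \<beta> * sin (2 * (t - t0)) + K" if t: "t \<in> I" for t
  proof -
    let ?c = "cos (2 * (t - t0))" and ?s = "sin (2 * (t - t0))"
    have "\<alpha> * ?c + \<beta> * ?s = (w t - K) * (?s\<^sup>2 + ?c\<^sup>2)"
      unfolding \<alpha>[OF t, symmetric] \<beta>[OF t, symmetric] U_def V_def by (rule rotation(1))
    then show ?thesis by simp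
  qed
  obtain s where s: "s \<in> I" using I(2) by blast
  have K0: "K > 0" unfolding K[OF s, symmetric] C_def using w(1)[OF s] pos[OF s] by (simp add: add_nonneg_pos)
  \<comment> \<open>The relation w f = 1, written in the three constants of the solution. It leaves
    two degrees of freedom, which is why the final formula has only the parameters a and b.\<close>
  have Ksq: "K\<^sup>2 = 1 + \<alpha>\<^sup>2 + \<beta>\<^sup>2"
  proof -
    let ?c = "cos (2 * (s - t0))" and ?s = "sin (2 * (s - t0))"
    have "\<alpha>\<^sup>2 + \<beta>\<^sup>2 = ((w s - K)\<^sup>2 + (q s)\<^sup>2) * (?s\<^sup>2 + ?c\<^sup>2)"
      unfolding \<alpha>[OF s, symmetric] \<beta>[OF s, symmetric] U_def V_def by (rule rotation(2))
    also have "\<dots> = (w s)\<^sup>2 - w s * (2 * K) + K\<^sup>2 + (q s)\<^sup>2" by (simp add: algebra_simps power2_eq_square)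
    also have "2 * K = (p s)\<^sup>2 * w s + f s + w s" unfolding K[OF s, symmetric] C_def by simp
    also have "(w s)\<^sup>2 - w s * ((p s)\<^sup>2 * w s + f s + w s) + K\<^sup>2 + (q s)\<^sup>2 = K\<^sup>2 - w s * f s"
      by (simp add: q_def) (simp add: algebra_simps power2_eq_square)
    finally show ?thesis using w(2)[OF s] by simp
  qed
  have "\<alpha>\<^sup>2 < K\<^sup>2" unfolding Ksq by (simp add: add_pos_nonneg)
  then have "\<bar>\<alpha>\<bar> < K" using K0 by (metis abs_of_pos power2_less_imp_less abs_ge_zero power2_abs)
  then have Ka: "K + \<alpha> > 0" by linarith
  \<comment> \<open>The choice solves a^2 = K + \<alpha> and a b = \<beta>. The remaining
    coefficient is forced by \<open>Ksq\<close>, read as (K + \<alpha>) (K - \<alpha>) = 1 +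
    \<beta>^2.\<close>
  define a where "a = sqrt (K + \<alpha>)"
  define b where "b = \<beta> / a"
  have a: "a > 0" "a\<^sup>2 = K + \<alpha>" using Ka by (simp_all add: a_def)
  have "1 / a\<^sup>2 + b\<^sup>2 = (1 + \<beta>\<^sup>2) / (K + \<alpha>)" using a by (simp add: b_def power_divide add_divide_distrib)
  also have "1 + \<beta>\<^sup>2 = (K - \<alpha>) * (K + \<alpha>)" using Ksq by (simp add: algebra_simps power2_eq_square)
  finally have ab: "1 / a\<^sup>2 + b\<^sup>2 = K - \<alpha>" using Ka by simp
  have e: "a\<^sup>2 - 1 / a\<^sup>2 - b\<^sup>2 = 2 * \<alpha>" "2 * a * b = 2 * \<beta>" "a\<^sup>2 + 1 / a\<^sup>2 + b\<^sup>2 = 2 * K"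
    using ab a by (simp_all add: b_def)
  have "f t = 2 / (2 * \<alpha> * cos (2 * (t - t0)) + 2 * \<beta> * sin (2 * (t - t0)) + 2 * K)" if t: "t \<in> I" for t
  proof -
    have "2 * \<alpha> * cos (2 * (t - t0)) + 2 * \<beta> * sin (2 * (t - t0)) + 2 * K = 2 * w t"
      unfolding sol[OF t] by simp
    then show ?thesis by (simp add: w_def)
  qed
  then show ?thesis unfolding e[symmetric] using a(1) by blast
qed

text \<open>By the double-angle formulas the denominator is twice the squared norm of the plane
  curve (a cos s + b sin s, sin s / a), so the speed formula becomes the angular velocity of that
  curve.\<close>

lemma spherical_profile_eq:
  fixes a b s :: real
  assumes "a > 0"
  shows "2 / ((a\<^sup>2 - 1 / a\<^sup>2 - b\<^sup>2) * cos (2 * s) + 2 * a * b * sin (2 * s) + (a\<^sup>2 + 1 / a\<^sup>2 + b\<^sup>2))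
    = 1 / ((a * cos s + b * sin s)\<^sup>2 + (sin s / a)\<^sup>2)"
proof -
  define k where "k = 1 / a\<^sup>2"
  define X where "X = a\<^sup>2 * (cos s)\<^sup>2 + 2 * a * b * (sin s * cos s) + b\<^sup>2 * (sin s)\<^sup>2 + (sin s)\<^sup>2 * k"
  have c2: "(cos s)\<^sup>2 = 1 - (sin s)\<^sup>2" by (simp add: cos_squared_eq)
  have 1: "(a\<^sup>2 - k - b\<^sup>2) * cos (2 * s) + 2 * a * b * sin (2 * s) + (a\<^sup>2 + k + b\<^sup>2) = 2 * X"
    unfolding X_def cos_double sin_double c2 by (simp add: algebra_simps)
  have 2: "(a * cos s + b * sin s)\<^sup>2 + (sin s / a)\<^sup>2 = X"
    by (simp add: X_def power2_sum power_mult_distrib power_divide k_def algebra_simps)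
  show ?thesis unfolding k_def[symmetric] 1 2 by simp
qed

text \<open>The polar angle of the curve \<open>(a cos s + b sin s, sin s / a)\<close>, whose areal velocity is constant.\<close>

lemma polar_angle:
  fixes a b :: real
  assumes a: "a > 0"
  shows "\<exists>\<theta>. continuous_on {0..pi} \<theta> \<and> \<theta> 0 = 0 \<and> \<theta> pi = pi \<and>
    (\<forall>s\<in>{0<..<pi}. (\<theta> has_real_derivative 1 / ((a * cos s + b * sin s)\<^sup>2 + (sin s / a)\<^sup>2)) (at s))"
proof -
  define u where "u s = a * cos s + b * sin s" for s
  define v where "v s = sin s / a" for s
  define r where "r s = sqrt ((u s)\<^sup>2 + (v s)\<^sup>2)" for s
  have rr: "(u s)\<^sup>2 + (v s)\<^sup>2 > 0" for s
  proof (cases "sin s = 0")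
    case True
    then have "cos s \<noteq> 0" using sin_cos_squared_add[of s] by auto
    then show ?thesis using a True by (simp add: u_def v_def)
  next
    case False
    then show ?thesis using a by (simp add: v_def add_nonneg_pos)
  qed
  have r: "r s > 0" "(r s)\<^sup>2 = (u s)\<^sup>2 + (v s)\<^sup>2" for s
    using rr[of s] by (simp_all add: r_def)
  have le: "\<bar>u s\<bar> \<le> r s" for s unfolding r_def by (rule real_le_rsqrt) simp
  \<comment> \<open>For s between 0 and pi the curve lies in the closed upper half plane, where the
    arc cosine is the polar angle; it runs from (a, 0) to (-a, 0), whence the total angle
    pi.\<close>
  define \<theta> where "\<theta> s = arccos (u s / r s)" for s
  have bd: "-1 \<le> u s / r s" "u s / r s \<le> 1" for s
    using le[of s] r(1)[of s] by (simp_all add: divide_simps abs_le_iff)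
  have "continuous_on {0..pi} \<theta>"
    unfolding \<theta>_def[abs_def]
  proof (rule continuous_on_arccos)
    have cu: "continuous_on {0..pi} u" unfolding u_def[abs_def] by (intro continuous_intros)
    have cv: "continuous_on {0..pi} v" unfolding v_def[abs_def] using a by (intro continuous_intros) simp
    have cr: "continuous_on {0..pi} r" unfolding r_def[abs_def] by (intro continuous_intros cu cv)
    show "continuous_on {0..pi} (\<lambda>s. u s / r s)"
      using r(1) by (intro continuous_on_divide[OF cu cr]) (simp add: less_imp_neq[THEN not_sym])
  qed (use bd in auto)
  moreover have "\<theta> 0 = 0" using a by (simp add: \<theta>_def u_def r_def v_def)
  moreover have "\<theta> pi = pi" using a by (simp add: \<theta>_def u_def r_def v_def)
  \<comment> \<open>Only interior points: at both ends u / r is 1 or -1, where the arc cosine is not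
    differentiable. Continuity there suffices for the fundamental theorem.\<close>
  moreover have "(\<theta> has_real_derivative 1 / ((u s)\<^sup>2 + (v s)\<^sup>2)) (at s)" if s: "s \<in> {0<..<pi}" for s
  proof -
    have vs: "v s > 0" using s a sin_gt_zero[of s] by (simp add: v_def)
    define u' where "u' = - a * sin s + b * cos s"
    define v' where "v' = cos s / a"
    have du: "(u has_real_derivative u') (at s)" unfolding u_def[abs_def] u'_def
      by (auto intro!: derivative_eq_intros)
    have dv: "(v has_real_derivative v') (at s)" unfolding v_def[abs_def] v'_def using a
      by (auto intro!: derivative_eq_intros)
    \<comment> \<open>The areal velocity is normalized to 1 by the factor 1 / a in the second
      component; division by r^2 makes it the angular velocity.\<close>
    have wr: "u s * v' - u' * v s = 1"
    proof -
      have "(a * x + b * y) * (x / a) - (- a * y + b * x) * (y / a) = x\<^sup>2 + y\<^sup>2" for x y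
        using a by (simp add: field_simps power2_eq_square)
      then show ?thesis unfolding u_def v_def u'_def v'_def by simp
    qed
    have "((\<lambda>s. (u s)\<^sup>2 + (v s)\<^sup>2) has_real_derivative 2 * u s * u' + 2 * v s * v') (at s)"
      by (auto intro!: derivative_eq_intros du dv)
    from DERIV_chain2[OF DERIV_real_sqrt[OF rr] this]
    have "(r has_real_derivative inverse (r s) / 2 * (2 * u s * u' + 2 * v s * v')) (at s)"
      unfolding r_def[abs_def] .
    then have dr: "(r has_real_derivative (u s * u' + v s * v') / r s) (at s)"
      by (rule DERIV_cong) (use r(1)[of s] in \<open>simp add: divide_simps\<close>)
    have dq: "((\<lambda>s. u s / r s) has_real_derivative - v s / (r s)^3) (at s)"
    proof (rule DERIV_cong[OF DERIV_divide[OF du dr]])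
      show "r s \<noteq> 0" using r(1)[of s] by simp
      have "u' * r s - u s * ((u s * u' + v s * v') / r s) = (u' * (r s)\<^sup>2 - u s * (u s * u' + v s * v')) / r s"
        using r(1)[of s] by (simp add: field_simps power2_eq_square)
      also have "u' * (r s)\<^sup>2 - u s * (u s * u' + v s * v') = - v s * (u s * v' - u' * v s)"
        unfolding r(2) by (simp add: algebra_simps power2_eq_square)
      finally have "u' * r s - u s * ((u s * u' + v s * v') / r s) = - v s / r s" using wr by simp
      then show "(u' * r s - u s * ((u s * u' + v s * v') / r s)) / (r s * r s) = - v s / (r s)^3"
        by (simp add: power3_eq_cube)
    qed
    have "(u s)\<^sup>2 < (r s)\<^sup>2" using vs by (simp add: r(2))
    then have "\<bar>u s\<bar> < r s" using r(1)[of s] by (metis abs_of_pos power2_less_imp_less abs_ge_zero power2_abs)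
    then have q: "-1 < u s / r s" "u s / r s < 1" using r(1)[of s] by (auto simp: divide_simps abs_less_iff)
    have "1 - (u s / r s)\<^sup>2 = (v s / r s)\<^sup>2"
    proof -
      have "1 - (u s / r s)\<^sup>2 = ((r s)\<^sup>2 - (u s)\<^sup>2) / (r s)\<^sup>2"
        using r(1)[of s] by (simp add: power_divide diff_divide_distrib)
      then show ?thesis unfolding r(2) by (simp add: power_divide r(2))
    qed
    then have sq: "sqrt (1 - (u s / r s)\<^sup>2) = v s / r s"
      using vs r(1)[of s] by simp
    have "(\<theta> has_real_derivative inverse (- sqrt (1 - (u s / r s)\<^sup>2)) * (- v s / (r s)^3)) (at s)"
      unfolding \<theta>_def[abs_def] by (rule DERIV_chain2[OF DERIV_arccos[OF q] dq])
    moreover have "inverse (- sqrt (1 - (u s / r s)\<^sup>2)) * (- v s / (r s)^3) = 1 / ((u s)\<^sup>2 + (v s)\<^sup>2)"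
      unfolding sq r(2)[symmetric] using vs r(1)[of s] by (simp add: field_simps power2_eq_square power3_eq_cube)
    ultimately show ?thesis by simp
  qed
  ultimately show ?thesis unfolding u_def v_def by blast
qed

text \<open>Both end values are attained, and strict monotonicity makes their preimages the end
  points of the domain, which is therefore compact as well.\<close>

lemma reparam_Icc:
  assumes r: "reparam J {\<alpha>..\<beta>} \<sigma>" and le: "\<alpha> \<le> \<beta>"
  obtains \<gamma> \<delta> where "J = {\<gamma>..\<delta>}" "\<gamma> \<le> \<delta>" "\<sigma> \<gamma> = \<alpha>" "\<sigma> \<delta> = \<beta>"
proof -
  have J: "is_interval J" "\<sigma> ` J = {\<alpha>..\<beta>}" "strict_mono_on J \<sigma>"
    using r by (auto simp: reparam_def bij_betw_def)
  have "\<alpha> \<in> \<sigma> ` J" "\<beta> \<in> \<sigma> ` J" using J(2) le by auto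
  then obtain \<gamma> \<delta> where g: "\<gamma> \<in> J" "\<sigma> \<gamma> = \<alpha>" "\<delta> \<in> J" "\<sigma> \<delta> = \<beta>"
    by (elim imageE) simp
  have b: "\<gamma> \<le> s \<and> s \<le> \<delta>" if "s \<in> J" for s
  proof -
    have "\<sigma> s \<in> {\<alpha>..\<beta>}" using J(2) that by blast
    then have "\<not> \<sigma> s < \<sigma> \<gamma>" "\<not> \<sigma> \<delta> < \<sigma> s" using g(2,4) by simp_all
    then have "\<not> s < \<gamma>" "\<not> \<delta> < s"
      using strict_mono_onD[OF J(3) that g(1)] strict_mono_onD[OF J(3) g(3) that] by blast+
    then show ?thesis by simp
  qed
  have "J = {\<gamma>..\<delta>}"
  proof
    show "{\<gamma>..\<delta>} \<subseteq> J"
      using mem_is_interval_1_I[OF J(1) g(1,3)] by auto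
  qed (use b in auto)
  then show thesis using that g b by blast
qed

lemma speed_reparam:
  assumes A: "smooth_atlas A" and E: "finsler_metric A E"
    and r: "reparam J I \<sigma>" and g: "geodesic A F I c" "geodesic A Ft J (c \<circ> \<sigma>)"
    and s: "s \<in> J" and d: "d > 0" "(\<sigma> has_real_derivative d) (at s within J)"
  shows "speed A E J (c \<circ> \<sigma>) s = d * speed A E I c (\<sigma> s)"
proof -
  obtain ch where ch: "ch \<in> A" "c (\<sigma> s) \<in> fst ch" using atlas_cover[OF A] by blast
  have "\<sigma> s \<in> I" using r s by (auto simp: reparam_def bij_betw_def)
  then show ?thesis
    using speed_eq[OF A ch(1) g(2) s _ finsler_metric_tangent_function[OF E]]
      speed_eq[OF A ch(1) g(1) _ ch(2) finsler_metric_tangent_function[OF E]]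
      reparam_velocity[OF r g ch(1) s ch(2) d(2)] ch
      finsler_chart.F_scale[OF finsler_metric_chart[OF A E ch(1)] _ d(1)]
    by simp
qed

context projective_einstein
begin

lemma spherical_speed:
  assumes "lam = 1" "lamt = 1" and g: "geodesic A F I c" and unit: "\<And>t. t \<in> I \<Longrightarrow> speed A F I c t = 1"
  shows "\<exists>a b. a > 0 \<and> (\<forall>t\<in>I. speed A Ft I c t =
     2 / ((a\<^sup>2 - 1 / a\<^sup>2 - b\<^sup>2) * cos (2 * (t - t0)) + 2 * a * b * sin (2 * (t - t0)) + (a\<^sup>2 + 1 / a\<^sup>2 + b\<^sup>2)))"
proof (rule spherical_profile_ode)
  show "convex I" "I \<noteq> {}" using geodesic_imp(1)[OF g]
    by (auto simp: nondegenerate_interval_def is_interval_convex)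
  fix t assume t: "t \<in> I"
  show "speed A Ft I c t > 0" by (rule speed_pos[OF atlas g t Ft])
  show "(speed A Ft I c has_real_derivative 2 * speed A Pf I c t * speed A Ft I c t) (at t within I)"
    by (rule speed_Ft_derivative[OF g t])
  show "(speed A Pf I c has_real_derivative (speed A Pf I c t)\<^sup>2 - (speed A Ft I c t)\<^sup>2 + 1) (at t within I)"
    using speed_Pf_derivative[OF g t] unit[OF t] assms(1,2) by simp
qed

text \<open>With the parameter origin at the left end, the polar angle is a primitive of the
  Ft-speed and grows from 0 to pi over the segment. Both the original curve and its
  reparametrization to a geodesic of Ft are measured by it.\<close>

lemma spherical_length:
  assumes "lam = 1" "lamt = 1" and g: "geodesic A F {\<alpha>..\<beta>} c"
    and unit: "\<And>t. t \<in> {\<alpha>..\<beta>} \<Longrightarrow> speed A F {\<alpha>..\<beta>} c t = 1"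
    and len: "flength A F {\<alpha>..\<beta>} c = pi"
  shows "flength A Ft {\<alpha>..\<beta>} c = pi"
    and "\<exists>\<gamma> \<delta> \<sigma>. reparam {\<gamma>..\<delta>} {\<alpha>..\<beta>} \<sigma> \<and> geodesic A Ft {\<gamma>..\<delta>} (c \<circ> \<sigma>)
       \<and> flength A Ft {\<gamma>..\<delta>} (c \<circ> \<sigma>) = pi"
proof -
  let ?I = "{\<alpha>..\<beta>}"
  have ab: "\<alpha> \<le> \<beta>" using geodesic_imp(1)[OF g] by (auto simp: nondegenerate_interval_def)
  have "flength A F ?I c = integral ?I (\<lambda>t. 1)"
    unfolding flength_def by (rule integral_cong) (rule unit)
  then have \<beta>: "\<beta> = \<alpha> + pi" using len ab by simp
  obtain a b where a: "a > 0" and sp: "\<And>t. t \<in> ?I \<Longrightarrow> speed A Ft ?I c t =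
     2 / ((a\<^sup>2 - 1 / a\<^sup>2 - b\<^sup>2) * cos (2 * (t - \<alpha>)) + 2 * a * b * sin (2 * (t - \<alpha>)) + (a\<^sup>2 + 1 / a\<^sup>2 + b\<^sup>2))"
    using spherical_speed[OF assms(1,2) g unit] by blast
  obtain \<theta> where \<theta>: "continuous_on {0..pi} \<theta>" "\<theta> 0 = 0" "\<theta> pi = pi"
    "\<And>s. s \<in> {0<..<pi} \<Longrightarrow> (\<theta> has_real_derivative 1 / ((a * cos s + b * sin s)\<^sup>2 + (sin s / a)\<^sup>2)) (at s)"
    using polar_angle[OF a, of b] by blast
  define \<Theta> where "\<Theta> t = \<theta> (t - \<alpha>)" for t
  have d\<Theta>: "(\<Theta> has_real_derivative speed A Ft ?I c t) (at t)" if t: "t \<in> {\<alpha><..<\<beta>}" for t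
  proof -
    have "(\<Theta> has_real_derivative 1 / ((a * cos (t - \<alpha>) + b * sin (t - \<alpha>))\<^sup>2 + (sin (t - \<alpha>) / a)\<^sup>2) * 1) (at t)"
      unfolding \<Theta>_def[abs_def]
      by (rule DERIV_chain2[OF \<theta>(4)]) (use t \<beta> in \<open>auto intro!: derivative_eq_intros\<close>)
    then show ?thesis using sp[of t] t spherical_profile_eq[OF a, of b "t - \<alpha>"] by simp
  qed
  have c\<Theta>: "continuous_on ?I \<Theta>"
    unfolding \<Theta>_def[abs_def]
    by (rule continuous_on_compose2[OF \<theta>(1)]) (use \<beta> in \<open>auto intro!: continuous_intros\<close>)
  have ends: "\<Theta> \<alpha> = 0" "\<Theta> \<beta> = pi" using \<theta>(2,3) \<beta> by (simp_all add: \<Theta>_def)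
  have "(speed A Ft ?I c has_integral (\<Theta> \<beta> - \<Theta> \<alpha>)) ?I"
    using d\<Theta> by (intro fundamental_theorem_of_calculus_interior ab c\<Theta>)
      (simp add: has_real_derivative_iff_has_vector_derivative)
  then show "flength A Ft ?I c = pi" unfolding flength_def ends by (simp add: integral_unique)
  obtain J \<sigma> where r: "reparam J ?I \<sigma>" and gt: "geodesic A Ft J (c \<circ> \<sigma>)"
    using proj g unfolding proj_related_def by blast
  obtain \<gamma> \<delta> where J: "J = {\<gamma>..\<delta>}" "\<gamma> \<le> \<delta>" "\<sigma> \<gamma> = \<alpha>" "\<sigma> \<delta> = \<beta>"
    using reparam_Icc[OF r ab] by blast
  have img: "\<sigma> ` J = ?I" and mono: "strict_mono_on J \<sigma>" using r by (auto simp: reparam_def bij_betw_def)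
  have der: "\<exists>d>0. (\<sigma> has_real_derivative d) (at s within J)" if "s \<in> J" for s
    using r that by (simp add: reparam_def)
  have c\<sigma>: "continuous_on J \<sigma>"
    unfolding continuous_on_eq_continuous_within using der DERIV_continuous by blast
  \<comment> \<open>The primitive is composed with \<sigma> instead of changing variables in the
    integral, since the derivative of \<sigma> is not known to be continuous.\<close>
  have "(speed A Ft J (c \<circ> \<sigma>) has_integral ((\<Theta> \<circ> \<sigma>) \<delta> - (\<Theta> \<circ> \<sigma>) \<gamma>)) {\<gamma>..\<delta>}"
  proof (rule fundamental_theorem_of_calculus_interior[OF J(2)])
    show "continuous_on {\<gamma>..\<delta>} (\<Theta> \<circ> \<sigma>)"
      using c\<sigma> c\<Theta> img unfolding J(1) by (intro continuous_on_compose) auto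
    fix s assume s: "s \<in> {\<gamma><..<\<delta>}"
    then have sJ: "s \<in> J" "\<gamma> \<in> J" "\<delta> \<in> J" using J by auto
    obtain d where d: "d > 0" "(\<sigma> has_real_derivative d) (at s within J)" using der[OF sJ(1)] by blast
    then have d': "(\<sigma> has_real_derivative d) (at s)" using s at_within_Icc_at[of \<gamma> s \<delta>] unfolding J(1) by simp
    have "\<sigma> s \<in> {\<alpha><..<\<beta>}"
      using strict_mono_onD[OF mono sJ(2,1)] strict_mono_onD[OF mono sJ(1,3)] s J(3,4) by simp
    from DERIV_chain[OF d\<Theta>[OF this] d']
    have "((\<Theta> \<circ> \<sigma>) has_real_derivative speed A Ft ?I c (\<sigma> s) * d) (at s)" .
    then show "((\<Theta> \<circ> \<sigma>) has_vector_derivative speed A Ft J (c \<circ> \<sigma>) s) (at s)"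
      using speed_reparam[OF atlas Ft r g gt sJ(1) d]
      by (simp add: has_real_derivative_iff_has_vector_derivative mult.commute)
  qed
  then have "flength A Ft {\<gamma>..\<delta>} (c \<circ> \<sigma>) = pi"
    unfolding flength_def using ends J by (simp add: integral_unique)
  then show "\<exists>\<gamma> \<delta> \<sigma>. reparam {\<gamma>..\<delta>} ?I \<sigma> \<and> geodesic A Ft {\<gamma>..\<delta>} (c \<circ> \<sigma>)
       \<and> flength A Ft {\<gamma>..\<delta>} (c \<circ> \<sigma>) = pi"
    using r gt unfolding J(1) by blast
qed

end

theorem theorem1p1:
  fixes A :: "('m::{t2_space, second_countable_topology}, 'n::finite) chart set"
    and F Ft :: "('m, 'n) chart \<Rightarrow> real^'n \<Rightarrow> real^'n \<Rightarrow> real"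
    and lam lamt :: real
  assumes "CARD('n) \<ge> 2"
    and "closed_manifold A"
    and "finsler_metric A F" and "finsler_metric A Ft"
    and "lam \<in> {-1, 0, 1}" and "lamt \<in> {-1, 0, 1}"
    and "einstein A F lam" and "einstein A Ft lamt"
    and "proj_related A F Ft"
  shows "sgn lam = sgn lamt
    \<and> ((lam = 1 \<and> lamt = 1) \<longrightarrow>
         (\<forall>I c. geodesic A F I c \<and> (\<forall>t\<in>I. speed A F I c t = 1) \<longrightarrow>
            (\<exists>a b. a > 0 \<and> (\<forall>t\<in>I. speed A Ft I c t =
               2 / ((a\<^sup>2 - 1 / a\<^sup>2 - b\<^sup>2) * cos (2 * t) + 2 * a * b * sin (2 * t)
                    + (a\<^sup>2 + 1 / a\<^sup>2 + b\<^sup>2)))))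
       \<and> (\<forall>\<alpha> \<beta> c. geodesic A F {\<alpha>..\<beta>} c \<and> (\<forall>t\<in>{\<alpha>..\<beta>}. speed A F {\<alpha>..\<beta>} c t = 1)
              \<and> flength A F {\<alpha>..\<beta>} c = pi \<longrightarrow>
            flength A Ft {\<alpha>..\<beta>} c = pi \<and>
            (\<exists>\<gamma> \<delta> \<sigma>. reparam {\<gamma>..\<delta>} {\<alpha>..\<beta>} \<sigma> \<and> geodesic A Ft {\<gamma>..\<delta>} (c \<circ> \<sigma>)
                     \<and> flength A Ft {\<gamma>..\<delta>} (c \<circ> \<sigma>) = pi)))
    \<and> ((lam = 0 \<and> lamt = 0) \<longrightarrow>
         (\<forall>I c. geodesic A F I c \<or> geodesic A Ft I c \<longrightarrow>
            (\<exists>k. \<forall>t\<in>I. speed A F I c t / speed A Ft I c t = k)))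
    \<and> ((lam = -1 \<and> lamt = -1) \<longrightarrow>
         (\<forall>ch\<in>A. \<forall>x\<in>snd ch ` fst ch. \<forall>y. Ft ch x y = F ch x y))"
proof -
  interpret P: projective_einstein A F Ft lam lamt
    by (rule projective_einstein.intro[OF assms(1-4,7-9)])
  interpret Q: projective_einstein A Ft F lamt lam
    by (rule projective_einstein.intro[OF assms(1,2,4,3,8,7) proj_related_sym[OF assms(9)]])
  obtain m where m: "m > 0" "lam \<le> lamt * m\<^sup>2"
    "\<And>ch x y. ch \<in> A \<Longrightarrow> x \<in> chart_dom ch \<Longrightarrow> y \<noteq> 0 \<Longrightarrow> Ft ch x y / F ch x y \<le> m"
    using P.ratio_max by blast
  obtain k where k: "k > 0" "lamt \<le> lam * k\<^sup>2"
    "\<And>ch x y. ch \<in> A \<Longrightarrow> x \<in> chart_dom ch \<Longrightarrow> y \<noteq> 0 \<Longrightarrow> F ch x y / Ft ch x y \<le> k"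
    using Q.ratio_max by blast
  have pos: "m\<^sup>2 > 0" "k\<^sup>2 > 0" using m(1) k(1) by simp_all
  \<comment> \<open>An inequality x \<le> y q with q positive carries positivity from x to y and
    negativity from y to x. The bounds with m^2 and k^2 point in opposite directions, so each sign
    is carried both ways.\<close>
  have sign: "0 < x \<Longrightarrow> 0 < y" "y < 0 \<Longrightarrow> x < 0" if "x \<le> y * q" "q > 0" for x y q :: real
  proof -
    assume "0 < x"
    then have "0 < y * q" using that(1) by linarith
    then show "0 < y" using that(2) by (simp add: zero_less_mult_iff)
  next
    assume "y < 0"
    then have "y * q < 0" using that(2) by (rule mult_neg_pos)
    then show "x < 0" using that(1) by linarith
  qed
  have same: "sgn lam = sgn lamt"
  proof -
    have iff: "0 < lam \<longleftrightarrow> 0 < lamt" "lam < 0 \<longleftrightarrow> lamt < 0"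
      by (rule iffI, erule sign(1)[OF m(2) pos(1)], erule sign(1)[OF k(2) pos(2)])
        (rule iffI, erule sign(2)[OF k(2) pos(2)], erule sign(2)[OF m(2) pos(1)])
    have zero: "lam = 0 \<longleftrightarrow> \<not> 0 < lam \<and> \<not> lam < 0" "lamt = 0 \<longleftrightarrow> \<not> 0 < lamt \<and> \<not> lamt < 0"
      by linarith+
    show ?thesis unfolding sgn_if zero iff by (rule refl)
  qed
  have i1: "\<exists>a b. a > 0 \<and> (\<forall>t\<in>I. speed A Ft I c t =
      2 / ((a\<^sup>2 - 1 / a\<^sup>2 - b\<^sup>2) * cos (2 * t) + 2 * a * b * sin (2 * t) + (a\<^sup>2 + 1 / a\<^sup>2 + b\<^sup>2)))"
    if "lam = 1 \<and> lamt = 1" "geodesic A F I c \<and> (\<forall>t\<in>I. speed A F I c t = 1)" for I c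
    using P.spherical_speed[of I c 0] that by simp
  have ii: "\<exists>k. \<forall>t\<in>I. speed A F I c t / speed A Ft I c t = k"
    if "lam = 0 \<and> lamt = 0" "geodesic A F I c \<or> geodesic A Ft I c" for I c
  proof -
    from that(1) have l: "lam = 0" "lamt = 0" by simp_all
    show ?thesis
      using that(2)
    proof
      assume "geodesic A F I c"
      then show ?thesis by (rule P.flat_ratio_constant[OF l])
    next
      assume "geodesic A Ft I c"
      from Q.flat_ratio_constant[OF l(2,1) this]
      obtain k where k: "\<forall>t\<in>I. speed A Ft I c t / speed A F I c t = k" by (rule exE)
      show ?thesis
      proof (intro exI ballI)
        fix t assume "t \<in> I"
        then have "1 / (speed A Ft I c t / speed A F I c t) = 1 / k" using k by simp
        then show "speed A F I c t / speed A Ft I c t = 1 / k" by simp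
      qed
    qed
  qed
  have iii: "Ft ch x y = F ch x y" if l: "lam = -1 \<and> lamt = -1" and ch: "ch \<in> A" "x \<in> chart_dom ch" for ch x y
  proof -
    interpret M: finsler_chart F ch "chart_dom ch" by (rule finsler_metric_chart[OF P.atlas P.F ch(1)])
    interpret T: finsler_chart Ft ch "chart_dom ch" by (rule finsler_metric_chart[OF P.atlas P.Ft ch(1)])
    show ?thesis
    proof (cases "y = 0")
      \<comment> \<open>Homogeneity with factor 2 forces both metrics to vanish at zero, where the
        ratio bounds say nothing.\<close>
      case True
      then show ?thesis using M.F_scale[OF ch(2), of 2 0] T.F_scale[OF ch(2), of 2 0] by simp
    next
      case False
      \<comment> \<open>With both constants -1 the extremal inequalities read -1 \<le> - m^2 and -1
        \<le> - k^2, so both ratios of the metrics are at most 1.\<close>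
      have sq: "m\<^sup>2 \<le> 1\<^sup>2" "k\<^sup>2 \<le> 1\<^sup>2" using m(2) k(2) l by simp_all
      have "m \<le> 1" "k \<le> 1"
        by (rule power2_le_imp_le[OF sq(1)], simp) (rule power2_le_imp_le[OF sq(2)], simp)
      then have "Ft ch x y / F ch x y \<le> 1" "F ch x y / Ft ch x y \<le> 1"
        using m(3)[OF ch False] k(3)[OF ch False] by linarith+
      then show ?thesis using M.F_pos[OF ch(2) False] T.F_pos[OF ch(2) False] by simp
    qed
  qed
  show ?thesis
  proof (intro conjI impI allI ballI)
    show "sgn lam = sgn lamt" by (rule same)
  next
    fix I c assume "lam = 1 \<and> lamt = 1" "geodesic A F I c \<and> (\<forall>t\<in>I. speed A F I c t = 1)"
    then show "\<exists>a b. a > 0 \<and> (\<forall>t\<in>I. speed A Ft I c t =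
      2 / ((a\<^sup>2 - 1 / a\<^sup>2 - b\<^sup>2) * cos (2 * t) + 2 * a * b * sin (2 * t) + (a\<^sup>2 + 1 / a\<^sup>2 + b\<^sup>2)))"
      by (rule i1)
  next
    fix \<alpha> \<beta> c
    assume l: "lam = 1 \<and> lamt = 1"
      and c: "geodesic A F {\<alpha>..\<beta>} c \<and> (\<forall>t\<in>{\<alpha>..\<beta>}. speed A F {\<alpha>..\<beta>} c t = 1)
              \<and> flength A F {\<alpha>..\<beta>} c = pi"
    have *: "lam = 1" "lamt = 1" "geodesic A F {\<alpha>..\<beta>} c"
      "\<And>t. t \<in> {\<alpha>..\<beta>} \<Longrightarrow> speed A F {\<alpha>..\<beta>} c t = 1" "flength A F {\<alpha>..\<beta>} c = pi"
      using l c by blast+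
    show "flength A Ft {\<alpha>..\<beta>} c = pi"
      by (rule P.spherical_length(1)[OF *])
    show "\<exists>\<gamma> \<delta> \<sigma>. reparam {\<gamma>..\<delta>} {\<alpha>..\<beta>} \<sigma> \<and> geodesic A Ft {\<gamma>..\<delta>} (c \<circ> \<sigma>)
                     \<and> flength A Ft {\<gamma>..\<delta>} (c \<circ> \<sigma>) = pi"
      by (rule P.spherical_length(2)[OF *])
  next
    fix I c assume "lam = 0 \<and> lamt = 0" "geodesic A F I c \<or> geodesic A Ft I c"
    then show "\<exists>k. \<forall>t\<in>I. speed A F I c t / speed A Ft I c t = k" by (rule ii)
  next
    fix ch x y assume "lam = -1 \<and> lamt = -1" "ch \<in> A" "x \<in> snd ch ` fst ch"
    then show "Ft ch x y = F ch x y" by (rule iii)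
  qed
qed

end
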